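(* For formal variables $T$, $q$ and $u$, $$\sum_{\lambda\in\mathcal{DD}'} u^{-d_\lambda}T^{|\lambda|/2}\prod_{s\in\lambda}\frac{1-u^{-2\varepsilon_s}q^{2h_s}}{1-q^{2h_s}}\prod_{s\in\Delta}\frac{1-uq^{h_s}}{1-u^{-1}q^{h_s}}=\prod_{m,r\ge 1}\frac{1-u^{-1}q^{2(r-1)}T^{m}}{1-uq^{2r}T^{m}}\cdot\frac{\left(1-u^{-2}q^{2r}T^m\right)^{\lceil r/2 \rceil}\left(1-u^2q^{2(r+1)}T^m\right)^{\lceil r/2 \rceil}}{\left(1-q^{2r}T^m\right)^{\lceil (r+1)/2 \rceil}\left(1-q^{2(r+2)}T^m\right)^{\lceil r/2 \rceil}}.$$
   Context: The identity is one of formal power series in $T$. For a partition $\lambda$, $h_s$ is the hook length of a box $s$, $\Delta$ is the set of boxes on the main diagonal of the Ferrers diagram (English convention), $d_\lambda=\max\{s:\lambda_s\ge s\}$ is the Durfee square size ($0$ for the empty partition), and $\varepsilon_s=-1$ if $s$ is strictly below the main diagonal, $\varepsilon_s=1$ otherwise. $\mathcal{DD}$ is the set of partitions with $\lambda_i=\lambda'_i+1$ for $1\le i\le d_\lambda$ ($\lambda'$ the conjugate; the empty partition included), and $\mathcal{DD}'=\{\lambda'\mid\lambda\in\mathcal{DD}\}$. This is the $q$-Nekrasov–Okounkov formula attached to the affine type $B^{(1)}_t$.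
   Formalization: The weight u^{-d_λ} is replaced by (-1)^{d_λ} u^{-d_λ}; as printed the identity fails, since at q=0 the coefficient of T is u^{-1} on the left (only λ=(1,1)) but -u^{-1} on the right. *)

theory Defs
  imports
    "HOL-Analysis.Infinite_Sum"
    "HOL-Computational_Algebra.Polynomial"
    "HOL-Computational_Algebra.Fraction_Field"
    "HOL-Computational_Algebra.Formal_Power_Series"
begin

section \<open>Partitions\<close>

text \<open>A partition is the list of its positive parts in weakly decreasing order. Rows, columns and
  parts are indexed from 1; \<open>part l i\<close> is 0 for every index outside \<open>{1..length l}\<close>.\<close>

definition is_partition :: "nat list \<Rightarrow> bool" where
  "is_partition l \<longleftrightarrow> sorted_wrt (\<ge>) l \<and> 0 \<notin> set l"

definition part :: "nat list \<Rightarrow> nat \<Rightarrow> nat" where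
  "part l i = (if i \<in> {1..length l} then l ! (i - 1) else 0)"

definition conjugate :: "nat list \<Rightarrow> nat list" where
  "conjugate l = map (\<lambda>j. card {i \<in> {1..length l}. j \<le> part l i}) [1..<Suc (part l 1)]"

definition boxes :: "nat list \<Rightarrow> (nat \<times> nat) set" where
  "boxes l = {(i, j). 1 \<le> i \<and> i \<le> length l \<and> 1 \<le> j \<and> j \<le> part l i}"

definition diag_boxes :: "nat list \<Rightarrow> (nat \<times> nat) set" where
  "diag_boxes l = {(i, j) \<in> boxes l. i = j}"

definition hook :: "nat list \<Rightarrow> nat \<times> nat \<Rightarrow> nat" where
  "hook l = (\<lambda>(i, j). (part l i - j) + (part (conjugate l) j - i) + 1)"

text \<open>The index 0 is added so that the maximum exists, with value 0 for the empty partition.\<close>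

definition durfee :: "nat list \<Rightarrow> nat" where
  "durfee l = Max (insert 0 {s \<in> {1..length l}. part l s \<ge> s})"

text \<open>English convention: rows are numbered downwards, so the box in row \<open>i\<close> and column \<open>j\<close> is
  strictly below the main diagonal iff \<open>j < i\<close>.\<close>

definition box_sign :: "nat \<times> nat \<Rightarrow> int" where
  "box_sign = (\<lambda>(i, j). if j < i then - 1 else 1)"

definition DD :: "nat list set" where
  "DD = {l. is_partition l \<and> (\<forall>i \<in> {1..durfee l}. part l i = part (conjugate l) i + 1)}"

definition DD' :: "nat list set" where
  "DD' = conjugate ` DD"

section \<open>Formal variables\<close>

text \<open>The ambient ring is \<open>\<rat>(u)[[q]][[T]]\<close>: negative powers of \<open>u\<close> occur, while \<open>q\<close> and \<open>T\<close>
  are power series variables (the product over \<open>r\<close> needs \<open>q\<close>-adic convergence).\<close>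

type_synonym uqT_series = "rat poly fract fps fps"

definition u_pow :: "int \<Rightarrow> uqT_series" where
  "u_pow k = fps_const (fps_const (Fraction_Field.Fract [:0, 1:] 1 powi k))"

definition var_u :: uqT_series where
  "var_u = u_pow 1"

definition var_q :: uqT_series where
  "var_q = fps_const fps_X"

definition var_T :: uqT_series where
  "var_T = fps_X"

text \<open>The library topology on \<open>'a fps fps\<close> is adic in the outer variable only, with discrete
  coefficients. The product below has infinitely many factors contributing to each power of \<open>T\<close>,
  so convergence is required for each coefficient of \<open>T\<^sup>n\<close> separately, in the \<open>q\<close>-adic topology of
  \<open>'a fps\<close>, and unconditionally (along the net of finite index sets).\<close>

definition fps_has_prod ::
    "('i \<Rightarrow> 'a::comm_ring_1 fps fps) \<Rightarrow> 'i set \<Rightarrow> 'a fps fps \<Rightarrow> bool" where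
  "fps_has_prod f A P \<longleftrightarrow>
     (\<forall>n. ((\<lambda>F. fps_nth (\<Prod>i\<in>F. f i) n) \<longlongrightarrow> fps_nth P n) (finite_subsets_at_top A))"

section \<open>The two sides of the identity\<close>

text \<open>The sum carries the weight \<open>(-u)\<^sup>-\<^sup>d = (-1)\<^sup>d u\<^sup>-\<^sup>d\<close>. The sign cannot be omitted: at \<open>q = 0\<close> the
  product is \<open>\<Prod>m\<ge>1. (1 - u\<^sup>-\<^sup>1 T\<^sup>m)\<close>, whose coefficient of \<open>T\<close> is \<open>- u\<^sup>-\<^sup>1\<close>, while the only partition
  in \<open>DD'\<close> of size 2 is \<open>(1, 1)\<close>, whose weight without sign would be \<open>u\<^sup>-\<^sup>1\<close>.\<close>

definition lhs_term :: "nat list \<Rightarrow> uqT_series" where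
  "lhs_term l =
     (- 1) ^ durfee l * u_pow (- int (durfee l)) * var_T ^ (sum_list l div 2) *
     (\<Prod>s\<in>boxes l. (1 - u_pow (- 2 * box_sign s) * var_q ^ (2 * hook l s)) /
                    (1 - var_q ^ (2 * hook l s))) *
     (\<Prod>s\<in>diag_boxes l. (1 - var_u * var_q ^ hook l s) /
                         (1 - u_pow (- 1) * var_q ^ hook l s))"

definition rhs_factor :: "nat \<Rightarrow> nat \<Rightarrow> uqT_series" where
  "rhs_factor m r =
     (1 - u_pow (- 1) * var_q ^ (2 * (r - 1)) * var_T ^ m) /
     (1 - var_u * var_q ^ (2 * r) * var_T ^ m) *
     (((1 - u_pow (- 2) * var_q ^ (2 * r) * var_T ^ m) ^ nat \<lceil>real r / 2\<rceil> *
       (1 - u_pow 2 * var_q ^ (2 * (r + 1)) * var_T ^ m) ^ nat \<lceil>real r / 2\<rceil>) /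
      ((1 - var_q ^ (2 * r) * var_T ^ m) ^ nat \<lceil>real (r + 1) / 2\<rceil> *
       (1 - var_q ^ (2 * (r + 2)) * var_T ^ m) ^ nat \<lceil>real r / 2\<rceil>))"

end

(* Elements of DD' correspond to finite sets of positive integers, read off the Maya diagram; adding
   the largest element b multiplies the weight by a factor that depends only on b and the smaller
   elements. Put Q = q^2. At u = Q^-t this factor vanishes unless the beads are flush on the abacus
   with 2 t runners, so the sum collapses to a sum over a lattice of charges, an expanded determinant
   of theta functions. Weierstrass' three-term relation evaluates that determinant as a product
   (Macdonald's identity of type C) up to a factor depending on T alone.

   By induction on n, let the coefficients of T^k agree for k < n. The unknown factor has integral
   coefficients, so the difference of the coefficients of T^n is a rational number at every
   u = Q^-t; it is also a Laurent polynomial in u with coefficients in a field of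
   Laurent series in q, hence constant, and it vanishes at t = 1.
   The product itself is handled through its logarithmic derivative in T. *)

theory Submission
  imports "Jordan_Normal_Form.Determinant" "HOL-Computational_Algebra.Formal_Laurent_Series" Defs
begin

section \<open>Doubled distinct partitions\<close>

text \<open>Behind the specialization is a duality. At \<open>x k = Q ^ Suc k\<close> the alternants
  of the expanded determinant, built from powers of \<open>x k\<close> with exponents
  \<open>w r\<close>, can be read as alternants in the powers of \<open>Q\<close> with exponents
  \<open>w r\<close>, and these factor as Weyl denominators of type C. A new bead shifts one
  \<open>w r\<close> by 2 t, so the weight of a bead set is a quotient of two Weyl denominators. The
  rank is n = t - 1, since the runners 0 and t are their own mirror images and carry no charge.

  The obstacle is the constant of Macdonald's identity, here a change-of-basis determinant. It is
  not evaluated but shown to have integer coefficients. This is enough because a nonconstant Laurent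
  polynomial in u picks up growing powers of q along u = Q^-t, which a rational number cannot do. In
  rank 0 both series are 1, and this fixes the last constant.

  Setting u to a power of q needs a field that contains both. Therefore u ranges over all nonzero
  Laurent series in q, and the formal u is recovered as a constant when the coefficients are
  rational functions in u.\<close>

lemma nat_eqI_le: "(\<And>i. 1 \<le> i \<Longrightarrow> i \<le> m \<longleftrightarrow> i \<le> n) \<Longrightarrow> m = (n::nat)"
  by (metis One_nat_def Suc_leI dual_order.refl le_antisym le_zero_eq not_gr_zero)

section \<open>Parts of a partition and conjugation\<close>

lemma part_Cons: "part (x # xs) i = (if i = 0 then 0 else if i = 1 then x else part xs (i - 1))"
  by (cases i) (auto simp: part_def nth_Cons split: nat.splits)

lemma part_Nil [simp]: "part [] i = 0"
  by (simp add: part_def)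

lemma part_0 [simp]: "part l 0 = 0"
  by (simp add: part_def)

lemma part_map_upt:
  "part (map f [1..<Suc n]) i = (if 1 \<le> i \<and> i \<le> n then f i else 0)"
  by (auto simp: part_def simp del: upt_Suc)

lemma part_antimono:
  assumes "is_partition l" "1 \<le> i" "i \<le> j"
  shows "part l j \<le> part l i"
proof (cases "i < j \<and> j \<le> length l")
  case True
  then have "i - 1 < j - 1" "j - 1 < length l" using assms by auto
  with assms(1) have "l ! (i - 1) \<ge> l ! (j - 1)"
    by (auto simp: is_partition_def sorted_wrt_iff_nth_less)
  with True assms show ?thesis by (simp add: part_def)
next
  case False
  with assms show ?thesis by (cases "i = j") (auto simp: part_def)
qed

lemma part_pos_iff:
  assumes "is_partition l"
  shows "0 < part l i \<longleftrightarrow> 1 \<le> i \<and> i \<le> length l"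
proof -
  have "l ! (i - 1) \<noteq> 0" if "1 \<le> i" "i \<le> length l"
  proof -
    have "l ! (i - 1) \<in> set l" using that by (intro nth_mem) auto
    with assms show ?thesis unfolding is_partition_def by metis
  qed
  then show ?thesis by (auto simp: part_def)
qed

lemma is_partitionI:
  assumes "\<And>i. 1 \<le> i \<Longrightarrow> i < length l \<Longrightarrow> part l (Suc i) \<le> part l i"
    and "\<And>i. 1 \<le> i \<Longrightarrow> i \<le> length l \<Longrightarrow> 0 < part l i"
  shows "is_partition l"
proof -
  have "l ! Suc i \<le> l ! i" if "Suc i < length l" for i
    using assms(1)[of "Suc i"] that by (simp add: part_def)
  then have "sorted_wrt (\<ge>) l"
    by (intro iffD2[OF sorted_wrt_iff_nth_Suc_transp]) (auto simp: transp_def)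
  moreover have "l ! i > 0" if "i < length l" for i
    using assms(2)[of "Suc i"] that by (simp add: part_def)
  then have "0 \<notin> set l" by (metis in_set_conv_nth less_irrefl)
  ultimately show ?thesis by (simp add: is_partition_def)
qed

lemma partition_eqI:
  assumes "is_partition l" "is_partition l'" "\<And>i. 1 \<le> i \<Longrightarrow> part l i = part l' i"
  shows "l = l'"
proof -
  have len: "i \<le> length l \<longleftrightarrow> i \<le> length l'" if "1 \<le> i" for i
    using part_pos_iff[OF assms(1), of i] part_pos_iff[OF assms(2), of i] assms(3)[of i] that by simp
  have "length l = length l'"
    by (rule nat_eqI_le) (use len in blast)
  moreover have "l ! i = l' ! i" if "i < length l" for i
    using assms(3)[of "Suc i"] that \<open>length l = length l'\<close> by (simp add: part_def)
  ultimately show ?thesis by (rule nth_equalityI)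
qed

text \<open>By monotonicity the rows of length at least \<open>j\<close> form an initial segment, so
  their number is also the index of the last one. Later arguments about conjugates use this
  equivalence in place of the counting definition.\<close>

lemma part_conjugate_iff:
  assumes "is_partition l" "1 \<le> i" "1 \<le> j"
  shows "i \<le> part (conjugate l) j \<longleftrightarrow> j \<le> part l i"
proof -
  let ?C = "{i \<in> {1..length l}. j \<le> part l i}"
  have ex: "\<exists>k \<le> length l. ?C = {1..k}"
  proof (cases "?C = {}")
    case True
    then show ?thesis by (intro exI[of _ 0]) auto
  next
    case False
    have fin: "finite ?C" by simp
    let ?k = "Max ?C"
    have k: "?k \<in> ?C" using Max_in[OF fin False] .
    have "?C = {1..?k}"
    proof
      show "?C \<subseteq> {1..?k}" using Max_ge[OF fin] by auto
      show "{1..?k} \<subseteq> ?C"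
      proof
        fix x assume x: "x \<in> {1..?k}"
        then have "part l ?k \<le> part l x" using assms(1) by (intro part_antimono) auto
        with k x show "x \<in> ?C" by auto
      qed
    qed
    with k show ?thesis by (intro exI[of _ ?k]) auto
  qed
  then obtain k where k: "?C = {1..k}" "k \<le> length l" by blast
  have part: "part (conjugate l) j = k"
  proof (cases "j \<le> part l 1")
    case True
    then show ?thesis using assms(3) k(1) unfolding conjugate_def part_map_upt by simp
  next
    case False
    have "?C = {}"
    proof (rule ccontr)
      assume "?C \<noteq> {}"
      then obtain x where "1 \<le> x" "j \<le> part l x" by auto
      with part_antimono[OF assms(1) order_refl \<open>1 \<le> x\<close>] False show False by simp
    qed
    with k(1) have "k = 0" by simp
    with False show ?thesis unfolding conjugate_def part_map_upt by simp
  qed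
  show ?thesis
  proof (cases "i \<le> length l")
    case True
    then have "j \<le> part l i \<longleftrightarrow> i \<in> {1..k}" using k(1) assms by (metis (no_types, lifting) atLeastAtMost_iff mem_Collect_eq)
    then show ?thesis using part assms by simp
  next
    case False
    then show ?thesis using part k(2) assms(3) by (simp add: part_def)
  qed
qed

lemma is_partition_conjugate:
  assumes "is_partition l"
  shows "is_partition (conjugate l)"
proof (rule is_partitionI)
  fix i :: nat assume i: "1 \<le> i"
  show "part (conjugate l) (Suc i) \<le> part (conjugate l) i"
  proof (cases "part (conjugate l) (Suc i) = 0")
    case False
    then have "Suc i \<le> part l (part (conjugate l) (Suc i))"
      using part_conjugate_iff[OF assms, of "part (conjugate l) (Suc i)" "Suc i"] by simp
    then show ?thesis
      using part_conjugate_iff[OF assms, of "part (conjugate l) (Suc i)" i] False i by simp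
  qed simp
next
  fix i assume i: "1 \<le> i" "i \<le> length (conjugate l)"
  then have "i \<le> part l 1" by (simp add: conjugate_def del: upt_Suc)
  then show "0 < part (conjugate l) i"
    using part_conjugate_iff[OF assms, of 1 i] i by simp
qed

lemma conjugate_eqI:
  assumes "is_partition l" "is_partition l'"
    and "\<And>i j. 1 \<le> i \<Longrightarrow> 1 \<le> j \<Longrightarrow> i \<le> part l' j \<longleftrightarrow> j \<le> part l i"
  shows "conjugate l = l'"
proof (rule partition_eqI[OF is_partition_conjugate[OF assms(1)] assms(2)])
  fix j :: nat assume j: "1 \<le> j"
  show "part (conjugate l) j = part l' j"
    by (rule nat_eqI_le) (use assms(3) part_conjugate_iff[OF assms(1)] j in blast)
qed

section \<open>Frobenius coordinates of doubled distinct partitions\<close>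

definition strict :: "nat list \<Rightarrow> bool" where
  "strict bs \<longleftrightarrow> sorted_wrt (>) bs \<and> 0 \<notin> set bs"

lemma strict_Nil [simp]: "strict []"
  by (simp add: strict_def)

lemma strict_pos: "strict bs \<Longrightarrow> c \<in> set bs \<Longrightarrow> 0 < c"
  by (auto simp: strict_def intro: gr0I)

lemma strict_Cons: "strict (b # bs) \<longleftrightarrow> 0 < b \<and> (\<forall>c \<in> set bs. c < b) \<and> strict bs"
  by (auto simp: strict_def)

text \<open>In Frobenius notation \<open>DD_of bs\<close> is \<open>(b\<^sub>1, b\<^sub>2, \<dots> | b\<^sub>1 - 1, b\<^sub>2 - 1, \<dots>)\<close>, and \<open>DD'_of bs\<close> is
  its conjugate; both are built by wrapping principal hooks around the smaller diagram.\<close>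

fun DD_of :: "nat list \<Rightarrow> nat list" where
  "DD_of [] = []"
| "DD_of (b # bs) = Suc b # map (\<lambda>i. Suc (part (DD_of bs) i)) [1..<b]"

fun DD'_of :: "nat list \<Rightarrow> nat list" where
  "DD'_of [] = []"
| "DD'_of (b # bs) = b # map (\<lambda>i. Suc (part (DD'_of bs) i)) [1..<Suc b]"

lemma part_DD'_of_Cons:
  "part (DD'_of (b # bs)) i =
     (if i = 0 then 0 else if i = 1 then b else if i \<le> Suc b then Suc (part (DD'_of bs) (i - 1)) else 0)"
  unfolding DD'_of.simps part_Cons part_map_upt by auto

lemma part_DD_of_Cons:
  "part (DD_of (b # bs)) i =
     (if i = 0 then 0 else if i = 1 then Suc b else if i \<le> b then Suc (part (DD_of bs) (i - 1)) else 0)"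
  by (cases b; cases i) (auto simp: part_Cons part_def simp del: upt_Suc)

lemma part_DD'_of_eq_0: "\<forall>c \<in> set bs. c < b \<Longrightarrow> b < i \<Longrightarrow> part (DD'_of bs) i = 0"
  by (cases bs) (auto simp: part_DD'_of_Cons simp del: DD'_of.simps(2))

lemma part_DD_of_eq_0:
  "0 < b \<Longrightarrow> \<forall>c \<in> set bs. 0 < c \<and> c < b \<Longrightarrow> b \<le> i \<Longrightarrow> part (DD_of bs) i = 0"
  by (cases bs) (auto simp: part_DD_of_Cons simp del: DD_of.simps(2))

lemma length_DD'_of_Cons: "length (DD'_of (b # bs)) = Suc b"
  by simp

lemma length_DD_of_Cons: "0 < b \<Longrightarrow> length (DD_of (b # bs)) = b"
  by simp

lemma part_DD'_of_le: "strict bs \<Longrightarrow> \<forall>c \<in> set bs. c < b \<Longrightarrow> 0 < b \<Longrightarrow> part (DD'_of bs) i < b"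
proof (induction bs arbitrary: b i)
  case (Cons a bs)
  then have "part (DD'_of bs) (i - 1) < a" by (auto simp: strict_Cons)
  with Cons.prems show ?case by (auto simp: part_DD'_of_Cons simp del: DD'_of.simps)
qed auto

lemma part_DD_of_le: "strict bs \<Longrightarrow> \<forall>c \<in> set bs. c < b \<Longrightarrow> 0 < b \<Longrightarrow> part (DD_of bs) i \<le> b"
proof (induction bs arbitrary: b i)
  case (Cons a bs)
  then have "part (DD_of bs) (i - 1) \<le> a" by (auto simp: strict_Cons)
  with Cons.prems show ?case by (auto simp: part_DD_of_Cons simp del: DD_of.simps)
qed auto

lemma is_partition_DD'_of: "strict bs \<Longrightarrow> is_partition (DD'_of bs)"
proof (induction bs)
  case (Cons b bs)
  then have IH: "is_partition (DD'_of bs)" and b: "0 < b" "\<forall>c \<in> set bs. c < b" "strict bs"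
    by (auto simp: strict_Cons)
  show ?case
  proof (rule is_partitionI)
    fix i :: nat assume "1 \<le> i"
    then show "part (DD'_of (b # bs)) (Suc i) \<le> part (DD'_of (b # bs)) i"
      using part_DD'_of_le[OF b(3,2,1), of 1] part_antimono[OF IH, of "i - 1" i] b(1)
      by (auto simp: part_DD'_of_Cons simp del: DD'_of.simps)
  next
    fix i assume "1 \<le> i" "i \<le> length (DD'_of (b # bs))"
    then show "0 < part (DD'_of (b # bs)) i"
      using b unfolding length_DD'_of_Cons part_DD'_of_Cons by auto
  qed
qed (simp add: is_partition_def)

lemma is_partition_DD_of: "strict bs \<Longrightarrow> is_partition (DD_of bs)"
proof (induction bs)
  case (Cons b bs)
  then have IH: "is_partition (DD_of bs)" and b: "0 < b" "\<forall>c \<in> set bs. c < b" "strict bs"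
    by (auto simp: strict_Cons)
  show ?case
  proof (rule is_partitionI)
    fix i :: nat assume "1 \<le> i"
    then show "part (DD_of (b # bs)) (Suc i) \<le> part (DD_of (b # bs)) i"
      using part_DD_of_le[OF b(3,2,1), of 1] part_antimono[OF IH, of "i - 1" i] b(1)
      by (auto simp: part_DD_of_Cons simp del: DD_of.simps)
  next
    fix i assume "1 \<le> i" "i \<le> length (DD_of (b # bs))"
    then show "0 < part (DD_of (b # bs)) i"
      using b unfolding length_DD_of_Cons[OF b(1)] part_DD_of_Cons by auto
  qed
qed (simp add: is_partition_def)

text \<open>Peeling off the outer principal hook lowers both indices by one. The inner diagrams fit
  inside that hook, so the bounds \<open>j \<le> b\<close> and \<open>i \<le> Suc b\<close> hold
  automatically wherever an inner box exists.\<close>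

lemma DD_of_DD'_of_iff:
  "strict bs \<Longrightarrow> 1 \<le> i \<Longrightarrow> 1 \<le> j \<Longrightarrow> i \<le> part (DD_of bs) j \<longleftrightarrow> j \<le> part (DD'_of bs) i"
proof (induction bs arbitrary: i j)
  case (Cons b bs)
  then have b: "0 < b" "\<forall>c \<in> set bs. c < b" "strict bs"
    by (auto simp: strict_Cons)
  have b0: "\<forall>c \<in> set bs. 0 < c \<and> c < b" using b strict_pos by blast
  show ?case
  proof (cases "i = 1 \<or> j = 1")
    case True
    then show ?thesis using Cons.prems b by (auto simp: part_DD'_of_Cons part_DD_of_Cons simp del: DD_of.simps DD'_of.simps)
  next
    case False
    then have ij: "i - 1 \<ge> 1" "j - 1 \<ge> 1" using Cons.prems by auto
    have IH: "i - 1 \<le> part (DD_of bs) (j - 1) \<longleftrightarrow> j - 1 \<le> part (DD'_of bs) (i - 1)"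
      using Cons.IH[OF b(3)] ij by blast
    have "i \<le> part (DD_of (b # bs)) j \<longleftrightarrow> j \<le> b \<and> i - 1 \<le> part (DD_of bs) (j - 1)"
      using False Cons.prems by (auto simp: part_DD_of_Cons simp del: DD_of.simps)
    also have "\<dots> \<longleftrightarrow> i - 1 \<le> part (DD_of bs) (j - 1)"
      using part_DD_of_eq_0[OF b(1) b0, of "j - 1"] ij by (cases "j \<le> b") auto
    also have "\<dots> \<longleftrightarrow> i \<le> Suc b \<and> j - 1 \<le> part (DD'_of bs) (i - 1)"
      using part_DD'_of_eq_0[OF b(2), of "i - 1"] ij IH by (cases "i \<le> Suc b") auto
    also have "\<dots> \<longleftrightarrow> j \<le> part (DD'_of (b # bs)) i"
      using False Cons.prems by (auto simp: part_DD'_of_Cons simp del: DD'_of.simps)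
    finally show ?thesis .
  qed
qed auto

lemma conjugate_DD_of: "strict bs \<Longrightarrow> conjugate (DD_of bs) = DD'_of bs"
  by (intro conjugate_eqI is_partition_DD_of is_partition_DD'_of) (use DD_of_DD'_of_iff in blast)+

lemma conjugate_DD'_of: "strict bs \<Longrightarrow> conjugate (DD'_of bs) = DD_of bs"
  by (intro conjugate_eqI is_partition_DD_of is_partition_DD'_of) (use DD_of_DD'_of_iff in blast)+

lemma le_durfee_iff:
  assumes "is_partition l" "1 \<le> s"
  shows "s \<le> durfee l \<longleftrightarrow> s \<le> part l s"
proof -
  let ?D = "insert 0 {s \<in> {1..length l}. s \<le> part l s}"
  have fin: "finite ?D" by simp
  show ?thesis
  proof
    assume s: "s \<le> durfee l"
    have "durfee l \<in> ?D" unfolding durfee_def by (rule Max_in) auto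
    with s assms have "durfee l \<le> part l (durfee l)" by auto
    also have "\<dots> \<le> part l s" using part_antimono[OF assms(1)] s assms by blast
    finally show "s \<le> part l s" using s by simp
  next
    assume s: "s \<le> part l s"
    then have "s \<in> ?D" using part_pos_iff[OF assms(1), of s] assms by auto
    then show "s \<le> durfee l" unfolding durfee_def by (intro Max_ge) auto
  qed
qed

lemma durfee_Nil [simp]: "durfee [] = 0"
  by (simp add: durfee_def)

lemma durfee_DD'_of: "strict bs \<Longrightarrow> durfee (DD'_of bs) = length bs"
proof (induction bs)
  case (Cons b bs)
  then have b: "0 < b" "\<forall>c \<in> set bs. c < b" "strict bs"
    by (auto simp: strict_Cons)
  show ?case
  proof (rule nat_eqI_le)
    fix s :: nat assume s: "1 \<le> s"
    show "s \<le> durfee (DD'_of (b # bs)) \<longleftrightarrow> s \<le> length (b # bs)"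
    proof (cases "s = 1")
      case False
      then have s': "1 \<le> s - 1" using s by simp
      have "s \<le> durfee (DD'_of (b # bs)) \<longleftrightarrow> s \<le> part (DD'_of (b # bs)) s"
        by (rule le_durfee_iff[OF is_partition_DD'_of[OF Cons.prems] s])
      also have "\<dots> \<longleftrightarrow> s - 1 \<le> part (DD'_of bs) (s - 1)"
        using False s part_DD'_of_eq_0[OF b(2), of "s - 1"] by (auto simp: part_DD'_of_Cons simp del: DD'_of.simps)
      also have "\<dots> \<longleftrightarrow> s - 1 \<le> length bs"
        using le_durfee_iff[OF is_partition_DD'_of[OF b(3)] s'] Cons.IH[OF b(3)] by simp
      finally show ?thesis by auto
    qed (use le_durfee_iff[OF is_partition_DD'_of[OF Cons.prems], of 1] b in
          \<open>simp add: part_DD'_of_Cons del: DD'_of.simps\<close>)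
  qed
qed (simp add: durfee_def)

lemma sum_list_eq_sum_part: "length l \<le> n \<Longrightarrow> sum_list l = (\<Sum>i=1..n. part l i)"
proof -
  assume n: "length l \<le> n"
  have "sum_list l = (\<Sum>i<length l. l ! i)" by (simp add: sum_list_sum_nth atLeast0LessThan)
  also have "\<dots> = (\<Sum>i=1..length l. part l i)"
    by (rule sum.reindex_bij_witness[of _ "\<lambda>i. i - 1" Suc]) (auto simp: part_def)
  also have "\<dots> = (\<Sum>i=1..n. part l i)"
    by (rule sum.mono_neutral_left) (use n in \<open>auto simp: part_def\<close>)
  finally show ?thesis .
qed

lemma sum_list_DD'_of: "strict bs \<Longrightarrow> sum_list (DD'_of bs) = 2 * sum_list bs"
proof (induction bs)
  case (Cons b bs)
  then have b: "0 < b" "\<forall>c \<in> set bs. c < b" "strict bs"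
    by (auto simp: strict_Cons)
  have "length (DD'_of bs) \<le> b" using b by (cases bs) auto
  then have "sum_list (DD'_of bs) = (\<Sum>i=1..b. part (DD'_of bs) i)" by (rule sum_list_eq_sum_part)
  moreover have "sum_list (DD'_of (b # bs)) = b + (\<Sum>i=1..b. Suc (part (DD'_of bs) i))"
    by (simp only: DD'_of.simps sum_list.Cons interv_sum_list_conv_sum_set_nat set_upt atLeastLessThanSuc_atLeastAtMost)
  ultimately show ?case using Cons.IH[OF b(3)] by (simp add: sum_Suc del: upt_Suc)
qed simp

lemma DD_of_in_DD: "strict bs \<Longrightarrow> DD_of bs \<in> DD"
proof (induction bs)
  case (Cons b bs)
  then have b: "0 < b" "\<forall>c \<in> set bs. c < b" "strict bs"
    by (auto simp: strict_Cons)
  have "part (DD_of (b # bs)) i = part (DD'_of (b # bs)) i + 1"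
    if i: "i \<in> {1..durfee (DD_of (b # bs))}" for i
  proof (cases "i = 1")
    case False
    then have i': "1 \<le> i - 1" using i by auto
    have "i \<le> part (DD_of (b # bs)) i"
      using le_durfee_iff[OF is_partition_DD_of[OF Cons.prems], of i] i by auto
    then have le: "i \<le> b" "i - 1 \<le> part (DD_of bs) (i - 1)" using False i
      by (auto simp: part_DD_of_Cons simp del: DD_of.simps split: if_splits)
    then have "i - 1 \<in> {1..durfee (DD_of bs)}"
      using le_durfee_iff[OF is_partition_DD_of[OF b(3)] i'] i' by simp
    then have "part (DD_of bs) (i - 1) = part (DD'_of bs) (i - 1) + 1"
      using Cons.IH[OF b(3)] conjugate_DD_of[OF b(3)] unfolding DD_def by auto
    then show ?thesis using False i le by (simp add: part_DD_of_Cons part_DD'_of_Cons del: DD_of.simps DD'_of.simps)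
  qed (simp add: part_DD_of_Cons part_DD'_of_Cons del: DD_of.simps DD'_of.simps)
  then show ?case
    unfolding DD_def using is_partition_DD_of[OF Cons.prems] conjugate_DD_of[OF Cons.prems] by auto
qed (simp add: DD_def is_partition_def)

text \<open>The first row is one longer than the first column, whose length is \<open>b\<close>.
  Stripping this hook leaves a smaller member of \<open>DD\<close>, because both sides of the
  defining relation drop by one along the diagonal.\<close>

lemma DD_imp_DD_of: "l \<in> DD \<Longrightarrow> \<exists>bs. strict bs \<and> l = DD_of bs"
proof (induction "sum_list l" arbitrary: l rule: less_induct)
  case less
  have l: "is_partition l" and ll: "\<And>i. i \<in> {1..durfee l} \<Longrightarrow> part l i = part (conjugate l) i + 1"
    using less.prems by (auto simp: DD_def)
  show ?case
  proof (cases l)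
    case Nil
    then show ?thesis by (intro exI[of _ "[]"]) simp
  next
    case (Cons x xs)
    define b where "b = length l"
    have b_pos: "0 < b" using Cons by (simp add: b_def)
    have conj1: "part (conjugate l) 1 = b"
      by (rule nat_eqI_le) (use part_conjugate_iff[OF l _ order_refl] part_pos_iff[OF l] in \<open>simp add: b_def Suc_le_eq\<close>)
    have "1 \<le> durfee l" using le_durfee_iff[OF l, of 1] part_pos_iff[OF l, of 1] b_pos b_def by simp
    with ll[of 1] conj1 have part1: "part l 1 = Suc b" by simp
    \<comment> \<open>The diagram without its first row and column; rows that become empty are
      dropped.\<close>
    define xs' where "xs' = filter (\<lambda>y. 0 < y) (map (\<lambda>y. y - 1) xs)"
    have sortedxs: "sorted_wrt (\<ge>) xs" using l Cons by (simp add: is_partition_def)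
    have part_xs: "part xs i = part l (Suc i)" if "1 \<le> i" for i
      using that by (simp add: Cons part_Cons)
    have part': "part xs' i = part l (Suc i) - 1" if "1 \<le> i" for i
    proof -
      have gen: "sorted_wrt (\<ge>) ys \<Longrightarrow> part (filter (\<lambda>y. 0 < y) (map (\<lambda>y. y - 1) ys)) i = part ys i - 1"
        for ys :: "nat list"
        using that
      proof (induction ys arbitrary: i)
        case (Cons y ys)
        show ?case
        proof (cases "y - 1 > 0")
          case True
          then show ?thesis using Cons by (cases "i = 1") (auto simp: part_Cons)
        next
          case False
          \<comment> \<open>In a weakly decreasing list everything after a part of size at most 1 is
            at most 1 as well, so the filter cuts off a tail and never closes a gap.\<close>
          then have *: "\<forall>z \<in> set (y # ys). z - 1 = 0" using Cons.prems by auto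
          then have "part (y # ys) i - 1 = 0"
          proof (cases "i \<in> {1..length (y # ys)}")
            case True
            then have "(y # ys) ! (i - 1) \<in> set (y # ys)" by (intro nth_mem) auto
            then show ?thesis using * True by (simp only: part_def if_True)
          qed (simp only: part_def if_False)
          moreover have "filter (\<lambda>y. 0 < y) (map (\<lambda>y. y - 1) (y # ys)) = []"
            using * by (auto simp: filter_empty_conv)
          ultimately show ?thesis by simp
        qed
      qed simp
      show ?thesis unfolding xs'_def gen[OF sortedxs] part_xs[OF that] ..
    qed
    have l': "is_partition xs'"
    proof -
      have "sorted_wrt (\<ge>) (map (\<lambda>y. y - 1) xs)" unfolding sorted_wrt_map
        by (rule sorted_wrt_mono_rel[OF _ sortedxs]) (auto intro: diff_le_mono)
      then show ?thesis unfolding is_partition_def xs'_def by (auto intro: sorted_wrt_filter)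
    qed
    have conj': "part (conjugate xs') j = part (conjugate l) (Suc j) - 1" if "1 \<le> j" for j
    proof (rule nat_eqI_le)
      fix i :: nat assume i: "1 \<le> i"
      have "i \<le> part (conjugate xs') j \<longleftrightarrow> j \<le> part l (Suc i) - 1"
        using part_conjugate_iff[OF l' i that] part'[OF i] by simp
      also have "\<dots> \<longleftrightarrow> Suc j \<le> part l (Suc i)" using that by auto
      also have "\<dots> \<longleftrightarrow> Suc i \<le> part (conjugate l) (Suc j)"
        using part_conjugate_iff[OF l, of "Suc i" "Suc j"] by simp
      finally show "i \<le> part (conjugate xs') j \<longleftrightarrow> i \<le> part (conjugate l) (Suc j) - 1" using i by auto
    qed
    have "xs' \<in> DD"
    proof -
      have "part xs' i = part (conjugate xs') i + 1" if i: "i \<in> {1..durfee xs'}" for i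
      proof -
        have "i \<le> part xs' i" using i le_durfee_iff[OF l', of i] by auto
        then have *: "Suc i \<le> part l (Suc i)" using part'[of i] i by auto
        then have "Suc i \<in> {1..durfee l}" using le_durfee_iff[OF l, of "Suc i"] by simp
        then have "part l (Suc i) = part (conjugate l) (Suc i) + 1" by (rule ll)
        moreover have "Suc i \<le> part (conjugate l) (Suc i)"
          using part_conjugate_iff[OF l, of "Suc i" "Suc i"] * by simp
        ultimately show ?thesis using part'[of i] conj'[of i] i by auto
      qed
      with l' show ?thesis by (auto simp: DD_def)
    qed
    moreover have "sum_list xs' < sum_list l"
    proof -
      have "sum_list xs' = sum_list (map (\<lambda>y. y - 1) xs)" unfolding xs'_def by (induction xs) auto
      also have "\<dots> \<le> sum_list xs" by (induction xs) auto
      also have "\<dots> < sum_list l" using part1 Cons by (simp add: part_Cons)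
      finally show ?thesis .
    qed
    ultimately obtain bs where bs: "strict bs" "xs' = DD_of bs" using less.hyps by blast
    have "\<forall>c \<in> set bs. c < b"
    proof (cases bs)
      case (Cons c cs)
      have "Suc c = part xs' 1" unfolding bs(2) Cons by (simp add: part_Cons)
      also have "\<dots> = part l 2 - 1" using part'[of 1] by (simp add: numeral_2_eq_2)
      also have "\<dots> \<le> part l 1 - 1" using part_antimono[OF l, of 1 2] by simp
      also have "\<dots> = b" using part1 by simp
      finally have "c < b" by simp
      then show ?thesis using bs(1) Cons by (auto simp: strict_Cons)
    qed simp
    with bs b_pos have st: "strict (b # bs)" by (simp add: strict_Cons)
    have "l = DD_of (b # bs)"
    proof (rule partition_eqI[OF l is_partition_DD_of[OF st]])
      fix i :: nat assume i: "1 \<le> i"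
      show "part l i = part (DD_of (b # bs)) i"
      proof (cases "i = 1")
        case True
        then show ?thesis using part1 by (simp add: part_DD_of_Cons del: DD_of.simps)
      next
        case False
        then have "part (DD_of bs) (i - 1) = part l i - 1" using part'[of "i - 1"] i bs(2) by simp
        then show ?thesis using False i part_pos_iff[OF l, of i] b_def
          by (auto simp: part_DD_of_Cons simp del: DD_of.simps)
      qed
    qed
    with st show ?thesis by blast
  qed
qed

lemma DD'_eq: "DD' = DD'_of ` {bs. strict bs}"
proof -
  have DD: "DD = DD_of ` {bs. strict bs}" using DD_imp_DD_of DD_of_in_DD by blast
  have "DD' = (\<lambda>bs. conjugate (DD_of bs)) ` {bs. strict bs}" unfolding DD'_def DD image_image ..
  also have "\<dots> = DD'_of ` {bs. strict bs}" by (intro image_cong) (auto simp: conjugate_DD_of)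
  finally show ?thesis .
qed

lemma inj_DD'_of: "inj_on DD'_of {bs. strict bs}"
proof (rule inj_onI, goal_cases)
  case (1 bs cs)
  then show ?case
  proof (induction bs arbitrary: cs)
    case Nil
    then show ?case by (cases cs) auto
  next
    case (Cons b bs)
    then obtain c cs' where cs: "cs = c # cs'" by (cases cs) auto
    have c: "c = b" using Cons.prems cs by simp
    have st: "strict bs" "strict cs'" "\<forall>x\<in>set bs. x < b" "\<forall>x\<in>set cs'. x < b"
      using Cons.prems cs c by (auto simp: strict_Cons)
    have "DD'_of bs = DD'_of cs'"
    proof (rule partition_eqI[OF is_partition_DD'_of[OF st(1)] is_partition_DD'_of[OF st(2)]])
      fix i :: nat assume i: "1 \<le> i"
      have "part (DD'_of (b # bs)) (Suc i) = part (DD'_of (b # cs')) (Suc i)"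
        using Cons.prems cs c by (simp del: DD'_of.simps)
      then show "part (DD'_of bs) i = part (DD'_of cs') i"
        using i part_DD'_of_eq_0[OF st(3), of i] part_DD'_of_eq_0[OF st(4), of i]
        by (auto simp: part_DD'_of_Cons simp del: DD'_of.simps split: if_splits)
    qed
    with Cons.IH[of cs'] st cs c show ?case by simp
  qed
qed

text \<open>Reading the boundary of the diagram as a Maya diagram, the bead in row \<open>i\<close> is
  \<open>\<lambda>\<^sub>i - i + 1\<close> and the hole in column \<open>j\<close> is \<open>j - \<lambda>'\<^sub>j\<close>; for \<open>DD'_of bs\<close> exactly one of
  \<open>c, - c\<close> is a bead, and it is \<open>c\<close> iff \<open>c \<in> set bs\<close>.\<close>

lemma prod_beads:
  fixes f :: "int \<Rightarrow> 'a::comm_monoid_mult"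
  shows "strict bs \<Longrightarrow> \<forall>c \<in> set bs. c < M \<Longrightarrow>
    (\<Prod>i=1..M. f (int (part (DD'_of bs) i) - int i + 1)) = (\<Prod>c<M. f (if c \<in> set bs then int c else - int c))"
proof (induction bs arbitrary: M)
  case Nil
  show ?case by (rule prod.reindex_bij_witness[of _ Suc "\<lambda>i. i - 1"]) (auto simp: of_nat_diff)
next
  case (Cons b bs)
  then have b: "0 < b" "\<forall>c \<in> set bs. c < b" "strict bs" "b < M" by (auto simp: strict_Cons)
  let ?g = "\<lambda>i. f (int (part (DD'_of (b # bs)) i) - int i + 1)"
  have split: "{1..M} = insert 1 ({2..Suc b} \<union> {b+2..M})" using b by auto
  have "prod ?g {1..M} = ?g 1 * (prod ?g {2..Suc b} * prod ?g {b+2..M})"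
    unfolding split using b(1) by (subst prod.insert, simp, simp, subst prod.union_disjoint, auto)
  also have "?g 1 = f (int b)" by (simp add: part_DD'_of_Cons del: DD'_of.simps)
  also have "prod ?g {2..Suc b} = (\<Prod>i=1..b. f (int (part (DD'_of bs) i) - int i + 1))"
    by (rule prod.reindex_bij_witness[of _ Suc "\<lambda>i. i - 1"])
       (auto simp: part_DD'_of_Cons of_nat_diff simp del: DD'_of.simps)
  also have "\<dots> = (\<Prod>c<b. f (if c \<in> set bs then int c else - int c))" by (rule Cons.IH[OF b(3,2)])
  also have "\<dots> = (\<Prod>c<b. f (if c \<in> set (b # bs) then int c else - int c))"
    by (rule prod.cong) auto
  also have "prod ?g {b+2..M} = (\<Prod>c\<in>{b<..<M}. f (if c \<in> set (b # bs) then int c else - int c))"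
    by (rule prod.reindex_bij_witness[of _ Suc "\<lambda>i. i - 1"])
       (use b in \<open>auto simp: part_DD'_of_Cons of_nat_diff simp del: DD'_of.simps\<close>)
  finally have "prod ?g {1..M} = f (int b) * ((\<Prod>c<b. f (if c \<in> set (b # bs) then int c else - int c)) *
     (\<Prod>c\<in>{b<..<M}. f (if c \<in> set (b # bs) then int c else - int c)))" .
  moreover have split': "{..<M} = insert b ({..<b} \<union> {b<..<M})" using b by auto
  have "(\<Prod>c\<in>{..<M}. f (if c \<in> set (b # bs) then int c else - int c)) = f (int b) * ((\<Prod>c\<in>{..<b}. f (if c \<in> set (b # bs) then int c else - int c)) *
     (\<Prod>c\<in>{b<..<M}. f (if c \<in> set (b # bs) then int c else - int c)))"
    unfolding split' by (subst prod.insert, simp, simp, subst prod.union_disjoint, auto)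
  ultimately show ?case by (simp only:)
qed

lemma prod_holes:
  fixes f :: "int \<Rightarrow> 'a::comm_monoid_mult"
  shows "strict bs \<Longrightarrow> 0 < M \<Longrightarrow> \<forall>c \<in> set bs. c < M \<Longrightarrow>
    (\<Prod>i=1..<M. f (int i - int (part (DD_of bs) i))) = (\<Prod>c=1..<M. f (if c \<in> set bs then - int c else int c))"
proof (induction bs arbitrary: M)
  case Nil
  show ?case by simp
next
  case (Cons b bs)
  then have b: "0 < b" "\<forall>c \<in> set bs. c < b" "strict bs" "b < M" by (auto simp: strict_Cons)
  let ?g = "\<lambda>i. f (int i - int (part (DD_of (b # bs)) i))"
  have split: "{1..<M} = insert 1 ({2..b} \<union> {b<..<M})" using b by auto
  have "prod ?g {1..<M} = ?g 1 * (prod ?g {2..b} * prod ?g {b<..<M})"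
    unfolding split using b(1) by (subst prod.insert, simp, simp, subst prod.union_disjoint, auto)
  also have "?g 1 = f (- int b)" by (simp add: part_DD_of_Cons del: DD_of.simps)
  also have "prod ?g {2..b} = (\<Prod>i=1..<b. f (int i - int (part (DD_of bs) i)))"
    by (rule prod.reindex_bij_witness[of _ Suc "\<lambda>i. i - 1"])
       (auto simp: part_DD_of_Cons of_nat_diff diff_diff_eq simp del: DD_of.simps)
  also have "\<dots> = (\<Prod>c=1..<b. f (if c \<in> set bs then - int c else int c))" by (rule Cons.IH[OF b(3,1,2)])
  also have "\<dots> = (\<Prod>c=1..<b. f (if c \<in> set (b # bs) then - int c else int c))"
    by (rule prod.cong) auto
  also have "prod ?g {b<..<M} = (\<Prod>c\<in>{b<..<M}. f (if c \<in> set (b # bs) then - int c else int c))"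
    by (rule prod.cong) (use b in \<open>auto simp: part_DD_of_Cons simp del: DD_of.simps\<close>)
  finally have "prod ?g {1..<M} = f (- int b) * ((\<Prod>c=1..<b. f (if c \<in> set (b # bs) then - int c else int c)) *
     (\<Prod>c\<in>{b<..<M}. f (if c \<in> set (b # bs) then - int c else int c)))" .
  moreover have split': "{1..<M} = insert b ({1..<b} \<union> {b<..<M})" using b by auto
  have "(\<Prod>c\<in>{1..<M}. f (if c \<in> set (b # bs) then - int c else int c)) = f (- int b) * ((\<Prod>c\<in>{1..<b}. f (if c \<in> set (b # bs) then - int c else int c)) *
     (\<Prod>c\<in>{b<..<M}. f (if c \<in> set (b # bs) then - int c else int c)))"
    unfolding split' by (subst prod.insert, simp, simp, subst prod.union_disjoint, auto)
  ultimately show ?case by (simp only:)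
qed

text \<open>Reflecting the Maya diagram at 0 exchanges beads and holes. Hence the distance from the
  bead \<open>b\<close> down to the hole among \<open>c\<close>, \<open>- c\<close> equals the
  distance from the hole \<open>- b\<close> up to the bead among them, and one function serves both
  the first row and the first column.\<close>

definition bead_hook :: "nat list \<Rightarrow> nat \<Rightarrow> nat \<Rightarrow> nat" where
  "bead_hook bs b c = (if c \<in> set bs then b + c else b - c)"

section \<open>Hook lengths under removal of the outer principal hook\<close>

lemma boxes_DD'_of_Cons:
  assumes "strict (b # bs)"
  shows "boxes (DD'_of (b # bs)) = insert (1, 1) (Pair 1 ` {2..b} \<union> (\<lambda>i. (i, 1)) ` {2..Suc b} \<union>
           (\<lambda>(i, j). (Suc i, Suc j)) ` boxes (DD'_of bs))" (is "?L = ?R")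
proof -
  have b: "0 < b" "\<forall>c \<in> set bs. c < b" "strict bs" using assms by (auto simp: strict_Cons)
  have len: "length (DD'_of bs) \<le> b" using b by (cases bs) auto
  have mem: "(i, j) \<in> boxes (DD'_of cs) \<longleftrightarrow> 1 \<le> i \<and> 1 \<le> j \<and> j \<le> part (DD'_of cs) i" for i j cs
    by (auto simp: boxes_def part_def split: if_splits)
  have "(i, j) \<in> ?L \<longleftrightarrow> (i, j) \<in> ?R" for i j
  proof -
    have im: "(i, j) \<in> (\<lambda>(i, j). (Suc i, Suc j)) ` boxes (DD'_of bs) \<longleftrightarrow>
        i \<ge> 2 \<and> j \<ge> 2 \<and> j - 1 \<le> part (DD'_of bs) (i - 1)"
    proof
      assume "(i, j) \<in> (\<lambda>(i, j). (Suc i, Suc j)) ` boxes (DD'_of bs)"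
      then show "i \<ge> 2 \<and> j \<ge> 2 \<and> j - 1 \<le> part (DD'_of bs) (i - 1)" by (auto simp: mem)
    next
      assume *: "i \<ge> 2 \<and> j \<ge> 2 \<and> j - 1 \<le> part (DD'_of bs) (i - 1)"
      then have "(i - 1, j - 1) \<in> boxes (DD'_of bs)" by (auto simp: mem)
      then show "(i, j) \<in> (\<lambda>(i, j). (Suc i, Suc j)) ` boxes (DD'_of bs)"
        using * by (intro image_eqI[of _ _ "(i - 1, j - 1)"]) auto
    qed
    have z: "part (DD'_of bs) (i - 1) = 0" if "\<not> i \<le> Suc b"
      using part_DD'_of_eq_0[OF b(2), of "i - 1"] that by auto
    show ?thesis
      unfolding mem part_DD'_of_Cons using im z b(1) by auto
  qed
  then show ?thesis by auto
qed

lemma hook_DD'_of_Suc: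
  assumes "strict (b # bs)" "(i, j) \<in> boxes (DD'_of bs)"
  shows "hook (DD'_of (b # bs)) (Suc i, Suc j) = hook (DD'_of bs) (i, j)"
proof -
  have b: "0 < b" "\<forall>c \<in> set bs. c < b" "strict bs" using assms by (auto simp: strict_Cons)
  have b0: "\<forall>c \<in> set bs. 0 < c \<and> c < b" using b strict_pos by blast
  have ij: "1 \<le> i" "1 \<le> j" "j \<le> part (DD'_of bs) i" using assms(2) by (auto simp: boxes_def)
  then have "i \<le> part (DD_of bs) j" using DD_of_DD'_of_iff[OF b(3)] by blast
  then have "i \<le> b" "j < b"
    using part_DD'_of_eq_0[OF b(2), of i] part_DD_of_eq_0[OF b(1) b0, of j] ij by (auto simp: not_le[symmetric])
  then show ?thesis
    unfolding hook_def conjugate_DD'_of[OF assms(1)] conjugate_DD'_of[OF b(3)] using ij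
    by (simp add: part_DD'_of_Cons part_DD_of_Cons del: DD_of.simps DD'_of.simps)
qed

lemma finite_boxes: "finite (boxes l)"
proof -
  have "boxes l \<subseteq> (SIGMA i:{1..length l}. {1..part l i})" by (auto simp: boxes_def)
  then show ?thesis by (rule finite_subset) auto
qed

text \<open>Hook lengths are distances between beads and holes: the first row belongs to the bead
  \<open>b\<close>, the first column to the hole \<open>- b\<close>, and the corner to both. The
  column has one box more than the row, which is the index \<open>c = 0\<close>, of hook length
  \<open>b\<close>, in the product with sign \<open>- 1\<close>.\<close>

lemma prod_boxes_DD'_of_Cons:
  fixes f :: "int \<Rightarrow> nat \<Rightarrow> 'a::comm_monoid_mult"
  assumes "strict (b # bs)"
  shows "(\<Prod>s\<in>boxes (DD'_of (b # bs)). f (box_sign s) (hook (DD'_of (b # bs)) s)) =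
    f 1 (2 * b) * (\<Prod>c=1..<b. f 1 (bead_hook bs b c)) * (\<Prod>c<b. f (- 1) (bead_hook bs b c)) *
    (\<Prod>s\<in>boxes (DD'_of bs). f (box_sign s) (hook (DD'_of bs) s))"
proof -
  have b: "0 < b" "\<forall>c \<in> set bs. c < b" "strict bs" using assms by (auto simp: strict_Cons)
  let ?l = "DD'_of (b # bs)"
  let ?g = "\<lambda>s. f (box_sign s) (hook ?l s)"
  note del = DD_of.simps DD'_of.simps
  have "prod ?g (boxes ?l) = ?g (1, 1) * (prod ?g (Pair 1 ` {2..b}) *
      prod ?g ((\<lambda>i. (i, 1)) ` {2..Suc b}) * prod ?g ((\<lambda>(i, j). (Suc i, Suc j)) ` boxes (DD'_of bs)))"
    unfolding boxes_DD'_of_Cons[OF assms] using finite_boxes[of "DD'_of bs"]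
    by (subst prod.insert, simp, force simp: boxes_def, subst prod.union_disjoint, simp, simp, force simp: boxes_def,
        subst prod.union_disjoint) auto
  also have "?g (1, 1) = f 1 (2 * b)"
    using b(1) by (simp add: hook_def box_sign_def conjugate_DD'_of[OF assms] part_DD'_of_Cons part_DD_of_Cons mult_2 del: del)
  also have "prod ?g (Pair 1 ` {2..b}) = (\<Prod>i=1..<b. f 1 (nat (int b - (int i - int (part (DD_of bs) i)))))"
    unfolding prod.reindex[OF inj_on_convol_ident, of _ _] 
    by (subst prod.reindex, simp add: inj_on_def, rule prod.reindex_bij_witness[of _ Suc "\<lambda>i. i - 1"])
       (auto simp: hook_def box_sign_def conjugate_DD'_of[OF assms] part_DD'_of_Cons part_DD_of_Cons
          simp del: del intro!: arg_cong[of _ _ "f 1"])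
  also have "\<dots> = (\<Prod>c=1..<b. f 1 (bead_hook bs b c))"
    by (subst prod_holes[OF b(3,1,2), of "\<lambda>x. f 1 (nat (int b - x))"], rule prod.cong)
       (auto simp: bead_hook_def nat_add_distrib nat_diff_distrib intro!: arg_cong[of _ _ "f 1"])
  also have "prod ?g ((\<lambda>i. (i, 1)) ` {2..Suc b}) =
      (\<Prod>i=1..b. f (- 1) (nat (int b + (int (part (DD'_of bs) i) - int i + 1))))"
    by (subst prod.reindex, simp add: inj_on_def, rule prod.reindex_bij_witness[of _ Suc "\<lambda>i. i - 1"])
       (auto simp: hook_def box_sign_def conjugate_DD'_of[OF assms] part_DD'_of_Cons part_DD_of_Cons
          simp del: del intro!: arg_cong[of _ _ "f (- 1)"])
  also have "\<dots> = (\<Prod>c<b. f (- 1) (bead_hook bs b c))"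
    by (subst prod_beads[OF b(3,2), of "\<lambda>x. f (- 1) (nat (int b + x))"], rule prod.cong)
       (auto simp: bead_hook_def nat_add_distrib nat_diff_distrib intro!: arg_cong[of _ _ "f (- 1)"])
  also have "prod ?g ((\<lambda>(i, j). (Suc i, Suc j)) ` boxes (DD'_of bs)) =
      (\<Prod>s\<in>boxes (DD'_of bs). f (box_sign s) (hook (DD'_of bs) s))"
  proof (subst prod.reindex)
    show "inj_on (\<lambda>(i, j). (Suc i, Suc j)) (boxes (DD'_of bs))" by (auto simp: inj_on_def)
  qed (intro prod.cong, auto simp: box_sign_def hook_DD'_of_Suc[OF assms] simp del: del)
  finally show ?thesis by (simp add: mult.assoc)
qed

lemma prod_diag_boxes_DD'_of_Cons:
  fixes f :: "nat \<Rightarrow> 'a::comm_monoid_mult"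
  assumes "strict (b # bs)"
  shows "(\<Prod>s\<in>diag_boxes (DD'_of (b # bs)). f (hook (DD'_of (b # bs)) s)) =
    f (2 * b) * (\<Prod>s\<in>diag_boxes (DD'_of bs). f (hook (DD'_of bs) s))"
proof -
  have b: "0 < b" "\<forall>c \<in> set bs. c < b" "strict bs" using assms by (auto simp: strict_Cons)
  have fin: "finite (diag_boxes (DD'_of bs))"
    by (rule finite_subset[OF _ finite_boxes[of "DD'_of bs"]]) (auto simp: diag_boxes_def)
  have eq: "diag_boxes (DD'_of (b # bs)) = insert (1, 1) ((\<lambda>(i, j). (Suc i, Suc j)) ` diag_boxes (DD'_of bs))"
    (is "?L = ?R")
  proof -
    have "(i, j) \<in> ?L \<longleftrightarrow> (i, j) \<in> ?R" for i j
      unfolding diag_boxes_def boxes_DD'_of_Cons[OF assms] by (cases "i = j") force+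
    then show ?thesis by auto
  qed
  have "hook (DD'_of (b # bs)) (1, 1) = 2 * b"
    using b(1) by (simp add: hook_def conjugate_DD'_of[OF assms] part_DD'_of_Cons part_DD_of_Cons mult_2
        del: DD_of.simps DD'_of.simps)
  moreover have "(\<Prod>s\<in>(\<lambda>(i, j). (Suc i, Suc j)) ` diag_boxes (DD'_of bs). f (hook (DD'_of (b # bs)) s)) =
     (\<Prod>s\<in>diag_boxes (DD'_of bs). f (hook (DD'_of bs) s))"
  proof (subst prod.reindex)
    show "inj_on (\<lambda>(i, j). (Suc i, Suc j)) (diag_boxes (DD'_of bs))" by (auto simp: inj_on_def)
  qed (intro prod.cong, auto simp: diag_boxes_def hook_DD'_of_Suc[OF assms] simp del: DD'_of.simps)
  moreover have "(1, 1) \<notin> (\<lambda>(i, j). (Suc i, Suc j)) ` diag_boxes (DD'_of bs)"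
    by (force simp: diag_boxes_def boxes_def)
  ultimately show ?thesis unfolding eq using fin by (simp del: DD'_of.simps)
qed

section \<open>Locally finite families of power series\<close>

definition locfin :: "'i set \<Rightarrow> ('i \<Rightarrow> 'a::comm_monoid_add fps) \<Rightarrow> bool" where
  "locfin A f \<longleftrightarrow> (\<forall>n. finite {i \<in> A. fps_nth (f i) n \<noteq> 0})"

text \<open>Each coefficient is summed over its support only. For a family that is not locally
  finite, a coefficient with infinite support takes the default value 0.\<close>

definition fsum :: "'i set \<Rightarrow> ('i \<Rightarrow> 'a::comm_monoid_add fps) \<Rightarrow> 'a fps" where
  "fsum A f = Abs_fps (\<lambda>n. \<Sum>i | i \<in> A \<and> fps_nth (f i) n \<noteq> 0. fps_nth (f i) n)"

lemma locfinI: "(\<And>n. finite {i \<in> A. fps_nth (f i) n \<noteq> 0}) \<Longrightarrow> locfin A f"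
  by (simp add: locfin_def)

lemma fsum_nth:
  assumes "finite S" "S \<subseteq> A" "\<And>i. i \<in> A \<Longrightarrow> fps_nth (f i) n \<noteq> 0 \<Longrightarrow> i \<in> S"
  shows "fps_nth (fsum A f) n = (\<Sum>i\<in>S. fps_nth (f i) n)"
proof -
  have "{i. i \<in> A \<and> fps_nth (f i) n \<noteq> 0} \<subseteq> S" using assms(3) by blast
  then have "(\<Sum>i | i \<in> A \<and> fps_nth (f i) n \<noteq> 0. fps_nth (f i) n) = (\<Sum>i\<in>S. fps_nth (f i) n)"
  proof (rule sum.mono_neutral_left[OF assms(1)], intro ballI)
    fix i assume "i \<in> S - {i. i \<in> A \<and> fps_nth (f i) n \<noteq> 0}"
    moreover then have "i \<in> A" using assms(2) by blast
    ultimately show "fps_nth (f i) n = 0" by simp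
  qed
  then show ?thesis by (simp only: fsum_def fps_nth_Abs_fps)
qed

lemma fsum_cong: "A = B \<Longrightarrow> (\<And>i. i \<in> B \<Longrightarrow> f i = g i) \<Longrightarrow> fsum A f = fsum B g"
  by (auto simp: fsum_def fps_eq_iff intro!: sum.cong)

lemma locfin_cong: "A = B \<Longrightarrow> (\<And>i. i \<in> B \<Longrightarrow> f i = g i) \<Longrightarrow> locfin A f = locfin B g"
  by (auto simp: locfin_def cong: conj_cong)

lemma locfin_finite: "finite A \<Longrightarrow> locfin A f"
  by (simp add: locfin_def)

lemma fsum_finite: "finite A \<Longrightarrow> fsum A f = (\<Sum>i\<in>A. f i)"
  by (rule fps_ext, subst fsum_nth[of A]) (auto simp: fps_sum_nth)

lemma fsum_neutral:
  assumes "A \<subseteq> B" "\<And>i. i \<in> B - A \<Longrightarrow> f i = 0"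
  shows "fsum A f = fsum B f"
proof (rule fps_ext)
  fix n
  have "{i. i \<in> A \<and> fps_nth (f i) n \<noteq> 0} = {i. i \<in> B \<and> fps_nth (f i) n \<noteq> 0}" using assms by force
  then show "fps_nth (fsum A f) n = fps_nth (fsum B f) n" by (simp add: fsum_def)
qed

lemma fsum_reindex:
  assumes "bij_betw h A B"
  shows "fsum A (\<lambda>i. f (h i)) = fsum B f"
proof (rule fps_ext)
  fix n
  have "bij_betw h {i. i \<in> A \<and> fps_nth (f (h i)) n \<noteq> 0} {i. i \<in> B \<and> fps_nth (f i) n \<noteq> 0}"
    using assms by (auto simp: bij_betw_def inj_on_def)
  then show "fps_nth (fsum A (\<lambda>i. f (h i))) n = fps_nth (fsum B f) n"
    unfolding fsum_def using sum.reindex_bij_betw[of h _ _ "\<lambda>i. fps_nth (f i) n"] by simp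
qed

lemma locfin_reindex:
  assumes "bij_betw h A B"
  shows "locfin A (\<lambda>i. f (h i)) \<longleftrightarrow> locfin B f"
proof -
  have "bij_betw h {i \<in> A. fps_nth (f (h i)) n \<noteq> 0} {i \<in> B. fps_nth (f i) n \<noteq> 0}" for n
    using assms by (auto simp: bij_betw_def inj_on_def)
  then show ?thesis unfolding locfin_def by (meson bij_betw_finite)
qed

lemma locfin_add:
  fixes f g :: "'i \<Rightarrow> 'a::comm_monoid_add fps"
  assumes "locfin A f" "locfin A g"
  shows "locfin A (\<lambda>i. f i + g i)"
proof (rule locfinI)
  fix n
  have "{i \<in> A. fps_nth (f i + g i) n \<noteq> 0} \<subseteq>
      {i \<in> A. fps_nth (f i) n \<noteq> 0} \<union> {i \<in> A. fps_nth (g i) n \<noteq> 0}" by auto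
  then show "finite {i \<in> A. fps_nth (f i + g i) n \<noteq> 0}"
    using assms unfolding locfin_def by (meson finite_UnI finite_subset)
qed

lemma fsum_add:
  fixes f g :: "'i \<Rightarrow> 'a::comm_monoid_add fps"
  assumes "locfin A f" "locfin A g"
  shows "fsum A (\<lambda>i. f i + g i) = fsum A f + fsum A g"
proof (rule fps_ext)
  fix n
  let ?S = "{i \<in> A. fps_nth (f i) n \<noteq> 0} \<union> {i \<in> A. fps_nth (g i) n \<noteq> 0}"
  have "finite ?S" using assms by (simp add: locfin_def)
  then have "fps_nth (fsum A (\<lambda>i. f i + g i)) n = (\<Sum>i\<in>?S. fps_nth (f i + g i) n)"
    "fps_nth (fsum A f) n = (\<Sum>i\<in>?S. fps_nth (f i) n)"
    "fps_nth (fsum A g) n = (\<Sum>i\<in>?S. fps_nth (g i) n)"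
    by (intro fsum_nth; auto)+
  then show "fps_nth (fsum A (\<lambda>i. f i + g i)) n = fps_nth (fsum A f + fsum A g) n"
    by (simp add: sum.distrib)
qed

lemma locfin_mult:
  fixes f :: "'i \<Rightarrow> 'a::comm_ring_1 fps" and g :: "'j \<Rightarrow> 'a fps"
  assumes "locfin A f" "locfin B g"
  shows "locfin (A \<times> B) (\<lambda>(i, j). f i * g j)"
proof (rule locfinI)
  fix n
  have "{p \<in> A \<times> B. fps_nth (case p of (i, j) \<Rightarrow> f i * g j) n \<noteq> 0} \<subseteq>
     (\<Union>k\<le>n. {i \<in> A. fps_nth (f i) k \<noteq> 0} \<times> {j \<in> B. fps_nth (g j) (n - k) \<noteq> 0})"
  proof clarify
    fix i j assume ij: "i \<in> A" "j \<in> B" "fps_nth (f i * g j) n \<noteq> 0"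
    then have "(\<Sum>k=0..n. fps_nth (f i) k * fps_nth (g j) (n - k)) \<noteq> 0" by (simp add: fps_mult_nth)
    then obtain k where "k \<in> {0..n}" "fps_nth (f i) k * fps_nth (g j) (n - k) \<noteq> 0"
      by (rule sum.not_neutral_contains_not_neutral)
    then have "fps_nth (f i) k \<noteq> 0" "fps_nth (g j) (n - k) \<noteq> 0" "k \<le> n" by auto
    with ij show "(i, j) \<in> (\<Union>k\<le>n. {i \<in> A. fps_nth (f i) k \<noteq> 0} \<times> {j \<in> B. fps_nth (g j) (n - k) \<noteq> 0})"
      by auto
  qed
  moreover have "finite (\<Union>k\<le>n. {i \<in> A. fps_nth (f i) k \<noteq> 0} \<times> {j \<in> B. fps_nth (g j) (n - k) \<noteq> 0})"
    using assms by (auto simp: locfin_def)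
  ultimately show "finite {p \<in> A \<times> B. fps_nth (case p of (i, j) \<Rightarrow> f i * g j) n \<noteq> 0}"
    by (rule finite_subset)
qed

lemma locfin_mult_left:
  fixes f :: "'i \<Rightarrow> 'a::comm_ring_1 fps"
  assumes "locfin A f"
  shows "locfin A (\<lambda>i. f i * g i)"
proof (rule locfinI)
  fix n
  have "{i \<in> A. fps_nth (f i * g i) n \<noteq> 0} \<subseteq> (\<Union>k\<le>n. {i \<in> A. fps_nth (f i) k \<noteq> 0})"
  proof clarify
    fix i assume i: "i \<in> A" "fps_nth (f i * g i) n \<noteq> 0"
    then have "(\<Sum>k=0..n. fps_nth (f i) k * fps_nth (g i) (n - k)) \<noteq> 0" by (simp add: fps_mult_nth)
    then obtain k where "k \<in> {0..n}" "fps_nth (f i) k * fps_nth (g i) (n - k) \<noteq> 0"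
      by (rule sum.not_neutral_contains_not_neutral)
    then have "fps_nth (f i) k \<noteq> 0" "k \<le> n" by auto
    with i show "i \<in> (\<Union>k\<le>n. {i \<in> A. fps_nth (f i) k \<noteq> 0})" by auto
  qed
  moreover have "finite (\<Union>k\<le>n. {i \<in> A. fps_nth (f i) k \<noteq> 0})" using assms by (auto simp: locfin_def)
  ultimately show "finite {i \<in> A. fps_nth (f i * g i) n \<noteq> 0}" by (rule finite_subset)
qed

text \<open>The coefficient of degree n only sees indices with some nonzero coefficient of degree at
  most n. They form a finite rectangle, on which this is the finite distributive law.\<close>

lemma fsum_mult:
  fixes f :: "'i \<Rightarrow> 'a::comm_ring_1 fps" and g :: "'j \<Rightarrow> 'a fps"
  assumes f: "locfin A f" and g: "locfin B g"
  shows "fsum (A \<times> B) (\<lambda>(i, j). f i * g j) = fsum A f * fsum B g"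
proof (rule fps_ext)
  fix n
  let ?S = "\<Union>k\<le>n. {i \<in> A. fps_nth (f i) k \<noteq> 0}" and ?R = "\<Union>k\<le>n. {i \<in> B. fps_nth (g i) k \<noteq> 0}"
  have fin: "finite ?S" "finite ?R" using assms by (auto simp: locfin_def)
  have sub: "(i, j) \<in> ?S \<times> ?R" if ij: "i \<in> A" "j \<in> B" "fps_nth (f i * g j) n \<noteq> 0" for i j
  proof -
    have "(\<Sum>k=0..n. fps_nth (f i) k * fps_nth (g j) (n - k)) \<noteq> 0" using ij by (simp add: fps_mult_nth)
    then obtain k where "k \<in> {0..n}" "fps_nth (f i) k * fps_nth (g j) (n - k) \<noteq> 0"
      by (rule sum.not_neutral_contains_not_neutral)
    then have "fps_nth (f i) k \<noteq> 0" "fps_nth (g j) (n - k) \<noteq> 0" "k \<le> n" "n - k \<le> n" by auto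
    with ij show ?thesis by blast
  qed
  have "fps_nth (fsum (A \<times> B) (\<lambda>(i, j). f i * g j)) n = (\<Sum>p\<in>?S \<times> ?R. fps_nth (case p of (i, j) \<Rightarrow> f i * g j) n)"
    by (rule fsum_nth) (use fin sub in auto)
  also have "\<dots> = (\<Sum>i\<in>?S. \<Sum>j\<in>?R. fps_nth (f i * g j) n)" by (simp add: sum.cartesian_product split_beta)
  also have "\<dots> = fps_nth ((\<Sum>i\<in>?S. f i) * (\<Sum>j\<in>?R. g j)) n" by (simp add: sum_product fps_sum_nth)
  also have "\<dots> = (\<Sum>k=0..n. fps_nth (\<Sum>i\<in>?S. f i) k * fps_nth (\<Sum>j\<in>?R. g j) (n - k))" by (simp add: fps_mult_nth)
  also have "\<dots> = (\<Sum>k=0..n. fps_nth (fsum A f) k * fps_nth (fsum B g) (n - k))"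
  proof (intro sum.cong refl arg_cong2[of _ _ _ _ "(*)"])
    fix k assume "k \<in> {0..n}"
    then show "fps_nth (\<Sum>i\<in>?S. f i) k = fps_nth (fsum A f) k"
      unfolding fps_sum_nth by (intro fsum_nth[symmetric]) (use fin in auto)
    show "fps_nth (\<Sum>i\<in>?R. g i) (n - k) = fps_nth (fsum B g) (n - k)"
      unfolding fps_sum_nth by (intro fsum_nth[symmetric]) (use fin in auto)
  qed
  also have "\<dots> = fps_nth (fsum A f * fsum B g) n" by (simp add: fps_mult_nth)
  finally show "fps_nth (fsum (A \<times> B) (\<lambda>(i, j). f i * g j)) n = fps_nth (fsum A f * fsum B g) n" .
qed

lemma fsum_cmult:
  fixes f :: "'i \<Rightarrow> 'a::comm_ring_1 fps"
  assumes "locfin A f"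
  shows "fsum A (\<lambda>i. c * f i) = c * fsum A f"
proof -
  \<comment> \<open>The constant is regarded as a family over a one-element set, so that the product
    rule applies.\<close>
  have bij: "bij_betw (\<lambda>i. ((), i)) A ({()} \<times> A)" by (auto simp: bij_betw_def inj_on_def)
  have "c * fsum A f = fsum {()} (\<lambda>_. c) * fsum A f" by (simp add: fsum_finite)
  also have "\<dots> = fsum ({()} \<times> A) (\<lambda>(_, i). c * f i)" by (rule fsum_mult[symmetric]) (auto simp: assms locfin_finite)
  also have "\<dots> = fsum A (\<lambda>i. c * f i)"
    using fsum_reindex[OF bij, of "\<lambda>(_, i). c * f i"] by simp
  finally show ?thesis ..
qed

lemma locfin_cmult:
  fixes f :: "'i \<Rightarrow> 'a::comm_ring_1 fps"
  assumes "locfin A f"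
  shows "locfin A (\<lambda>i. c * f i)"
  using locfin_mult_left[OF assms, of "\<lambda>_. c"] by (simp add: mult.commute)

lemma
  fixes f :: "'i \<times> 'j \<Rightarrow> 'a::comm_monoid_add fps"
  assumes f: "locfin (A \<times> B) f"
  shows locfin_inner: "i \<in> A \<Longrightarrow> locfin B (\<lambda>j. f (i, j))"
    and locfin_outer: "locfin A (\<lambda>i. fsum B (\<lambda>j. f (i, j)))"
    and fsum_fubini: "fsum (A \<times> B) f = fsum A (\<lambda>i. fsum B (\<lambda>j. f (i, j)))"
proof -
  define S where "S n = {p \<in> A \<times> B. fps_nth (f p) n \<noteq> 0}" for n
  have S: "finite (S n)" for n using f by (simp add: S_def locfin_def)
  show inner: "locfin B (\<lambda>j. f (i, j))" if "i \<in> A" for i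
  proof (rule locfinI)
    fix n
    have "{j \<in> B. fps_nth (f (i, j)) n \<noteq> 0} \<subseteq> snd ` S n" using that by (force simp: S_def)
    then show "finite {j \<in> B. fps_nth (f (i, j)) n \<noteq> 0}" using S finite_surj by blast
  qed
  have in_n: "fps_nth (fsum B (\<lambda>j. f (i, j))) n = (\<Sum>j\<in>snd ` S n. fps_nth (f (i, j)) n)" if "i \<in> A" for i n
    by (rule fsum_nth) (use S that in \<open>force simp: S_def\<close>)+
  have sub: "{i \<in> A. fps_nth (fsum B (\<lambda>j. f (i, j))) n \<noteq> 0} \<subseteq> fst ` S n" for n
  proof clarify
    fix i assume i: "i \<in> A" "fps_nth (fsum B (\<lambda>j. f (i, j))) n \<noteq> 0"
    then have "(\<Sum>j\<in>snd ` S n. fps_nth (f (i, j)) n) \<noteq> 0" using in_n by simp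
    then obtain j where "j \<in> snd ` S n" "fps_nth (f (i, j)) n \<noteq> 0"
      by (rule sum.not_neutral_contains_not_neutral)
    then have "(i, j) \<in> S n" using i by (auto simp: S_def)
    then show "i \<in> fst ` S n" by force
  qed
  show "locfin A (\<lambda>i. fsum B (\<lambda>j. f (i, j)))"
    by (rule locfinI, rule finite_subset[OF sub finite_imageI[OF S]])
  show "fsum (A \<times> B) f = fsum A (\<lambda>i. fsum B (\<lambda>j. f (i, j)))"
  proof (rule fps_ext)
    fix n
    have "fps_nth (fsum A (\<lambda>i. fsum B (\<lambda>j. f (i, j)))) n = (\<Sum>i\<in>fst ` S n. fps_nth (fsum B (\<lambda>j. f (i, j))) n)"
    proof (rule fsum_nth)
      show "finite (fst ` S n)" using S by simp
      show "fst ` S n \<subseteq> A" by (auto simp: S_def)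
      show "i \<in> fst ` S n" if "i \<in> A" "fps_nth (fsum B (\<lambda>j. f (i, j))) n \<noteq> 0" for i
        using sub[of n] that by blast
    qed
    also have "\<dots> = (\<Sum>i\<in>fst ` S n. \<Sum>j\<in>snd ` S n. fps_nth (f (i, j)) n)"
      by (rule sum.cong) (use in_n in \<open>auto simp: S_def\<close>)
    also have "\<dots> = (\<Sum>p\<in>fst ` S n \<times> snd ` S n. fps_nth (f p) n)" by (simp add: sum.cartesian_product split_beta)
    also have "\<dots> = fps_nth (fsum (A \<times> B) f) n"
    proof (rule fsum_nth[symmetric])
      show "finite (fst ` S n \<times> snd ` S n)" using S by simp
      show "fst ` S n \<times> snd ` S n \<subseteq> A \<times> B" by (auto simp: S_def)
      fix p assume "p \<in> A \<times> B" "fps_nth (f p) n \<noteq> 0"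
      then have "p \<in> S n" by (simp add: S_def)
      then have "fst p \<in> fst ` S n" "snd p \<in> snd ` S n" by auto
      then show "p \<in> fst ` S n \<times> snd ` S n" by (cases p) auto
    qed
    finally show "fps_nth (fsum (A \<times> B) f) n = fps_nth (fsum A (\<lambda>i. fsum B (\<lambda>j. f (i, j)))) n" ..
  qed
qed

text \<open>Multiplying out: each factor selects one index, so the expansion runs over functions.
  They are taken extensional on \<open>J\<close>, so that every selection is counted exactly
  once.\<close>

lemma
  fixes f :: "'j \<Rightarrow> 'i \<Rightarrow> 'a::comm_ring_1 fps"
  assumes "finite J" "\<And>j. j \<in> J \<Longrightarrow> locfin A (f j)"
  shows locfin_prod: "locfin (J \<rightarrow>\<^sub>E A) (\<lambda>\<phi>. \<Prod>j\<in>J. f j (\<phi> j))"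
    and fsum_prod: "(\<Prod>j\<in>J. fsum A (f j)) = fsum (J \<rightarrow>\<^sub>E A) (\<lambda>\<phi>. \<Prod>j\<in>J. f j (\<phi> j))"
  using assms
proof (induction J)
  case empty
  { case 1 show ?case by (simp add: locfin_finite) }
  { case 2 show ?case by (simp add: fsum_finite) }
next
  case (insert j J)
  let ?g = "\<lambda>(i, \<phi>). f j i * (\<Prod>k\<in>J. f k (\<phi> k))"
  have bij: "bij_betw (\<lambda>(i, \<phi>). \<phi>(j := i)) (A \<times> (J \<rightarrow>\<^sub>E A)) (insert j J \<rightarrow>\<^sub>E A)"
    unfolding bij_betw_def using insert.hyps by (auto intro: inj_combinator simp: PiE_insert_eq)
  have eq: "(\<lambda>\<phi>. \<Prod>k\<in>insert j J. f k (\<phi> k)) (case p of (i, \<phi>) \<Rightarrow> \<phi>(j := i)) = ?g p"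
    if "p \<in> A \<times> (J \<rightarrow>\<^sub>E A)" for p
  proof -
    obtain i \<phi> where p: "p = (i, \<phi>)" by (cases p)
    have "(\<Prod>k\<in>J. f k ((\<phi>(j := i)) k)) = (\<Prod>k\<in>J. f k (\<phi> k))"
      by (rule prod.cong) (use insert.hyps in auto)
    then show ?thesis using insert.hyps p by simp
  qed
  { case 1
    have "locfin A (f j)" "locfin (J \<rightarrow>\<^sub>E A) (\<lambda>\<phi>. \<Prod>j\<in>J. f j (\<phi> j))" using 1 insert.IH(1) by auto
    then have "locfin (A \<times> (J \<rightarrow>\<^sub>E A)) ?g" by (rule locfin_mult)
    then show ?case
      unfolding locfin_reindex[OF bij, symmetric] using eq by (subst locfin_cong[OF refl eq])
  }
  { case 2
    have "(\<Prod>j\<in>insert j J. fsum A (f j)) = fsum A (f j) * fsum (J \<rightarrow>\<^sub>E A) (\<lambda>\<phi>. \<Prod>j\<in>J. f j (\<phi> j))"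
      using insert 2 by simp
    also have "\<dots> = fsum (A \<times> (J \<rightarrow>\<^sub>E A)) ?g"
      by (rule fsum_mult[symmetric]) (use 2 insert.IH(1) in auto)
    also have "\<dots> = fsum (A \<times> (J \<rightarrow>\<^sub>E A)) (\<lambda>p. (\<lambda>\<phi>. \<Prod>k\<in>insert j J. f k (\<phi> k)) (case p of (i, \<phi>) \<Rightarrow> \<phi>(j := i)))"
      by (rule fsum_cong) (use eq in auto)
    also have "\<dots> = fsum (insert j J \<rightarrow>\<^sub>E A) (\<lambda>\<phi>. \<Prod>k\<in>insert j J. f k (\<phi> k))"
      by (rule fsum_reindex[OF bij])
    finally show ?case .
  }
qed

section \<open>Theta functions as power series in \<open>T\<close>\<close>

text \<open>The value at \<open>x\<close> of a two-sided Laurent series whose coefficients are power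
  series in T; it is meaningful because local finiteness forces the coefficients to tend to 0 in the
  T-adic sense.\<close>

definition ev :: "(int \<Rightarrow> 'a::field fps) \<Rightarrow> 'a \<Rightarrow> 'a fps" where
  "ev a x = fsum UNIV (\<lambda>k. a k * fps_const (x powi k))"

definition conv :: "(int \<Rightarrow> 'a::field fps) \<Rightarrow> (int \<Rightarrow> 'a fps) \<Rightarrow> int \<Rightarrow> 'a fps" where
  "conv a b l = fsum UNIV (\<lambda>i. a i * b (l - i))"

lemma
  fixes a b :: "int \<Rightarrow> 'a::field fps"
  assumes a: "locfin UNIV a" and b: "locfin UNIV b"
  shows locfin_conv: "locfin UNIV (conv a b)"
    and ev_conv: "x \<noteq> 0 \<Longrightarrow> ev (conv a b) x = ev a x * ev b x"
proof -
  have bij: "bij_betw (\<lambda>(l, i). (i, l - i)) (UNIV :: (int \<times> int) set) (UNIV \<times> UNIV)"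
    by (rule bij_betw_byWitness[where f' = "\<lambda>(i, j). (i + j, i)"]) auto
  have lf: "locfin (UNIV \<times> UNIV) (\<lambda>(l, i). a i * b (l - i))"
    using locfin_reindex[OF bij, of "\<lambda>(i, j). a i * b j"] locfin_mult[OF a b] by (simp add: case_prod_unfold)
  show "locfin UNIV (conv a b)" using locfin_outer[OF lf] unfolding conv_def by simp
  assume x: "x \<noteq> 0"
  let ?a = "\<lambda>k. a k * fps_const (x powi k)" and ?b = "\<lambda>k. b k * fps_const (x powi k)"
  have lfab: "locfin UNIV ?a" "locfin UNIV ?b" using a b by (auto intro: locfin_mult_left)
  have bij2: "bij_betw (\<lambda>(l, i). (i, l - i)) ((UNIV :: int set) \<times> (UNIV :: int set)) (UNIV \<times> UNIV)"
    using bij by simp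
  have lf2: "locfin (UNIV \<times> UNIV) (\<lambda>(l, i). ?a i * ?b (l - i))"
    using locfin_reindex[OF bij2, of "\<lambda>(i, j). ?a i * ?b j"] locfin_mult[OF lfab] by (simp add: case_prod_unfold)
  have "ev a x * ev b x = fsum (UNIV \<times> UNIV) (\<lambda>(i, j). ?a i * ?b j)"
    unfolding ev_def by (rule fsum_mult[symmetric, OF lfab])
  also have "\<dots> = fsum (UNIV \<times> UNIV) (\<lambda>(l, i). ?a i * ?b (l - i))"
    using fsum_reindex[OF bij2, of "\<lambda>(i, j). ?a i * ?b j"] by (simp add: case_prod_unfold)
  also have "\<dots> = fsum UNIV (\<lambda>l. fsum UNIV (\<lambda>i. ?a i * ?b (l - i)))"
    by (subst fsum_fubini[OF lf2]) simp
  also have "\<dots> = ev (conv a b) x"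
    unfolding ev_def
  proof (rule fsum_cong[OF refl])
    fix l :: int
    have "fsum UNIV (\<lambda>i. ?a i * ?b (l - i)) = fsum UNIV (\<lambda>i. fps_const (x powi l) * (a i * b (l - i)))"
    proof (rule fsum_cong[OF refl])
      fix i
      have "x powi l = x powi i * x powi (l - i)" using power_int_add[of x i "l - i"] x by simp
      then show "?a i * ?b (l - i) = fps_const (x powi l) * (a i * b (l - i))"
        by (simp add: fps_const_mult[symmetric] del: fps_const_mult)
    qed
    also have "\<dots> = fps_const (x powi l) * conv a b l"
      unfolding conv_def by (rule fsum_cmult) (rule locfin_mult_left[OF a])
    finally show "fsum UNIV (\<lambda>i. ?a i * ?b (l - i)) = conv a b l * fps_const (x powi l)" by (simp add: mult.commute)
  qed
  finally show "ev (conv a b) x = ev a x * ev b x" ..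
qed

text \<open>Coefficient sequences of theta functions of degree \<open>2 t\<close>. The quasi-period relation
  is only required where the exponent of \<open>T\<close> is nonnegative; parity supplies the rest.\<close>

definition quasi_periodic :: "int \<Rightarrow> int \<Rightarrow> (int \<Rightarrow> 'a::field fps) \<Rightarrow> bool" where
  "quasi_periodic s t a \<longleftrightarrow> (\<forall>k. a (- k) = of_int s * a k) \<and>
     (\<forall>k \<ge> - t. a (k + 2 * t) = fps_X ^ nat (k + t) * a k)"

text \<open>Reflection sends \<open>k\<close> to \<open>- (k + 2 * t)\<close>, where the relation is
  available with a nonnegative exponent; the sign introduced by parity squares to 1.\<close>

lemma quasi_periodic_down:
  assumes "quasi_periodic s t a" "s * s = 1" "k \<le> - t"
  shows "a k = fps_X ^ nat (- k - t) * a (k + 2 * t)"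
proof -
  have neg: "\<And>k. a (- k) = of_int s * a k" and per: "\<And>k. k \<ge> - t \<Longrightarrow> a (k + 2 * t) = fps_X ^ nat (k + t) * a k"
    using assms(1) by (auto simp: quasi_periodic_def)
  have s: "of_int s * (of_int s * y) = y" for y :: "'a fps"
    using assms(2) by (metis mult.assoc mult_1 of_int_1 of_int_mult)
  have "a (- k) = fps_X ^ nat (- k - t) * a (- (k + 2 * t))"
    using per[of "- (k + 2 * t)"] assms(3) by (simp add: algebra_simps)
  then have "of_int s * a k = fps_X ^ nat (- k - t) * (of_int s * a (k + 2 * t))" by (simp only: neg)
  then have "of_int s * (of_int s * a k) = of_int s * (of_int s * (fps_X ^ nat (- k - t) * a (k + 2 * t)))"
    by (simp add: ac_simps)
  then show ?thesis by (simp only: s)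
qed

lemma quasi_periodic_conv:
  fixes a b :: "int \<Rightarrow> 'a::field fps"
  assumes a: "quasi_periodic s t a" and b: "quasi_periodic s' t' b" and s: "s * s = 1" "s' * s' = 1"
    and lf: "locfin UNIV a"
  shows "quasi_periodic (s * s') (t + t') (conv a b)"
  unfolding quasi_periodic_def
proof (intro conjI allI impI)
  have neg: "\<And>k. a (- k) = of_int s * a k" "\<And>k. b (- k) = of_int s' * b k"
    using a b by (auto simp: quasi_periodic_def)
  have per: "\<And>k. k \<ge> - t \<Longrightarrow> a (k + 2 * t) = fps_X ^ nat (k + t) * a k"
    "\<And>k. k \<ge> - t' \<Longrightarrow> b (k + 2 * t') = fps_X ^ nat (k + t') * b k"
    using a b by (auto simp: quasi_periodic_def)
  have lfl: "locfin UNIV (\<lambda>i. a i * b (l - i))" for l by (rule locfin_mult_left[OF lf])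
  fix k :: int
  have "conv a b (- k) = fsum UNIV (\<lambda>i. a (- i) * b (- k - (- i)))"
    unfolding conv_def by (rule fsum_reindex[symmetric]) (rule bij_betw_byWitness[where f' = uminus], auto)
  also have "\<dots> = fsum UNIV (\<lambda>i. of_int (s * s') * (a i * b (k - i)))"
    by (rule fsum_cong[OF refl]) (use neg(2)[of "k - i" for i] in \<open>simp add: neg(1)\<close>)
  also have "\<dots> = of_int (s * s') * conv a b k" unfolding conv_def by (rule fsum_cmult[OF lfl])
  finally show "conv a b (- k) = of_int (s * s') * conv a b k" .
next
  have per: "\<And>k. k \<ge> - t \<Longrightarrow> a (k + 2 * t) = fps_X ^ nat (k + t) * a k"
    "\<And>k. k \<ge> - t' \<Longrightarrow> b (k + 2 * t') = fps_X ^ nat (k + t') * b k"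
    using a b by (auto simp: quasi_periodic_def)
  have lfl: "locfin UNIV (\<lambda>i. a i * b (l - i))" for l by (rule locfin_mult_left[OF lf])
  fix k assume k: "- (t + t') \<le> k"
  have "conv a b (k + 2 * (t + t')) = fsum UNIV (\<lambda>i. a (i + 2 * t) * b (k + 2 * (t + t') - (i + 2 * t)))"
    unfolding conv_def
    by (rule fsum_reindex[symmetric]) (rule bij_betw_byWitness[where f' = "\<lambda>i. i - 2 * t"], auto)
  also have "\<dots> = fsum UNIV (\<lambda>i. fps_X ^ nat (k + (t + t')) * (a i * b (k - i)))"
  proof (rule fsum_cong[OF refl])
    fix i :: int
    have e: "k + 2 * (t + t') - (i + 2 * t) = (k - i) + 2 * t'" by simp
    \<comment> \<open>Since \<open>k \<ge> - (t + t')\<close>, at most one factor lies below its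
      range. That factor uses the downward relation, and the exponent of the other one exceeds
      \<open>k + (t + t')\<close> by exactly the power of T absorbed there.\<close>
    consider "i \<ge> - t" "k - i \<ge> - t'" | "i < - t" | "k - i < - t'" by linarith
    then show "a (i + 2 * t) * b (k + 2 * (t + t') - (i + 2 * t)) = fps_X ^ nat (k + (t + t')) * (a i * b (k - i))"
    proof cases
      case 1
      then have "nat (k + (t + t')) = nat (i + t) + nat (k - i + t')" by simp
      then show ?thesis unfolding e using 1 by (simp add: per power_add)
    next
      case 2
      then have "k - i \<ge> - t'" using k by simp
      moreover have "nat (k - i + t') = nat (k + (t + t')) + nat (- i - t)" using 2 k by simp
      ultimately show ?thesis unfolding e using 2 quasi_periodic_down[OF a s(1), of i] by (simp add: per power_add)
    next
      case 3
      then have "i \<ge> - t" using k by simp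
      moreover have "nat (i + t) = nat (k + (t + t')) + nat (- (k - i) - t')" using 3 k by simp
      ultimately show ?thesis unfolding e using 3 quasi_periodic_down[OF b s(2), of "k - i"] by (simp add: per power_add)
    qed
  qed
  also have "\<dots> = fps_X ^ nat (k + (t + t')) * conv a b k" unfolding conv_def by (rule fsum_cmult[OF lfl])
  finally show "conv a b (k + 2 * (t + t')) = fps_X ^ nat (k + (t + t')) * conv a b k" .
qed

lemma square_plus_ge:
  fixes n r t :: int
  assumes "\<bar>r\<bar> \<le> t"
  shows "t * (\<bar>n\<bar> * (\<bar>n\<bar> - 1)) \<le> t * n\<^sup>2 + r * n"
proof -
  have "\<bar>r * n\<bar> \<le> t * \<bar>n\<bar>" using assms by (simp add: abs_mult mult_right_mono)
  then have "- (t * \<bar>n\<bar>) \<le> r * n" by linarith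
  moreover have "t * (\<bar>n\<bar> * (\<bar>n\<bar> - 1)) = t * n\<^sup>2 - t * \<bar>n\<bar>"
    by (simp add: right_diff_distrib power2_eq_square)
  ultimately show ?thesis by linarith
qed

lemma abs_mult_pred_ge: "\<bar>n\<bar> - 1 \<le> \<bar>n\<bar> * (\<bar>n\<bar> - 1)" for n :: int
proof (cases "n = 0")
  case False
  then have "1 * (\<bar>n\<bar> - 1) \<le> \<bar>n\<bar> * (\<bar>n\<bar> - 1)" by (intro mult_right_mono) auto
  then show ?thesis by simp
qed simp

lemma square_plus_nonneg:
  fixes n r t :: int
  assumes "\<bar>r\<bar> \<le> t"
  shows "0 \<le> t * n\<^sup>2 + r * n"
proof -
  have "0 \<le> \<bar>n\<bar> * (\<bar>n\<bar> - 1)" by (cases "n = 0") auto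
  then have "0 \<le> t * (\<bar>n\<bar> * (\<bar>n\<bar> - 1))" using assms by simp
  with square_plus_ge[OF assms, of n] show ?thesis by simp
qed

text \<open>Iterating the relation accumulates the exponents 2 t m + r + t for m < n, whose sum is t
  n^2 + r n. Negative \<open>n\<close> follow by parity.\<close>

lemma quasi_periodic_shift:
  fixes a :: "int \<Rightarrow> 'a::field fps"
  assumes a: "quasi_periodic s t a" and s: "s * s = 1" and r: "\<bar>r\<bar> \<le> t"
  shows "a (2 * t * n + r) = fps_X ^ nat (t * n\<^sup>2 + r * n) * a r"
proof -
  have neg: "\<And>k. a (- k) = of_int s * a k" and per: "\<And>k. k \<ge> - t \<Longrightarrow> a (k + 2 * t) = fps_X ^ nat (k + t) * a k"
    using a by (auto simp: quasi_periodic_def)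
  have pos: "a (2 * t * int m + r) = fps_X ^ nat (t * (int m)\<^sup>2 + r * int m) * a r" if r: "\<bar>r\<bar> \<le> t" for r m
  proof (induction m)
    case (Suc m)
    let ?k = "2 * t * int m + r"
    have "0 \<le> 2 * t * int m" using r by simp
    then have k: "0 \<le> ?k + t" using r by linarith
    have "a (2 * t * int (Suc m) + r) = a (?k + 2 * t)" by (simp add: algebra_simps)
    also have "\<dots> = fps_X ^ nat (?k + t) * (fps_X ^ nat (t * (int m)\<^sup>2 + r * int m) * a r)"
      using per[of ?k] Suc.IH k by simp
    also have "\<dots> = fps_X ^ (nat (?k + t) + nat (t * (int m)\<^sup>2 + r * int m)) * a r"
      by (simp add: power_add mult.assoc)
    also have "nat (?k + t) + nat (t * (int m)\<^sup>2 + r * int m) = nat (t * (int (Suc m))\<^sup>2 + r * int (Suc m))"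
      unfolding nat_add_distrib[OF k square_plus_nonneg[OF r], symmetric]
      by (simp add: algebra_simps power2_eq_square)
    finally show ?case .
  qed simp
  show ?thesis
  proof (cases "n \<ge> 0")
    case True
    then show ?thesis using pos[OF r, of "nat n"] by simp
  next
    case False
    then obtain m where m: "n = - int m" by (metis int_nat_eq minus_minus nat_0_le neg_0_le_iff_le nle_le)
    have "a (2 * t * n + r) = of_int s * a (2 * t * int m + (- r))"
      using neg[of "2 * t * int m + (- r)"] m by simp
    also have "\<dots> = of_int s * (fps_X ^ nat (t * n\<^sup>2 + r * n) * a (- r))"
      using pos[of "- r" m] r m by simp
    also have "a (- r) = of_int s * a r" by (rule neg)
    also have "of_int s * (fps_X ^ nat (t * n\<^sup>2 + r * n) * (of_int s * a r)) =
        of_int (s * s) * (fps_X ^ nat (t * n\<^sup>2 + r * n) * a r)" by simp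
    finally show ?thesis using s by simp
  qed
qed

lemma locfin_powers:
  assumes "\<And>n. finite {k \<in> A. e k = n}"
  shows "locfin A (\<lambda>k. fps_X ^ e k * fps_const (c k :: 'a::comm_ring_1))"
proof (rule locfinI)
  fix n
  have "{k \<in> A. fps_nth (fps_X ^ e k * fps_const (c k)) n \<noteq> 0} \<subseteq> {k \<in> A. e k = n}"
    by (auto simp: fps_X_power_nth split: if_splits)
  then show "finite {k \<in> A. fps_nth (fps_X ^ e k * fps_const (c k)) n \<noteq> 0}" using assms finite_subset by blast
qed

lemma finite_square_plus:
  fixes r t :: int
  assumes "\<bar>r\<bar> \<le> t" "1 \<le> t"
  shows "finite {n. nat (t * n\<^sup>2 + r * n) = N}"
proof -
  have "{n. nat (t * n\<^sup>2 + r * n) = N} \<subseteq> {- (int N + 1)..int N + 1}"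
  proof
    fix n assume "n \<in> {n. nat (t * n\<^sup>2 + r * n) = N}"
    then have N: "int N = t * n\<^sup>2 + r * n" using square_plus_nonneg[OF assms(1), of n] by auto
    have "0 \<le> \<bar>n\<bar> * (\<bar>n\<bar> - 1)" by (cases "n = 0") auto
    then have "1 * (\<bar>n\<bar> * (\<bar>n\<bar> - 1)) \<le> t * (\<bar>n\<bar> * (\<bar>n\<bar> - 1))" using assms(2) by (intro mult_right_mono) auto
    with N square_plus_ge[OF assms(1), of n] abs_mult_pred_ge[of n] have "\<bar>n\<bar> - 1 \<le> int N" by linarith
    then show "n \<in> {- (int N + 1)..int N + 1}" by auto
  qed
  then show ?thesis by (rule finite_subset) simp
qed

text \<open>With k = 2 t n + r the exponent of T is (k^2 - r^2) / (4 t). This is the antisymmetrized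
  theta series of the residue class of r modulo 2 t, normalized so that the term n = 0 has exponent
  0.\<close>

definition theta :: "int \<Rightarrow> int \<Rightarrow> 'a::field \<Rightarrow> 'a fps" where
  "theta t r x = fsum UNIV (\<lambda>n. fps_X ^ nat (t * n\<^sup>2 + r * n) *
     fps_const (x powi (2 * t * n + r) - x powi (- (2 * t * n + r))))"

lemma locfin_theta:
  assumes "\<bar>r\<bar> \<le> t" "1 \<le> t"
  shows "locfin UNIV (\<lambda>n. fps_X ^ nat (t * n\<^sup>2 + r * n) * fps_const (c n :: 'a::field))"
  by (rule locfin_powers) (use finite_square_plus[OF assms] in simp)

text \<open>An odd quasi-periodic sequence is determined by its values on one period. Oddness
  removes the residues 0 and \<open>t\<close> and pairs \<open>r\<close> with \<open>- r\<close>, so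
  t - 1 theta series remain.\<close>

lemma ev_quasi_periodic_odd:
  fixes a :: "int \<Rightarrow> 'a::field_char_0 fps"
  assumes t: "1 \<le> t" and a: "quasi_periodic (- 1) t a" and lf: "locfin UNIV a"
  shows "ev a x = (\<Sum>r\<in>{1..<t}. a r * theta t r x)"
proof -
  define U where "U r = fsum UNIV (\<lambda>n. fps_X ^ nat (t * n\<^sup>2 + r * n) * fps_const (x powi (2 * t * n + r)))" for r
  have neg: "a (- k) = - a k" for k using a by (simp add: quasi_periodic_def)
  \<comment> \<open>Representatives are chosen in the half-open interval from \<open>- t\<close> to
    \<open>t\<close>, which is symmetric apart from the residue \<open>t\<close>.\<close>
  have bij: "bij_betw (\<lambda>(r, n). 2 * t * n + r) ({- t<..t} \<times> UNIV) UNIV"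
  proof (rule bij_betw_byWitness[where f' = "\<lambda>k. (let r = (k + t - 1) mod (2 * t) - t + 1 in (r, (k - r) div (2 * t)))"], goal_cases)
    case 1
    show ?case
    proof clarify
      fix r n assume "r \<in> {- t<..t}"
      then have "0 \<le> r + t - 1" "r + t - 1 < 2 * t" by auto
      then have "(r + t - 1 + 2 * t * n) mod (2 * t) = r + t - 1" by (simp add: mod_pos_pos_trivial)
      then have "(2 * t * n + r + t - 1) mod (2 * t) = r + t - 1" by (simp add: algebra_simps)
      then show "(let r' = (2 * t * n + r + t - 1) mod (2 * t) - t + 1 in (r', (2 * t * n + r - r') div (2 * t))) = (r, n)"
        using t by simp
    qed
  next
    case 2
    show ?case
    proof clarify
      fix k :: int
      let ?r = "(k + t - 1) mod (2 * t) - t + 1"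
      have "k - ?r = (k + t - 1) - (k + t - 1) mod (2 * t)" by simp
      also have "\<dots> = 2 * t * ((k + t - 1) div (2 * t))" by (simp add: minus_mod_eq_mult_div)
      finally have "k - ?r = 2 * t * ((k + t - 1) div (2 * t))" .
      then have "2 * t * ((k - ?r) div (2 * t)) = k - ?r" using t by simp
      then show "(case let r = ?r in (r, (k - r) div (2 * t)) of (r, n) \<Rightarrow> 2 * t * n + r) = k" by (simp add: Let_def)
    qed
  next
    case 4
    show ?case
    proof (rule image_subsetI)
      fix k :: int
      define m where "m = (k + t - 1) mod (2 * t)"
      have "0 \<le> m" "m < 2 * t" using t by (auto simp: m_def)
      then show "(let r = (k + t - 1) mod (2 * t) - t + 1 in (r, (k - r) div (2 * t))) \<in> {- t<..t} \<times> UNIV"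
        unfolding Let_def m_def[symmetric] by auto
    qed
  qed auto
  let ?f = "\<lambda>k. a k * fps_const (x powi k)"
  have lf2: "locfin ({- t<..t} \<times> UNIV) (\<lambda>p. ?f (case p of (r, n) \<Rightarrow> 2 * t * n + r))"
    using locfin_reindex[OF bij, of ?f] locfin_mult_left[OF lf, of "\<lambda>k. fps_const (x powi k)"] by blast
  have "ev a x = fsum ({- t<..t} \<times> UNIV) (\<lambda>p. ?f (case p of (r, n) \<Rightarrow> 2 * t * n + r))"
    unfolding ev_def by (rule fsum_reindex[OF bij, symmetric])
  also have "\<dots> = (\<Sum>r\<in>{- t<..t}. fsum UNIV (\<lambda>n. ?f (2 * t * n + r)))"
    by (subst fsum_fubini[OF lf2], subst fsum_finite) auto
  also have "\<dots> = (\<Sum>r\<in>{- t<..t}. a r * U r)"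
  proof (rule sum.cong[OF refl])
    fix r assume "r \<in> {- t<..t}"
    then have r: "\<bar>r\<bar> \<le> t" by auto
    have "fsum UNIV (\<lambda>n. ?f (2 * t * n + r)) =
        fsum UNIV (\<lambda>n. a r * (fps_X ^ nat (t * n\<^sup>2 + r * n) * fps_const (x powi (2 * t * n + r))))"
      by (rule fsum_cong[OF refl], subst quasi_periodic_shift[OF a _ r]) (auto simp: mult_ac)
    also have "\<dots> = a r * U r" unfolding U_def by (rule fsum_cmult) (rule locfin_theta[OF r t])
    finally show "fsum UNIV (\<lambda>n. ?f (2 * t * n + r)) = a r * U r" .
  qed
  also have "\<dots> = (\<Sum>r\<in>{1..<t}. a r * U r) + (\<Sum>r\<in>{- t<..- 1}. a r * U r)"
  proof -
    have "a 0 = 0" using neg[of 0] by simp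
    moreover have "a t = 0"
    proof -
      \<comment> \<open>At \<open>k = - t\<close> the exponent in the relation is 0, so
        \<open>a t = a (- t)\<close>; oddness then forces \<open>a t = 0\<close>.\<close>
      have "a (- t + 2 * t) = fps_X ^ nat (- t + t) * a (- t)" using a unfolding quasi_periodic_def by blast
      then have "a t = - a t" using neg[of t] by simp
      then show ?thesis by simp
    qed
    moreover have split: "{- t<..t} = insert 0 (insert t ({1..<t} \<union> {- t<..- 1}))" using t by auto
    have "(\<Sum>r\<in>{- t<..t}. a r * U r) = a 0 * U 0 + (a t * U t + ((\<Sum>r\<in>{1..<t}. a r * U r) + (\<Sum>r\<in>{- t<..- 1}. a r * U r)))"
      unfolding split using t by (subst sum.insert, simp, simp, subst sum.insert, simp, simp, subst sum.union_disjoint) auto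
    ultimately show ?thesis by simp
  qed
  also have "(\<Sum>r\<in>{- t<..- 1}. a r * U r) = (\<Sum>r\<in>{1..<t}. a (- r) * U (- r))"
    by (rule sum.reindex_bij_witness[of _ uminus uminus]) auto
  also have "(\<Sum>r\<in>{1..<t}. a r * U r) + (\<Sum>r\<in>{1..<t}. a (- r) * U (- r)) = (\<Sum>r\<in>{1..<t}. a r * theta t r x)"
    unfolding sum.distrib[symmetric]
  proof (rule sum.cong[OF refl])
    fix r assume "r \<in> {1..<t}"
    then have r: "\<bar>r\<bar> \<le> t" by auto
    have "U (- r) = fsum UNIV (\<lambda>n. fps_X ^ nat (t * (- n)\<^sup>2 + (- r) * (- n)) * fps_const (x powi (2 * t * (- n) + (- r))))"
      unfolding U_def by (rule fsum_reindex[symmetric]) (rule bij_betw_byWitness[where f' = uminus], auto)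
    then have U: "U (- r) = fsum UNIV (\<lambda>n. fps_X ^ nat (t * n\<^sup>2 + r * n) * fps_const (x powi (- (2 * t * n + r))))"
      by (simp add: algebra_simps)
    have "theta t r x = fsum UNIV (\<lambda>n. fps_X ^ nat (t * n\<^sup>2 + r * n) * fps_const (x powi (2 * t * n + r)) +
        (- 1) * (fps_X ^ nat (t * n\<^sup>2 + r * n) * fps_const (x powi (- (2 * t * n + r)))))"
      unfolding theta_def by (rule fsum_cong[OF refl]) (simp add: algebra_simps flip: fps_const_sub)
    also have "\<dots> = U r + (- 1) * U (- r)"
      unfolding U by (subst fsum_add, rule locfin_theta[OF r t], rule locfin_cmult, rule locfin_theta[OF r t],
          subst fsum_cmult, rule locfin_theta[OF r t]) (simp add: U_def)
    finally have th: "theta t r x = U r - U (- r)" by simp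
    show "a r * U r + a (- r) * U (- r) = a r * theta t r x" unfolding th neg by (simp add: algebra_simps)
  qed
  finally show ?thesis .
qed

text \<open>Coefficients in the image of the integers. In the final induction this property turns an
  unknown discrepancy into a rational number.\<close>

definition int_coeffs :: "'a::ring_1 fps \<Rightarrow> bool" where
  "int_coeffs f \<longleftrightarrow> (\<forall>n. fps_nth f n \<in> \<int>)"

lemma int_coeffs_simps [intro]:
  fixes f g :: "'a::comm_ring_1 fps"
  shows "int_coeffs 0" "int_coeffs 1" "int_coeffs fps_X" "int_coeffs f \<Longrightarrow> int_coeffs (- f)"
    "int_coeffs f \<Longrightarrow> int_coeffs g \<Longrightarrow> int_coeffs (f + g)"
    "int_coeffs f \<Longrightarrow> int_coeffs g \<Longrightarrow> int_coeffs (f - g)"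
    "int_coeffs f \<Longrightarrow> int_coeffs g \<Longrightarrow> int_coeffs (f * g)"
  by (auto simp: int_coeffs_def fps_mult_nth fps_X_def)

lemma int_coeffs_power [intro]: "int_coeffs f \<Longrightarrow> int_coeffs (f ^ n :: 'a::comm_ring_1 fps)"
  by (induction n) auto

lemma int_coeffs_sum [intro]: "(\<And>i. i \<in> A \<Longrightarrow> int_coeffs (f i)) \<Longrightarrow> int_coeffs (\<Sum>i\<in>A. f i :: 'a::comm_ring_1 fps)"
  by (induction A rule: infinite_finite_induct) auto

lemma int_coeffs_prod [intro]: "(\<And>i. i \<in> A \<Longrightarrow> int_coeffs (f i)) \<Longrightarrow> int_coeffs (\<Prod>i\<in>A. f i :: 'a::comm_ring_1 fps)"
  by (induction A rule: infinite_finite_induct) auto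

lemma int_coeffs_fsum [intro]: "(\<And>i. i \<in> A \<Longrightarrow> int_coeffs (f i)) \<Longrightarrow> int_coeffs (fsum A f :: 'a::comm_ring_1 fps)"
  by (auto simp: int_coeffs_def fsum_def)

text \<open>Up to a power of T, \<open>thA\<close> and \<open>thB\<close> are the coefficient
  sequences of Jacobi's theta_3 and theta_2 with nome T, namely of the sums over m of T^(m^2) x^(2
  m) and of T^(m (m + 1)) x^(2 m + 1). They are even of degree two.\<close>

definition thA :: "int \<Rightarrow> 'a::field fps" where
  "thA k = (if even k then fps_X ^ nat ((k div 2)\<^sup>2) else 0)"

definition thB :: "int \<Rightarrow> 'a::field fps" where
  "thB k = (if odd k then fps_X ^ nat ((k div 2) * (k div 2 + 1)) else 0)"

text \<open>The odd series of degree four obtained from the Jacobi theta function \<open>th\<close>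
  at x^2 after division by x. It provides the long roots in Macdonald's identity.\<close>

definition thD :: "int \<Rightarrow> 'a::field fps" where
  "thD k = (if odd k then (if even (k div 2) then - 1 else 1) * fps_X ^ nat ((k div 2) * (k div 2 + 1) div 2) else 0)"

lemma thA_even: "k = 2 * m \<Longrightarrow> thA k = (fps_X ^ nat (m\<^sup>2) :: 'a::field fps)" by (simp add: thA_def)
lemma thA_odd: "k = 2 * m + 1 \<Longrightarrow> thA k = (0 :: 'a::field fps)" by (simp add: thA_def)
lemma thB_odd: "k = 2 * m + 1 \<Longrightarrow> thB k = (fps_X ^ nat (m * (m + 1)) :: 'a::field fps)" by (simp add: thB_def)
lemma thB_even: "k = 2 * m \<Longrightarrow> thB k = (0 :: 'a::field fps)" by (simp add: thB_def)
lemma thD_odd: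
  "k = 2 * m + 1 \<Longrightarrow> thD k = ((if even m then - 1 else 1) * fps_X ^ nat (m * (m + 1) div 2) :: 'a::field fps)"
  by (simp add: thD_def)
lemma thD_even: "k = 2 * m \<Longrightarrow> thD k = (0 :: 'a::field fps)" by (simp add: thD_def)

lemma nat_mult_pred: "0 \<le> m * (m + 1)" for m :: int
  by (cases "m \<ge> 0") (auto intro: mult_nonpos_nonpos)

lemma even_mult_pred: "even (m * (m + 1))" for m :: int
  by auto

lemma int_even_odd_cases:
  fixes k :: int
  obtains (1) m where "k = 2 * m" | (2) m where "k = 2 * m + 1"
  by (metis evenE oddE)

section \<open>Local finiteness and quasi-periods of the basic theta functions\<close>

lemma locfin_lt:
  fixes f :: "int \<Rightarrow> 'a::field fps"
  assumes "\<And>k n. fps_nth (f k) n \<noteq> 0 \<Longrightarrow> \<bar>k\<bar> \<le> c * int n + d"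
  shows "locfin A f"
proof (rule locfinI)
  fix n
  have "{i \<in> A. fps_nth (f i) n \<noteq> 0} \<subseteq> {- (c * int n + d)..c * int n + d}" using assms[of _ n] by (auto dest!: assms)
  then show "finite {i \<in> A. fps_nth (f i) n \<noteq> 0}" by (rule finite_subset) simp
qed

lemma mult_succ_ge: "\<bar>2 * m + 1\<bar> \<le> m * (m + 1) + 3" for m :: int
proof -
  have "0 \<le> (m - 1)\<^sup>2" "0 \<le> (m + 1)\<^sup>2" "0 \<le> (m + 2)\<^sup>2" by simp_all
  then show ?thesis unfolding power2_eq_square by (simp add: algebra_simps abs_le_iff)
qed

lemma locfin_thA: "locfin UNIV thA"
proof (rule locfin_lt[where c = 1 and d = 1])
  fix k :: int and n assume *: "fps_nth (thA k :: 'a fps) n \<noteq> 0"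
  show "\<bar>k\<bar> \<le> 1 * int n + 1"
  proof (cases k rule: int_even_odd_cases)
    case (1 m)
    with * have "n = nat (m\<^sup>2)" by (simp add: thA_even fps_X_power_nth split: if_splits)
    then have n: "int n = m\<^sup>2" by simp
    have "0 \<le> (m - 1)\<^sup>2" "0 \<le> (m + 1)\<^sup>2" by simp_all
    then show ?thesis using 1 n unfolding power2_eq_square by (simp add: algebra_simps abs_le_iff)
  qed (use * in \<open>simp add: thA_odd\<close>)
qed

lemma locfin_thB: "locfin UNIV thB"
proof (rule locfin_lt[where c = 1 and d = 3])
  fix k :: int and n assume *: "fps_nth (thB k :: 'a fps) n \<noteq> 0"
  show "\<bar>k\<bar> \<le> 1 * int n + 3"
  proof (cases k rule: int_even_odd_cases)
    case (2 m)
    with * have "n = nat (m * (m + 1))" by (simp add: thB_odd fps_X_power_nth split: if_splits)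
    then have n: "int n = m * (m + 1)" using nat_mult_pred[of m] by simp
    then show ?thesis using 2 mult_succ_ge[of m] by simp
  qed (use * in \<open>simp add: thB_even\<close>)
qed

lemma locfin_thD: "locfin UNIV thD"
proof (rule locfin_lt[where c = 2 and d = 3])
  fix k :: int and n assume *: "fps_nth (thD k :: 'a fps) n \<noteq> 0"
  show "\<bar>k\<bar> \<le> 2 * int n + 3"
  proof (cases k rule: int_even_odd_cases)
    case (2 m)
    with * have "n = nat (m * (m + 1) div 2)" by (simp add: thD_odd fps_X_power_nth split: if_splits)
    then have "2 * int n = m * (m + 1)" using nat_mult_pred[of m] even_mult_pred[of m]
      by (simp only: int_nat_eq) (simp add: dvd_mult_div_cancel)
    then show ?thesis using 2 mult_succ_ge[of m] by simp
  qed (use * in \<open>simp add: thD_even\<close>)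
qed

lemma quasi_periodic_thA: "quasi_periodic 1 1 (thA :: int \<Rightarrow> 'a::field fps)"
  unfolding quasi_periodic_def
proof (intro conjI allI impI)
  fix k :: int
  show "thA (- k) = (of_int 1 * thA k :: 'a fps)"
  proof (cases k rule: int_even_odd_cases)
    case (1 m)
    then have k: "- k = 2 * (- m)" by simp
    show ?thesis unfolding thA_even[OF 1] thA_even[OF k] by simp
  next
    case (2 m)
    then have k: "- k = 2 * (- m - 1) + 1" by simp
    show ?thesis unfolding thA_odd[OF 2] thA_odd[OF k] by (simp add: algebra_simps)
  qed
  assume k: "- 1 \<le> k"
  show "thA (k + 2 * 1) = (fps_X ^ nat (k + 1) * thA k :: 'a fps)"
  proof (cases k rule: int_even_odd_cases)
    case (1 m)
    then have k2: "k + 2 * 1 = 2 * (m + 1)" by simp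
    have "nat ((m + 1)\<^sup>2) = nat (k + 1) + nat (m\<^sup>2)"
      using k 1 by (simp add: nat_add_distrib[symmetric] power2_eq_square algebra_simps)
    then show ?thesis unfolding thA_even[OF 1] thA_even[OF k2] by (simp only: power_add)
  next
    case (2 m)
    then have k2: "k + 2 * 1 = 2 * (m + 1) + 1" by simp
    show ?thesis unfolding thA_odd[OF 2] thA_odd[OF k2] by simp
  qed
qed

lemma quasi_periodic_thB: "quasi_periodic 1 1 (thB :: int \<Rightarrow> 'a::field fps)"
  unfolding quasi_periodic_def
proof (intro conjI allI impI)
  fix k :: int
  show "thB (- k) = (of_int 1 * thB k :: 'a fps)"
  proof (cases k rule: int_even_odd_cases)
    case (1 m)
    then have k: "- k = 2 * (- m)" by simp
    show ?thesis unfolding thB_even[OF 1] thB_even[OF k] by simp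
  next
    case (2 m)
    then have k: "- k = 2 * (- m - 1) + 1" by simp
    show ?thesis unfolding thB_odd[OF 2] thB_odd[OF k] by (simp add: algebra_simps)
  qed
  assume k: "- 1 \<le> k"
  show "thB (k + 2 * 1) = (fps_X ^ nat (k + 1) * thB k :: 'a fps)"
  proof (cases k rule: int_even_odd_cases)
    case (1 m)
    then have k2: "k + 2 * 1 = 2 * (m + 1)" by simp
    show ?thesis unfolding thB_even[OF 1] thB_even[OF k2] by simp
  next
    case (2 m)
    then have k2: "k + 2 * 1 = 2 * (m + 1) + 1" by simp
    have "nat ((m + 1) * (m + 1 + 1)) = nat (k + 1) + nat (m * (m + 1))"
      using k 2 nat_mult_pred[of m] by (simp add: nat_add_distrib[symmetric] algebra_simps)
    then show ?thesis unfolding thB_odd[OF 2] thB_odd[OF k2] by (simp only: power_add)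
  qed
qed

lemma quasi_periodic_thD: "quasi_periodic (- 1) 2 (thD :: int \<Rightarrow> 'a::field fps)"
  unfolding quasi_periodic_def
proof (intro conjI allI impI)
  fix k :: int
  show "thD (- k) = (of_int (- 1) * thD k :: 'a fps)"
  proof (cases k rule: int_even_odd_cases)
    case (1 m)
    then have k: "- k = 2 * (- m)" by simp
    show ?thesis unfolding thD_even[OF 1] thD_even[OF k] by simp
  next
    case (2 m)
    then have k: "- k = 2 * (- m - 1) + 1" by simp
    show ?thesis unfolding thD_odd[OF 2] thD_odd[OF k] by (simp add: algebra_simps)
  qed
  assume k: "- 2 \<le> k"
  show "thD (k + 2 * 2) = (fps_X ^ nat (k + 2) * thD k :: 'a fps)"
  proof (cases k rule: int_even_odd_cases)
    case (1 m)
    then have k2: "k + 2 * 2 = 2 * (m + 2)" by simp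
    show ?thesis unfolding thD_even[OF 1] thD_even[OF k2] by simp
  next
    case (2 m)
    then have k2: "k + 2 * 2 = 2 * (m + 2) + 1" by simp
    have "(m + 2) * (m + 2 + 1) = m * (m + 1) + 2 * (k + 2)" using 2 by (simp add: algebra_simps)
    then have "(m + 2) * (m + 2 + 1) div 2 = m * (m + 1) div 2 + (k + 2)" by simp
    then have "nat ((m + 2) * (m + 2 + 1) div 2) = nat (k + 2) + nat (m * (m + 1) div 2)"
      using k nat_mult_pred[of m] by (simp add: nat_add_distrib[symmetric])
    then show ?thesis unfolding thD_odd[OF 2] thD_odd[OF k2] by (simp add: power_add mult_ac)
  qed
qed

text \<open>The sum side of the Jacobi triple product, with simple factor \<open>1 - z\<close> at
  order T^0.\<close>

definition th :: "'a::field \<Rightarrow> 'a fps" where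
  "th z = fsum UNIV (\<lambda>n. fps_X ^ nat (n * (n - 1) div 2) * fps_const ((if even n then 1 else - 1) * z powi n))"

lemma pred_mult_ge: "\<bar>n\<bar> - 1 \<le> n * (n - 1) div 2" for n :: int
proof -
  have "0 \<le> (n - 1) * (n - 2)" "0 \<le> (n + 1) * (n + 2)"
    using nat_mult_pred[of "n - 2"] nat_mult_pred[of "n + 1"] by (simp_all add: algebra_simps)
  then have "2 * (\<bar>n\<bar> - 1) \<le> n * (n - 1)" by (simp add: algebra_simps abs_le_iff abs_if)
  then show ?thesis by simp
qed

lemma locfin_th:
  "locfin UNIV (\<lambda>n. fps_X ^ nat (n * (n - 1) div 2) * fps_const (c n :: 'a::field))"
proof (rule locfin_lt[where c = 1 and d = 1])
  fix k :: int and n assume *: "fps_nth (fps_X ^ nat (k * (k - 1) div 2) * fps_const (c k)) n \<noteq> 0"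
  then have n: "n = nat (k * (k - 1) div 2)" by (simp add: fps_X_power_nth split: if_splits)
  have "k * (k - 1) div 2 \<le> int n" unfolding n by (rule nat_le_iff[THEN iffD1, OF order_refl])
  then show "\<bar>k\<bar> \<le> 1 * int n + 1" using pred_mult_ge[of k] by linarith
qed

lemma ev_thD:
  fixes x :: "'a::field"
  assumes x: "x \<noteq> 0"
  shows "ev thD x = fps_const (1 / x) * th (x\<^sup>2)"
proof -
  have "ev thD x = fsum {k. odd k} (\<lambda>k. thD k * fps_const (x powi k))"
    unfolding ev_def by (rule fsum_neutral[symmetric]) (auto simp: thD_def)
  also have "\<dots> = fsum UNIV (\<lambda>n. thD (2 * n - 1) * fps_const (x powi (2 * n - 1)))"
    by (rule fsum_reindex[symmetric]) (rule bij_betw_byWitness[where f' = "\<lambda>k. (k + 1) div 2"], auto elim!: oddE)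
  also have "\<dots> = fsum UNIV (\<lambda>n. fps_const (1 / x) * (fps_X ^ nat (n * (n - 1) div 2) *
      fps_const ((if even n then 1 else - 1) * (x\<^sup>2) powi n)))"
  proof (rule fsum_cong[OF refl])
    fix n :: int
    have "x powi (2 * n - 1) = 1 / x * (x\<^sup>2) powi n"
      using x by (simp add: power_int_diff power_int_mult)
    moreover have "thD (2 * n - 1) = (fps_X ^ nat (n * (n - 1) div 2) * fps_const (if even n then 1 else - 1) :: 'a fps)"
      by (subst thD_odd[of _ "n - 1"]) (auto simp: algebra_simps simp flip: fps_const_neg)
    ultimately show "thD (2 * n - 1) * fps_const (x powi (2 * n - 1)) = fps_const (1 / x) *
       (fps_X ^ nat (n * (n - 1) div 2) * fps_const ((if even n then 1 else - 1) * (x\<^sup>2) powi n))"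
      by simp
  qed
  also have "\<dots> = fps_const (1 / x) * th (x\<^sup>2)" unfolding th_def by (rule fsum_cmult[OF locfin_th])
  finally show ?thesis .
qed

text \<open>Weierstrass' three-term relation: \<open>th (x y) th (x / y)\<close> is antisymmetric of rank two in the
  even theta functions \<open>A\<close>, \<open>B\<close> of degree two.\<close>

lemma th_mult:
  fixes x y :: "'a::field"
  assumes x: "x \<noteq> 0" and y: "y \<noteq> 0"
  shows "th (x * y) * th (x / y) = fps_const x * (ev thB x * ev thA y - ev thA x * ev thB y)"
proof -
  let ?e = "\<lambda>n::int. nat (n * (n - 1) div 2)" and ?s = "\<lambda>n::int. if even n then 1 else - 1 :: 'a"
  define G where "G = (\<lambda>(a, b). fps_const (x powi a * y powi b) * (thB (a - 1) * thA b - thA (a - 1) * thB b :: 'a fps))"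
  let ?P = "{(a, b). even (a + b)} :: (int \<times> int) set"
  \<comment> \<open>In the coordinates m + n and m - n the two exponents of T combine into a square
    plus a product of consecutive integers. The new coordinates are exactly the pairs of even
    sum.\<close>
  have bij: "bij_betw (\<lambda>(m, n). (m + n, m - n)) (UNIV \<times> UNIV) ?P"
  proof (rule bij_betw_byWitness[where f' = "\<lambda>(a, b). ((a + b) div 2, (a - b) div 2)"], goal_cases)
    case 2
    show ?case
    proof
      fix p assume "p \<in> ?P"
      then obtain a b where p: "p = (a, b)" "even (a + b)" by auto
      from p(2) obtain c where "a + b = 2 * c" by (rule evenE)
      then have a: "a = 2 * c - b" by simp
      show "(case (case p of (a, b) \<Rightarrow> ((a + b) div 2, (a - b) div 2)) of (m, n) \<Rightarrow> (m + n, m - n)) = p"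
        unfolding p a by simp
    qed
  qed auto
  have "th (x * y) * th (x / y) = fsum (UNIV \<times> UNIV) (\<lambda>(m, n).
      (fps_X ^ ?e m * fps_const (?s m * (x * y) powi m)) * (fps_X ^ ?e n * fps_const (?s n * (x / y) powi n)))"
    unfolding th_def by (rule fsum_mult[symmetric, OF locfin_th locfin_th])
  also have "\<dots> = fsum (UNIV \<times> UNIV) (\<lambda>p. G ((\<lambda>(m, n). (m + n, m - n)) p))"
  proof (rule fsum_cong[OF refl])
    fix p :: "int \<times> int"
    obtain m n where p: "p = (m, n)" by (cases p)
    have pw: "(x * y) powi m * (x / y) powi n = x powi (m + n) * y powi (m - n)"
      using x y by (simp add: power_int_mult_distrib power_int_divide_distrib power_int_add power_int_diff field_simps)
    have "0 \<le> m * (m - 1) div 2" "0 \<le> n * (n - 1) div 2"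
      using nat_mult_pred[of "m - 1"] nat_mult_pred[of "n - 1"] by (simp_all add: algebra_simps)
    then have e: "?e m + ?e n = nat (m * (m - 1) div 2 + n * (n - 1) div 2)"
      by (simp add: nat_add_distrib)
    have ev2: "even (m * (m - 1))" "even (n * (n - 1))" by auto
    \<comment> \<open>The parity of m + n decides which of the two products is present; the other
      one vanishes by the parity of the supports of \<open>thA\<close> and \<open>thB\<close>. The
      sign of the term is the sign in the antisymmetric combination.\<close>
    have main: "fps_X ^ (?e m + ?e n) * fps_const (?s m * ?s n) =
       (thB (m + n - 1) * thA (m - n) - thA (m + n - 1) * thB (m - n) :: 'a fps)"
    proof (cases "m + n" rule: int_even_odd_cases)
      case (1 i)
      then have m: "m = 2 * i - n" by simp
      define j where "j = i - n"
      have mn: "m = i + j" "n = i - j" using m j_def by auto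
      have "2 * (m * (m - 1) div 2 + n * (n - 1) div 2) = m * (m - 1) + n * (n - 1)"
        using ev2 by (metis distrib_left dvd_mult_div_cancel)
      also have "\<dots> = 2 * ((i - 1) * i + j\<^sup>2)" unfolding mn by (simp add: algebra_simps power2_eq_square)
      finally have "m * (m - 1) div 2 + n * (n - 1) div 2 = (i - 1) * i + j\<^sup>2" by (simp only: mult_cancel_left) simp
      then have "?e m + ?e n = nat ((i - 1) * i) + nat (j\<^sup>2)"
        unfolding e using nat_mult_pred[of "i - 1"] by (simp add: nat_add_distrib)
      moreover have "thB (m + n - 1) = (fps_X ^ nat ((i - 1) * i) :: 'a fps)"
        using 1 by (subst thB_odd[of _ "i - 1"]) (auto simp: algebra_simps)
      moreover have "thA (m - n) = (fps_X ^ nat (j\<^sup>2) :: 'a fps)" "thB (m - n) = (0 :: 'a fps)"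
        using mn by (auto intro!: thA_even thB_even)
      moreover have "?s m * ?s n = 1" using 1 m by simp
      ultimately show ?thesis by (simp add: power_add)
    next
      case (2 i)
      define j where "j = i - n"
      have mn: "m = i + j + 1" "n = i - j" using 2 j_def by auto
      have "2 * (m * (m - 1) div 2 + n * (n - 1) div 2) = m * (m - 1) + n * (n - 1)"
        using ev2 by (metis distrib_left dvd_mult_div_cancel)
      also have "\<dots> = 2 * (i\<^sup>2 + j * (j + 1))" unfolding mn by (simp add: algebra_simps power2_eq_square)
      finally have "m * (m - 1) div 2 + n * (n - 1) div 2 = i\<^sup>2 + j * (j + 1)" by (simp only: mult_cancel_left) simp
      then have "?e m + ?e n = nat (i\<^sup>2) + nat (j * (j + 1))"
        unfolding e using nat_mult_pred[of j] by (simp add: nat_add_distrib)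
      moreover have "thA (m + n - 1) = (fps_X ^ nat (i\<^sup>2) :: 'a fps)" "thB (m + n - 1) = (0 :: 'a fps)"
        using 2 by (auto intro!: thA_even thB_even)
      moreover have "thB (m - n) = (fps_X ^ nat (j * (j + 1)) :: 'a fps)"
        using mn by (intro thB_odd) simp
      moreover have "?s m * ?s n = - 1" using mn by simp
      ultimately show ?thesis by (simp add: power_add flip: fps_const_neg)
    qed
    have "(fps_X ^ ?e m * fps_const (?s m * (x * y) powi m)) * (fps_X ^ ?e n * fps_const (?s n * (x / y) powi n)) =
        fps_const ((x * y) powi m * (x / y) powi n) * (fps_X ^ (?e m + ?e n) * fps_const (?s m * ?s n))"
      by (simp add: power_add mult_ac)
    also have "\<dots> = G (m + n, m - n)" unfolding pw main by (simp add: G_def)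
    finally show "(case p of (m, n) \<Rightarrow> fps_X ^ ?e m * fps_const (?s m * (x * y) powi m) *
        (fps_X ^ ?e n * fps_const (?s n * (x / y) powi n))) = G (case p of (m, n) \<Rightarrow> (m + n, m - n))"
      unfolding p prod.case .
  qed
  also have "\<dots> = fsum ?P G" by (rule fsum_reindex[OF bij])
  \<comment> \<open>On pairs of odd sum both products in \<open>G\<close> vanish, since the supports
    of \<open>thA\<close> and \<open>thB\<close> have opposite parity. So the parity condition may
    be dropped and the double sum factors.\<close>
  also have "\<dots> = fsum (UNIV \<times> UNIV) G"
    by (rule fsum_neutral) (auto simp: G_def thA_def thB_def split: if_splits)
  also have "\<dots> = fsum (UNIV \<times> UNIV) (\<lambda>p. G ((\<lambda>(a, b). (a + 1, b)) p))"
    by (rule fsum_reindex[symmetric]) (rule bij_betw_byWitness[where f' = "\<lambda>(a, b). (a - 1, b)"], auto)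
  also have "\<dots> = fsum (UNIV \<times> UNIV) (\<lambda>p.
      fps_const x * (case p of (a, b) \<Rightarrow> (thB a * fps_const (x powi a)) * (thA b * fps_const (y powi b))) +
      fps_const (- x) * (case p of (a, b) \<Rightarrow> (thA a * fps_const (x powi a)) * (thB b * fps_const (y powi b))))"
    by (rule fsum_cong[OF refl])
       (auto simp: G_def power_int_add x algebra_simps simp flip: fps_const_mult fps_const_neg)
  also have "\<dots> = fps_const x * (ev thB x * ev thA y) + fps_const (- x) * (ev thA x * ev thB y)"
  proof -
    have lfs: "locfin UNIV (\<lambda>k. thA k * fps_const (z powi k))" "locfin UNIV (\<lambda>k. thB k * fps_const (z powi k))" for z :: 'a
      by (intro locfin_mult_left locfin_thA locfin_thB)+
    note l1 = locfin_mult[OF lfs(2)[of x] lfs(1)[of y]] and l2 = locfin_mult[OF lfs(1)[of x] lfs(2)[of y]]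
    show ?thesis
      unfolding ev_def fsum_add[OF locfin_cmult[OF l1] locfin_cmult[OF l2]] fsum_cmult[OF l1] fsum_cmult[OF l2]
        fsum_mult[OF lfs(2)[of x] lfs(1)[of y]] fsum_mult[OF lfs(1)[of x] lfs(2)[of y]] ..
  qed
  also have "\<dots> = fps_const x * (ev thB x * ev thA y - ev thA x * ev thB y)"
    by (simp add: algebra_simps flip: fps_const_neg)
  finally show ?thesis .
qed

section \<open>Infinite products in \<open>T\<close> and the Jacobi triple product\<close>

lemma X_power_dvd_iff: "fps_X ^ n dvd (f :: 'a::comm_ring_1 fps) \<longleftrightarrow> (\<forall>k<n. fps_nth f k = 0)"
proof
  assume "fps_X ^ n dvd f"
  then obtain g where "f = fps_X ^ n * g" by (rule dvdE)
  then show "\<forall>k<n. fps_nth f k = 0" by (simp add: fps_X_power_mult_nth)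
next
  assume *: "\<forall>k<n. fps_nth f k = 0"
  have "f = fps_X ^ n * Abs_fps (\<lambda>k. fps_nth f (k + n))"
    by (rule fps_ext) (use * in \<open>auto simp: fps_X_power_mult_nth\<close>)
  then show "fps_X ^ n dvd f" by (rule dvdI)
qed

lemma nth_eq_of_dvd:
  "fps_X ^ n dvd (f - g :: 'a::comm_ring_1 fps) \<Longrightarrow> k < n \<Longrightarrow> fps_nth f k = fps_nth g k"
  by (auto simp: X_power_dvd_iff)

definition unital :: "(nat \<Rightarrow> 'a::comm_ring_1 fps) \<Rightarrow> bool" where
  "unital f \<longleftrightarrow> (\<forall>m \<ge> 1. fps_X ^ m dvd f m - 1)"

text \<open>The n-th coefficient is read off the first n factors; for a \<open>unital\<close> family
  the later factors are 1 modulo higher powers of T and leave it unchanged.\<close>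

definition iprod :: "(nat \<Rightarrow> 'a::comm_ring_1 fps) \<Rightarrow> 'a fps" where
  "iprod f = Abs_fps (\<lambda>n. fps_nth (\<Prod>m=1..n. f m) n)"

lemma iprod_nth:
  fixes f :: "nat \<Rightarrow> 'a::comm_ring_1 fps"
  assumes "unital f" "n \<le> M"
  shows "fps_nth (\<Prod>m=1..M. f m) n = fps_nth (iprod f) n"
  using assms(2)
proof (induction M rule: dec_induct)
  case base
  show ?case by (simp add: iprod_def)
next
  case (step M)
  have "fps_X ^ Suc M dvd f (Suc M) - 1" using assms(1) by (simp add: unital_def del: power_Suc)
  then have "fps_X ^ Suc M dvd (\<Prod>m=1..M. f m) * (f (Suc M) - 1)" by (rule dvd_mult)
  then have "fps_X ^ Suc M dvd (\<Prod>m=1..Suc M. f m) - (\<Prod>m=1..M. f m)" by (simp add: algebra_simps)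
  then have "fps_nth (\<Prod>m=1..Suc M. f m) n = fps_nth (\<Prod>m=1..M. f m) n"
    by (rule nth_eq_of_dvd) (use step in simp)
  with step show ?case by simp
qed

lemma unital_mult:
  assumes "unital f" "unital g"
  shows "unital (\<lambda>m. f m * g m)"
proof -
  have "f m * g m - 1 = f m * (g m - 1) + (f m - 1)" for m by (simp add: algebra_simps)
  with assms show ?thesis unfolding unital_def by (metis dvd_add dvd_mult)
qed

lemma iprod_mult:
  assumes "unital f" "unital g"
  shows "iprod (\<lambda>m. f m * g m) = iprod f * iprod g"
proof (rule fps_ext)
  fix n
  have "fps_nth (iprod (\<lambda>m. f m * g m)) n = fps_nth ((\<Prod>m=1..n. f m) * (\<Prod>m=1..n. g m)) n"
    by (simp add: iprod_def prod.distrib)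
  also have "\<dots> = (\<Sum>i=0..n. fps_nth (iprod f) i * fps_nth (iprod g) (n - i))"
    unfolding fps_mult_nth by (intro sum.cong refl arg_cong2[of _ _ _ _ "(*)"] iprod_nth assms) auto
  finally show "fps_nth (iprod (\<lambda>m. f m * g m)) n = fps_nth (iprod f * iprod g) n" by (simp add: fps_mult_nth)
qed

lemma iprod_nth_0 [simp]: "fps_nth (iprod f) 0 = 1"
  by (simp add: iprod_def)

lemma int_coeffs_iprod: "(\<And>m. 1 \<le> m \<Longrightarrow> int_coeffs (f m)) \<Longrightarrow> int_coeffs (iprod f)"
  using int_coeffs_prod[of "{1.._}" f] by (auto simp: iprod_def int_coeffs_def)

lemma unital_lin: "unital (\<lambda>m. 1 - fps_X ^ m * c)"
  by (simp add: unital_def)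

section \<open>A finite form of the Jacobi triple product\<close>

definition qp :: "nat \<Rightarrow> 'a::field fps" where
  "qp n = (\<Prod>m=1..n. 1 - fps_X ^ m)"

lemma qp_0 [simp]: "qp 0 = 1" and qp_Suc: "qp (Suc n) = qp n * (1 - fps_X ^ Suc n)"
  by (simp_all add: qp_def)

lemma qp_nth_0 [simp]: "fps_nth (qp n) 0 = 1"
  by (induction n) (simp_all add: qp_Suc)

lemma qp_inverse: "qp n * inverse (qp n) = 1"
  by (simp add: inverse_mult_eq_1')

text \<open>The reciprocal of the T-factorial, continued by 0 to negative arguments, so that
  Gaussian binomials vanish outside their range without case distinctions.\<close>

definition ig :: "int \<Rightarrow> 'a::field fps" where
  "ig k = (if k < 0 then 0 else inverse (qp (nat k)))"

lemma ig_pred: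
  assumes "0 \<le> k"
  shows "ig (k - 1) = ((1 - fps_X ^ nat k) * ig k :: 'a::field fps)"
proof (cases "k = 0")
  case False
  then have k: "nat k = Suc (nat (k - 1))" using assms by simp
  have "inverse (qp (nat (k - 1))) = inverse (qp (nat (k - 1))) * (qp (nat k) * inverse (qp (nat k)) :: 'a fps)"
    by (simp add: qp_inverse)
  also have "\<dots> = (qp (nat (k - 1)) * inverse (qp (nat (k - 1)))) * (1 - fps_X ^ nat k) * inverse (qp (nat k))"
    unfolding k qp_Suc by (simp add: mult_ac)
  finally show ?thesis using assms False by (simp add: ig_def qp_inverse)
qed (simp add: ig_def)

definition th_coeff :: "int \<Rightarrow> 'a::field fps" where
  "th_coeff k = (if even k then 1 else - 1) * fps_X ^ nat (k * (k - 1) div 2)"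

lemma th_eq_ev: "th z = ev th_coeff z"
  unfolding th_def ev_def th_coeff_def
  by (rule fsum_cong[OF refl]) (auto simp flip: fps_const_neg)

lemma half_pred_nonneg: "0 \<le> k * (k - 1) div 2" for k :: int
  using nat_mult_pred[of "k - 1"] by (simp add: algebra_simps)

lemma th_coeff_pred:
  assumes "0 \<le> m - k + 1" "0 \<le> m"
  shows "fps_X ^ nat m * th_coeff (k - 1) = - (th_coeff k * fps_X ^ nat (m - k + 1) :: 'a::field fps)"
proof -
  have "(k - 1) * (k - 1 - 1) = k * (k - 1) - 2 * (k - 1)" by (simp add: algebra_simps)
  then have "(k - 1) * (k - 1 - 1) div 2 = k * (k - 1) div 2 - (k - 1)" by simp
  then have "nat m + nat ((k - 1) * (k - 1 - 1) div 2) = nat (k * (k - 1) div 2) + nat (m - k + 1)"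
    using assms half_pred_nonneg[of k] half_pred_nonneg[of "k - 1"] by (simp add: nat_add_distrib[symmetric])
  then have "(fps_X ^ nat m * fps_X ^ nat ((k - 1) * (k - 1 - 1) div 2) :: 'a fps) =
      fps_X ^ nat (k * (k - 1) div 2) * fps_X ^ nat (m - k + 1)" by (simp only: power_add[symmetric])
  then show ?thesis unfolding th_coeff_def by (auto simp: mult_ac)
qed

lemma th_coeff_succ:
  assumes "0 \<le> m + k" "0 \<le> m"
  shows "fps_X ^ nat m * th_coeff (k + 1) = - (th_coeff k * fps_X ^ nat (m + k) :: 'a::field fps)"
proof -
  have "(k + 1) * (k + 1 - 1) = k * (k - 1) + 2 * k" by (simp add: algebra_simps)
  then have "(k + 1) * (k + 1 - 1) div 2 = k * (k - 1) div 2 + k" by simp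
  then have "nat m + nat ((k + 1) * (k + 1 - 1) div 2) = nat (k * (k - 1) div 2) + nat (m + k)"
    using assms half_pred_nonneg[of k] half_pred_nonneg[of "k + 1"] by (simp add: nat_add_distrib[symmetric])
  then have "(fps_X ^ nat m * fps_X ^ nat ((k + 1) * (k + 1 - 1) div 2) :: 'a fps) =
      fps_X ^ nat (k * (k - 1) div 2) * fps_X ^ nat (m + k)" by (simp only: power_add[symmetric])
  then show ?thesis unfolding th_coeff_def by (auto simp: mult_ac)
qed

text \<open>The Gaussian binomial of 2 M over M + k in base T, times the theta coefficient: by the
  q-binomial theorem this is the coefficient of z^k in the product truncated after M pairs of
  factors.\<close>

definition jtp_coeff :: "nat \<Rightarrow> int \<Rightarrow> 'a::field fps" where
  "jtp_coeff M k = qp (2 * M) * th_coeff k * ig (int M + k) * ig (int M - k)"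

text \<open>The recurrence for the triple product coefficients after the inverse T-factorials are
  cancelled. Here \<open>t\<close> is T, and \<open>x\<close>, \<open>y\<close>, \<open>x'\<close>,
  \<open>y'\<close> are the powers of T with exponents a + 1, b + 1, a, b, where a = M + k and b = M
  - k.\<close>

lemma gauss_binomial_identity:
  fixes x y x' y' :: "'a::comm_ring_1"
  assumes "x = t * x'" "y = t * y'"
  shows "(1 - t * x' * y') * (1 - t * t * x' * y') =
    (1 + t * x' * y') * ((1 - x) * (1 - y)) + y * ((1 - x') * (1 - x)) + x * ((1 - y') * (1 - y))"
  unfolding assms by (simp add: algebra_simps)

text \<open>The next pair of factors multiplies out to 1 + T^(2 M + 1) - T^M z - T^(M + 1) / z; the
  three terms of the recurrence correspond to the powers of z.\<close>

lemma jtp_coeff_Suc: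
  "jtp_coeff (Suc M) k = (1 + fps_X ^ (2 * M + 1)) * jtp_coeff M k - fps_X ^ M * jtp_coeff M (k - 1) -
     fps_X ^ Suc M * (jtp_coeff M (k + 1) :: 'a::field fps)"
proof -
  define a b where "a = int M + k" and "b = int M - k"
  define q c where "q = (qp (2 * M) :: 'a fps)" and "c = (th_coeff k :: 'a fps)"
  have j: "jtp_coeff M k = q * c * ig a * ig b" by (simp add: jtp_coeff_def a_def b_def q_def c_def)
  have jm: "fps_X ^ M * jtp_coeff M (k - 1) = - (q * c * fps_X ^ nat (b + 1) * ig (a - 1) * ig (b + 1))"
  proof (cases "0 \<le> b + 1")
    case True
    then have "(fps_X ^ M * th_coeff (k - 1) :: 'a fps) = - (c * fps_X ^ nat (b + 1))"
      using th_coeff_pred[of "int M" k] by (simp add: b_def c_def)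
    then have "q * (fps_X ^ M * th_coeff (k - 1)) * ig (a - 1) * ig (b + 1) =
        q * (- (c * fps_X ^ nat (b + 1))) * ig (a - 1) * ig (b + 1)" by simp
    then show ?thesis by (simp add: jtp_coeff_def q_def a_def b_def algebra_simps)
  next
    case False
    then have "ig (b + 1) = (0 :: 'a fps)" by (simp add: ig_def)
    then show ?thesis by (simp add: jtp_coeff_def b_def algebra_simps)
  qed
  have jp: "fps_X ^ Suc M * jtp_coeff M (k + 1) = - (q * c * fps_X ^ nat (a + 1) * ig (a + 1) * ig (b - 1))"
  proof (cases "0 \<le> a + 1")
    case True
    then have "(fps_X ^ Suc M * th_coeff (k + 1) :: 'a fps) = - (c * fps_X ^ nat (a + 1))"
      using th_coeff_succ[of "int (Suc M)" k, unfolded nat_int]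
      by (simp add: a_def c_def add.commute add.left_commute del: power_Suc)
    then have "q * (fps_X ^ Suc M * th_coeff (k + 1)) * ig (a + 1) * ig (b - 1) =
        q * (- (c * fps_X ^ nat (a + 1))) * ig (a + 1) * ig (b - 1)" by simp
    then show ?thesis by (simp add: jtp_coeff_def q_def a_def b_def algebra_simps)
  next
    case False
    then have "ig (a + 1) = (0 :: 'a fps)" by (simp add: ig_def)
    then show ?thesis by (simp add: jtp_coeff_def a_def algebra_simps)
  qed
  have "2 * Suc M = Suc (Suc (2 * M))" by simp
  then have j1: "jtp_coeff (Suc M) k =
      q * c * ((1 - fps_X ^ (2 * M + 1)) * (1 - fps_X ^ (2 * M + 2)) * (ig (a + 1) * ig (b + 1)))"
    by (simp only: jtp_coeff_def qp_Suc q_def c_def a_def b_def) (simp add: algebra_simps)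
  have "(1 - fps_X ^ (2 * M + 1)) * (1 - fps_X ^ (2 * M + 2)) * (ig (a + 1) * ig (b + 1)) =
     (1 + fps_X ^ (2 * M + 1)) * (ig a * ig b) + fps_X ^ nat (b + 1) * (ig (a - 1) * ig (b + 1)) +
     fps_X ^ nat (a + 1) * (ig (a + 1) * (ig (b - 1) :: 'a fps))"
  proof (cases "0 \<le> a + 1 \<and> 0 \<le> b + 1")
    case False
    then show ?thesis by (auto simp: ig_def)
  next
    case True
    define x y where "x = (fps_X ^ nat (a + 1) :: 'a fps)" and "y = (fps_X ^ nat (b + 1) :: 'a fps)"
    define x' y' where "x' = (fps_X ^ nat a :: 'a fps)" and "y' = (fps_X ^ nat b :: 'a fps)"
    have ab: "a + b = 2 * int M" by (simp add: a_def b_def)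
    have ia: "ig a = (1 - x) * ig (a + 1)" and ib: "ig b = (1 - y) * ig (b + 1)"
      using ig_pred[of "a + 1", where 'a = 'a] ig_pred[of "b + 1", where 'a = 'a] True by (simp_all add: x_def y_def)
    have ia': "ig (a - 1) = (1 - x') * (1 - x) * ig (a + 1)"
    proof (cases "0 \<le> a")
      case True
      then show ?thesis using ig_pred[of a, where 'a = 'a] ia by (simp add: x'_def mult.assoc)
    next
      case False
      then show ?thesis using \<open>0 \<le> a + 1 \<and> 0 \<le> b + 1\<close> by (simp add: ig_def x'_def)
    qed
    have ib': "ig (b - 1) = (1 - y') * (1 - y) * ig (b + 1)"
    proof (cases "0 \<le> b")
      case True
      then show ?thesis using ig_pred[of b, where 'a = 'a] ib by (simp add: y'_def mult.assoc)
    next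
      case False
      then show ?thesis using \<open>0 \<le> a + 1 \<and> 0 \<le> b + 1\<close> by (simp add: ig_def y'_def)
    qed
    have id: "(1 - fps_X ^ (2 * M + 1)) * (1 - fps_X ^ (2 * M + 2)) =
       (1 + fps_X ^ (2 * M + 1)) * ((1 - x) * (1 - y)) + y * ((1 - x') * (1 - x)) + x * ((1 - y') * (1 - y))"
    proof -
      \<comment> \<open>At \<open>a = - 1\<close> the truncation \<open>nat a = 0\<close> breaks the
        relation between \<open>x\<close> and \<open>x'\<close>, and likewise for \<open>b\<close>.
        There one of \<open>x\<close>, \<open>y\<close> equals 1 and the identity is
        immediate.\<close>
      consider "0 \<le> a" "0 \<le> b" | "a = - 1" "b = 2 * int M + 1" | "b = - 1" "a = 2 * int M + 1"
        using True ab by linarith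
      then show ?thesis
      proof cases
        case 1
        have xy: "x = fps_X * x'" "y = fps_X * y'" using 1 by (simp_all add: x_def x'_def y_def y'_def nat_add_distrib)
        have "nat a + nat b = 2 * M" using 1 ab by linarith
        then have "x' * y' = fps_X ^ (2 * M)" by (simp add: x'_def y'_def flip: power_add)
        then have "fps_X ^ (2 * M + 1) = fps_X * x' * y'" "fps_X ^ (2 * M + 2) = fps_X * fps_X * x' * y'"
          by (simp_all add: mult.assoc)
        then show ?thesis using gauss_binomial_identity[OF xy] by (simp add: mult.assoc)
      next
        case 2
        have "x = 1" "y = fps_X ^ (2 * M + 2)" "y' = fps_X ^ (2 * M + 1)"
          using 2 by (simp_all add: x_def y_def y'_def nat_add_distrib nat_mult_distrib)
        then show ?thesis by simp
      next
        case 3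
        have "y = 1" "x = fps_X ^ (2 * M + 2)" "x' = fps_X ^ (2 * M + 1)"
          using 3 by (simp_all add: x_def y_def x'_def nat_add_distrib nat_mult_distrib)
        then show ?thesis by (simp add: mult.commute)
      qed
    qed
    show ?thesis unfolding id ia ib ia' ib' x_def[symmetric] y_def[symmetric] by (simp add: algebra_simps)
  qed
  then show ?thesis unfolding j1 j jm jp by (simp add: algebra_simps)
qed

lemma locfin_jtp_coeff: "locfin UNIV (jtp_coeff M :: int \<Rightarrow> 'a::field fps)"
proof -
  have "{i \<in> UNIV. fps_nth (jtp_coeff M i :: 'a fps) n \<noteq> 0} \<subseteq> {- int M..int M}" for n
    by (auto simp: jtp_coeff_def ig_def split: if_splits)
  then show ?thesis by (intro locfinI) (meson finite_atLeastAtMost_int finite_subset)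
qed

lemma locfin_shift:
  fixes a :: "int \<Rightarrow> 'a::comm_ring_1 fps"
  assumes "locfin UNIV a"
  shows "locfin UNIV (\<lambda>k. a (k + j))"
proof -
  have bij: "bij_betw (\<lambda>k. k + j) UNIV UNIV" by (rule bij_betw_byWitness[where f' = "\<lambda>k. k - j"]) auto
  show ?thesis using locfin_reindex[OF bij] assms by blast
qed

lemma ev_shift:
  fixes a :: "int \<Rightarrow> 'a::field fps"
  assumes "locfin UNIV a" "z \<noteq> 0"
  shows "ev (\<lambda>k. a (k + j)) z = fps_const (z powi (- j)) * ev a z"
proof -
  have bij: "bij_betw (\<lambda>k. k + j) UNIV UNIV" by (rule bij_betw_byWitness[where f' = "\<lambda>k. k - j"]) auto
  have "ev a z = fsum UNIV (\<lambda>k. a (k + j) * fps_const (z powi (k + j)))"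
    unfolding ev_def by (rule fsum_reindex[OF bij, symmetric])
  also have "\<dots> = fsum UNIV (\<lambda>k. fps_const (z powi j) * (a (k + j) * fps_const (z powi k)))"
    by (rule fsum_cong[OF refl]) (simp add: power_int_add assms mult_ac)
  also have "\<dots> = fps_const (z powi j) * ev (\<lambda>k. a (k + j)) z"
    unfolding ev_def by (rule fsum_cmult) (rule locfin_mult_left[OF locfin_shift[OF assms(1)]])
  finally show ?thesis using assms(2)
    by (simp add: power_int_minus flip: mult.assoc)
qed

lemma ev_cmult: "locfin UNIV a \<Longrightarrow> ev (\<lambda>k. c * a k) z = c * ev a z"
  unfolding ev_def mult.assoc by (rule fsum_cmult) (rule locfin_mult_left)

lemma ev_add:
  fixes a :: "int \<Rightarrow> 'a::field fps"
  assumes "locfin UNIV a" "locfin UNIV b"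
  shows "ev (\<lambda>k. a k + b k) z = ev a z + ev b z"
  unfolding ev_def distrib_right by (rule fsum_add; rule locfin_mult_left) (use assms in auto)

lemma finite_triple_product:
  fixes z :: "'a::field"
  assumes z: "z \<noteq> 0"
  shows "(\<Prod>m=1..M. (1 - fps_X ^ (m - 1) * fps_const z) * (1 - fps_X ^ m * fps_const (1 / z))) = ev (jtp_coeff M) z"
proof (induction M)
  case 0
  have "jtp_coeff 0 k = (if k = 0 then 1 else 0 :: 'a fps)" for k
    by (auto simp: jtp_coeff_def ig_def th_coeff_def)
  then have "ev (jtp_coeff 0) z = fsum UNIV (\<lambda>k::int. if k = 0 then 1 else 0 :: 'a fps)"
    unfolding ev_def by (intro fsum_cong) auto
  also have "\<dots> = fsum {0::int} (\<lambda>_. 1)"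
    by (subst fsum_neutral[of "{0}" UNIV, symmetric]) (auto intro: fsum_cong)
  finally show ?case by (simp add: fsum_finite)
next
  case (Suc M)
  note lf = locfin_jtp_coeff[of M, where 'a = 'a]
  have "jtp_coeff (Suc M) = (\<lambda>k. (1 + fps_X ^ (2 * M + 1)) * jtp_coeff M k +
      ((- (fps_X ^ M)) * jtp_coeff M (k + (- 1)) + (- (fps_X ^ Suc M)) * (jtp_coeff M (k + 1) :: 'a fps)))"
    by (rule ext) (simp add: jtp_coeff_Suc del: power_Suc)
  then have "ev (jtp_coeff (Suc M)) z = (1 + fps_X ^ (2 * M + 1)) * ev (jtp_coeff M) z +
      (- (fps_X ^ M) * (fps_const z * ev (jtp_coeff M) z) +
       - (fps_X ^ Suc M) * (fps_const (1 / z) * ev (jtp_coeff M) z))"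
    by (simp only: ev_add ev_cmult locfin_add locfin_cmult locfin_shift lf ev_shift[OF lf z])
       (simp add: power_int_minus field_simps)
  also have "\<dots> = ev (jtp_coeff M) z * ((1 - fps_X ^ M * fps_const z) * (1 - fps_X ^ Suc M * fps_const (1 / z)))"
  proof -
    define p w v where "p = (fps_X ^ M :: 'a fps)" and "w = fps_const z" and "v = fps_const (1 / z)"
    have wv: "w * v = 1" using z by (simp add: w_def v_def)
    have X: "fps_X ^ (2 * M + 1) = fps_X * (p * p)" "fps_X ^ Suc M = fps_X * p"
      by (simp_all add: p_def mult_2 power_add)
    have "(1 - p * w) * (1 - fps_X * p * v) = 1 + fps_X * (p * p) * (w * v) - p * w - fps_X * p * v"
      by (simp add: algebra_simps)
    then have "(1 - p * w) * (1 - fps_X * p * v) = 1 + fps_X * (p * p) - p * w - fps_X * p * v"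
      unfolding wv by simp
    then show ?thesis
      unfolding X p_def[symmetric] w_def[symmetric] v_def[symmetric] by (simp only:) (simp add: algebra_simps)
  qed
  finally show ?case using Suc by simp
qed

lemma qp_ratio: "m \<le> N \<Longrightarrow> fps_X ^ Suc m dvd qp N * inverse (qp m) - (1 :: 'a::field fps)"
proof (induction N rule: dec_induct)
  case (step N)
  have "qp (Suc N) * inverse (qp m) - 1 = (qp N * inverse (qp m) - 1) - fps_X ^ Suc N * (qp N * inverse (qp m) :: 'a fps)"
    unfolding qp_Suc by (simp add: algebra_simps)
  moreover have "fps_X ^ Suc m dvd fps_X ^ Suc N * (qp N * inverse (qp m) :: 'a fps)"
    using step by (intro dvd_mult2 le_imp_power_dvd) simp
  ultimately show ?case using step by (metis dvd_diff)
qed (simp add: qp_inverse)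

text \<open>Times \<open>qp M\<close>, the Gaussian binomial becomes a product of two factorial
  ratios that are 1 modulo T^(M - |k| + 1). The theta coefficient contributes the exponent k (k - 1)
  / 2, which is at least |k| - 1, so the total error has order at least M, uniformly in k.\<close>

lemma jtp_coeff_limit: "fps_X ^ M dvd qp M * jtp_coeff M k - (th_coeff k :: 'a::field fps)"
proof (cases "\<bar>k\<bar> \<le> int M")
  case False
  then have "jtp_coeff M k = (0 :: 'a fps)" by (auto simp: jtp_coeff_def ig_def)
  moreover have "M \<le> nat (k * (k - 1) div 2)" using False pred_mult_ge[of k] by linarith
  then have "fps_X ^ M dvd (th_coeff k :: 'a fps)"
    unfolding th_coeff_def by (intro dvd_mult le_imp_power_dvd)
  ultimately show ?thesis by simp
next
  case True
  define m1 m2 where "m1 = nat (int M - \<bar>k\<bar>)" and "m2 = nat (int M + \<bar>k\<bar>)"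
  define g1 g2 where "g1 = qp M * inverse (qp m1 :: 'a fps)" and "g2 = qp (2 * M) * inverse (qp m2 :: 'a fps)"
  have g1: "fps_X ^ Suc m1 dvd g1 - 1" unfolding g1_def by (rule qp_ratio) (simp add: m1_def)
  have "fps_X ^ Suc m2 dvd g2 - 1" unfolding g2_def by (rule qp_ratio) (use True in \<open>simp add: m2_def\<close>)
  moreover have "Suc m1 \<le> Suc m2" by (simp add: m1_def m2_def)
  ultimately have g2: "fps_X ^ Suc m1 dvd g2 - 1" by (meson dvd_trans le_imp_power_dvd)
  have "g1 * g2 - 1 = g1 * (g2 - 1) + (g1 - 1)" by (simp add: algebra_simps)
  then have g: "fps_X ^ Suc m1 dvd g1 * g2 - 1" using g1 g2 by (metis dvd_add dvd_mult)
  have "ig (int M + k) * ig (int M - k) = inverse (qp m1) * (inverse (qp m2) :: 'a fps)"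
    using True by (cases "0 \<le> k") (auto simp: ig_def m1_def m2_def mult.commute)
  then have eq: "qp M * jtp_coeff M k - th_coeff k = th_coeff k * (g1 * g2 - 1)"
    unfolding jtp_coeff_def g1_def g2_def by (simp add: algebra_simps)
  have "fps_X ^ nat (k * (k - 1) div 2) dvd (th_coeff k :: 'a fps)" by (simp add: th_coeff_def)
  then have "fps_X ^ (nat (k * (k - 1) div 2) + Suc m1) dvd th_coeff k * (g1 * g2 - 1)"
    unfolding power_add using g by (rule mult_dvd_mono)
  moreover have "M \<le> nat (k * (k - 1) div 2) + Suc m1" using True pred_mult_ge[of k] by (simp add: m1_def)
  ultimately show ?thesis unfolding eq by (meson dvd_trans le_imp_power_dvd)
qed

section \<open>The Jacobi triple product in the limit\<close>

definition theta_prod :: "'a::field \<Rightarrow> 'a fps" where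
  "theta_prod z = iprod (\<lambda>m. (1 - fps_X ^ m * fps_const z) * (1 - fps_X ^ m * fps_const (1 / z)))"

lemma unital_theta_prod: "unital (\<lambda>m. (1 - fps_X ^ m * fps_const z) * (1 - fps_X ^ m * fps_const (1 / z)))"
  by (intro unital_mult unital_lin)

definition euler_prod :: "'a::field fps" where
  "euler_prod = iprod (\<lambda>m. 1 - fps_X ^ m)"

lemma unital_euler_prod: "unital (\<lambda>m. 1 - fps_X ^ m)"
  using unital_lin[of 1] by simp

theorem jacobi_triple_product:
  fixes z :: "'a::field"
  assumes z: "z \<noteq> 0"
  shows "th z = fps_const (1 - z) * (euler_prod * theta_prod z)"
proof (rule fps_ext)
  fix n
  define M where "M = Suc n"
  let ?f = "\<lambda>m. (1 - fps_X ^ m * fps_const z) * (1 - fps_X ^ m * fps_const (1 / z)) :: 'a fps"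
  let ?g = "\<lambda>m. (1 - fps_X ^ (m - 1) * fps_const z) * (1 - fps_X ^ m * fps_const (1 / z)) :: 'a fps"
  \<comment> \<open>Shifting the exponents of T from m - 1 to m trades the factor
    \<open>1 - z\<close> for one that is 1 modulo T^M and is therefore invisible in degree n <
    M.\<close>
  have tele: "(\<Prod>m=1..M. 1 - fps_X ^ (m - 1) * fps_const z) * (1 - fps_X ^ M * fps_const z) =
      fps_const (1 - z) * (\<Prod>m=1..M. 1 - fps_X ^ m * fps_const z)" for M
    by (induction M) (simp_all add: mult_ac flip: fps_const_sub)
  have "fps_nth (fps_const (1 - z) * (euler_prod * theta_prod z)) n =
      (1 - z) * fps_nth (\<Prod>m=1..M. (1 - fps_X ^ m) * ?f m) n"
    unfolding euler_prod_def theta_prod_def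
      iprod_mult[OF unital_euler_prod unital_theta_prod, symmetric] fps_mult_left_const_nth
    by (intro arg_cong[of _ _ "(*) (1 - z)"] iprod_nth[symmetric] unital_mult unital_euler_prod unital_lin)
       (simp add: M_def)
  also have "\<dots> = fps_nth (fps_const (1 - z) * (\<Prod>m=1..M. (1 - fps_X ^ m) * ?f m)) n" by simp
  also have "fps_const (1 - z) * (\<Prod>m=1..M. (1 - fps_X ^ m) * ?f m) =
      qp M * (\<Prod>m=1..M. ?g m) * (1 - fps_X ^ M * fps_const z)"
    using tele[of M] by (simp add: prod.distrib qp_def mult_ac)
  also have "fps_nth \<dots> n = fps_nth (qp M * (\<Prod>m=1..M. ?g m)) n"
  proof (rule nth_eq_of_dvd)
    show "fps_X ^ M dvd qp M * (\<Prod>m=1..M. ?g m) * (1 - fps_X ^ M * fps_const z) - qp M * (\<Prod>m=1..M. ?g m)"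
      by (simp add: right_diff_distrib)
  qed (simp add: M_def)
  also have "qp M * (\<Prod>m=1..M. ?g m) = ev (\<lambda>k. qp M * jtp_coeff M k) z"
    unfolding finite_triple_product[OF z] by (rule ev_cmult[OF locfin_jtp_coeff, symmetric])
  also have "fps_nth \<dots> n = fps_nth (ev th_coeff z) n"
  proof -
    have "fps_nth (qp M * jtp_coeff M k) n = fps_nth (th_coeff k :: 'a fps) n" for k
      by (rule nth_eq_of_dvd[OF jtp_coeff_limit]) (simp add: M_def)
    then show ?thesis unfolding ev_def fsum_def by simp
  qed
  finally show "fps_nth (th z) n = fps_nth (fps_const (1 - z) * (euler_prod * theta_prod z)) n"
    by (simp add: th_eq_ev)
qed

section \<open>Products of theta functions expanded in odd theta series\<close>

primrec prod_seq :: "nat \<Rightarrow> nat \<Rightarrow> int \<Rightarrow> 'a::field fps" where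
  "prod_seq 0 j = (conv thB ^^ j) thD"
| "prod_seq (Suc i) j = conv thA (prod_seq i j)"

lemma prod_seq_props:
  fixes x :: "'a::field"
  shows "locfin UNIV (prod_seq i j :: int \<Rightarrow> 'a fps)"
    and "quasi_periodic (- 1) (2 + int i + int j) (prod_seq i j :: int \<Rightarrow> 'a fps)"
    and "int_coeffs (prod_seq i j k :: 'a fps)"
    and "x \<noteq> 0 \<Longrightarrow> ev (prod_seq i j) x = ev thA x ^ i * ev thB x ^ j * ev thD x"
proof -
  have intD: "int_coeffs (thD k :: 'a fps)" and intA: "int_coeffs (thA k :: 'a fps)"
    and intB: "int_coeffs (thB k :: 'a fps)" for k
    by (auto simp: thD_def thA_def thB_def)
  have "locfin UNIV (prod_seq i j :: int \<Rightarrow> 'a fps) \<and>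
      quasi_periodic (- 1) (2 + int i + int j) (prod_seq i j :: int \<Rightarrow> 'a fps) \<and>
      (\<forall>k. int_coeffs (prod_seq i j k :: 'a fps)) \<and>
      (x \<noteq> 0 \<longrightarrow> ev (prod_seq i j) x = ev thA x ^ i * ev thB x ^ j * ev thD x)"
  proof (induction i)
    case 0
    show ?case
    proof (induction j)
      case 0
      show ?case using locfin_thD quasi_periodic_thD intD by simp
    next
      case (Suc j)
      let ?a = "prod_seq 0 j :: int \<Rightarrow> 'a fps"
      have e: "prod_seq 0 (Suc j) = conv thB ?a" by simp
      have "quasi_periodic (1 * - 1) (1 + (2 + int 0 + int j)) (conv thB ?a)"
        by (rule quasi_periodic_conv) (use Suc quasi_periodic_thB locfin_thB in auto)
      moreover have "int_coeffs (conv thB ?a k)" for k unfolding conv_def using Suc intB by blast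
      ultimately show ?case
        unfolding e using Suc locfin_conv[OF locfin_thB] ev_conv[OF locfin_thB, of ?a x]
        by (auto simp: algebra_simps)
    qed
  next
    case (Suc i)
    let ?a = "prod_seq i j :: int \<Rightarrow> 'a fps"
    have e: "prod_seq (Suc i) j = conv thA ?a" by simp
    have "quasi_periodic (1 * - 1) (1 + (2 + int i + int j)) (conv thA ?a)"
      by (rule quasi_periodic_conv) (use Suc quasi_periodic_thA locfin_thA in auto)
    moreover have "int_coeffs (conv thA ?a k)" for k unfolding conv_def using Suc intA by blast
    ultimately show ?case
      unfolding e using Suc locfin_conv[OF locfin_thA] ev_conv[OF locfin_thA, of ?a x]
      by (auto simp: algebra_simps)
  qed
  then show "locfin UNIV (prod_seq i j :: int \<Rightarrow> 'a fps)"
    "quasi_periodic (- 1) (2 + int i + int j) (prod_seq i j :: int \<Rightarrow> 'a fps)"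
    "int_coeffs (prod_seq i j k :: 'a fps)"
    "x \<noteq> 0 \<Longrightarrow> ev (prod_seq i j) x = ev thA x ^ i * ev thB x ^ j * ev thD x"
    by blast+
qed

text \<open>The product has degree 2 (n + 1) and is odd, so it lies in the span of n theta series.
  This is also the number of products A^(n-1-i) B^i D, and the coefficients of the expansion do not
  involve \<open>x\<close>.\<close>

lemma theta_span:
  fixes x :: "'a::field_char_0"
  assumes "i < n" "x \<noteq> 0"
  shows "ev thA x ^ (n - 1 - i) * ev thB x ^ i * ev thD x =
    (\<Sum>r<n. prod_seq (n - 1 - i) i (int r + 1) * theta (int n + 1) (int r + 1) x)"
proof -
  have n: "2 + int (n - 1 - i) + int i = int n + 1" using assms by simp
  note pr = prod_seq_props[where i = "n - 1 - i" and j = i and 'a = 'a, unfolded n]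
  have "ev thA x ^ (n - 1 - i) * ev thB x ^ i * ev thD x = ev (prod_seq (n - 1 - i) i) x"
    using pr(4)[of x] assms by simp
  also have "\<dots> = (\<Sum>r\<in>{1..<int n + 1}. prod_seq (n - 1 - i) i r * theta (int n + 1) r x)"
    by (rule ev_quasi_periodic_odd) (use pr assms in auto)
  also have "\<dots> = (\<Sum>r<n. prod_seq (n - 1 - i) i (int r + 1) * theta (int n + 1) (int r + 1) x)"
    by (rule sum.reindex_bij_witness[of _ "\<lambda>r. int r + 1" "\<lambda>r. nat (r - 1)"]) auto
  finally show ?thesis .
qed

section \<open>Determinants\<close>

lemma fps_const_prod: "fps_const (\<Prod>i\<in>A. f i) = (\<Prod>i\<in>A. fps_const (f i :: 'a::comm_ring_1))"
  by (induction A rule: infinite_finite_induct) (simp_all flip: fps_const_mult)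

lemma fps_const_sum: "fps_const (\<Sum>i\<in>A. f i) = (\<Sum>i\<in>A. fps_const (f i :: 'a::comm_ring_1))"
  by (induction A rule: infinite_finite_induct) (simp_all flip: fps_const_add)

lemma det_upper_unitriangular:
  fixes f :: "nat \<Rightarrow> nat \<Rightarrow> 'a::comm_ring_1"
  assumes "\<And>i j. j < i \<Longrightarrow> i < n \<Longrightarrow> f i j = 0" "\<And>i. i < n \<Longrightarrow> f i i = 1"
  shows "det (mat n n (\<lambda>(i, j). f i j)) = 1"
proof -
  have one: "\<forall>x\<in>set xs. x = 1 \<Longrightarrow> prod_list xs = 1" for xs :: "'a list"
    by (induction xs) auto
  have "det (mat n n (\<lambda>(i, j). f i j)) = prod_list (diag_mat (mat n n (\<lambda>(i, j). f i j)))"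
    by (rule det_upper_triangular[of _ n]) (use assms in \<open>auto simp: upper_triangular_def\<close>)
  also have "\<dots> = 1" by (rule one) (use assms in \<open>auto simp: diag_mat_def\<close>)
  finally show ?thesis .
qed

lemma det_mat_scale_rows:
  fixes d :: "nat \<Rightarrow> 'a::comm_ring_1"
  shows "det (mat n n (\<lambda>(k, i). d k * f k i)) = (\<Prod>k<n. d k) * det (mat n n (\<lambda>(k, i). f k i))"
proof -
  have "det (mat n n (\<lambda>(k, i). d k * f k i)) =
    (\<Sum>p | p permutes {0..<n}. signof p * (\<Prod>i=0..<n. d i * f i (p i)))"
    by (subst det_def'[of _ n]) (auto intro!: sum.cong arg_cong2[of _ _ _ _ "(*)"] prod.cong simp: permutes_in_image)
  also have "\<dots> = (\<Prod>k<n. d k) * (\<Sum>p | p permutes {0..<n}. signof p * (\<Prod>i=0..<n. f i (p i)))"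
    by (simp add: sum_distrib_left prod.distrib mult_ac atLeast0LessThan)
  also have "(\<Sum>p | p permutes {0..<n}. signof p * (\<Prod>i=0..<n. f i (p i))) = det (mat n n (\<lambda>(k, i). f k i))"
    by (subst det_def'[of _ n]) (auto intro!: sum.cong arg_cong2[of _ _ _ _ "(*)"] prod.cong simp: permutes_in_image)
  finally show ?thesis .
qed

lemma det_mat_mult:
  fixes f g :: "nat \<Rightarrow> nat \<Rightarrow> 'a::comm_ring_1"
  shows "det (mat n n (\<lambda>(k, i). \<Sum>r<n. f k r * g r i)) =
    det (mat n n (\<lambda>(k, i). f k i)) * det (mat n n (\<lambda>(k, i). g k i))"
proof -
  have "mat n n (\<lambda>(k, i). \<Sum>r<n. f k r * g r i) = mat n n (\<lambda>(k, i). f k i) * mat n n (\<lambda>(k, i). g k i)"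
    by (rule eq_matI) (auto simp: scalar_prod_def atLeast0LessThan intro!: sum.cong)
  then show ?thesis by (simp add: det_mult[of _ n])
qed

text \<open>Subtracting \<open>y n\<close> times each column from the next one is multiplication by
  a unitriangular matrix. It clears the last row except for its first entry, and expansion along
  that row reduces the size.\<close>

lemma det_vandermonde:
  fixes y :: "nat \<Rightarrow> 'a::comm_ring_1"
  shows "det (mat n n (\<lambda>(k, i). y k ^ i)) = (\<Prod>l<n. \<Prod>k<l. y l - y k)"
proof (induction n)
  case (Suc n)
  let ?V = "mat (Suc n) (Suc n) (\<lambda>(k, i). y k ^ i)"
  let ?c = "\<lambda>r i. if r = i then 1 else if i = Suc r then - y n else 0"
  let ?C = "mat (Suc n) (Suc n) (\<lambda>(r, i). ?c r i)"
  have "det ?C = 1"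
    by (rule det_upper_unitriangular) auto
  moreover have "det (mat (Suc n) (Suc n) (\<lambda>(k, i). \<Sum>r<Suc n. y k ^ r * ?c r i)) = det ?V * det ?C"
    by (rule det_mat_mult)
  moreover have "(\<Sum>r<Suc n. y k ^ r * ?c r i) = (if i = 0 then 1 else y k ^ (i - 1) * (y k - y n))"
    if "i < Suc n" for k i
  proof (cases i)
    case 0
    have "(\<Sum>r<Suc n. y k ^ r * ?c r i) = (\<Sum>r\<in>{0}. y k ^ r * ?c r i)"
      by (rule sum.mono_neutral_right) (use 0 in auto)
    then show ?thesis using 0 by simp
  next
    case (Suc j)
    have "(\<Sum>r<Suc n. y k ^ r * ?c r i) = (\<Sum>r\<in>{j, Suc j}. y k ^ r * ?c r i)"
      by (rule sum.mono_neutral_right) (use that Suc in auto)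
    then show ?thesis using Suc by (simp add: algebra_simps)
  qed
  then have "mat (Suc n) (Suc n) (\<lambda>(k, i). \<Sum>r<Suc n. y k ^ r * ?c r i) =
      mat (Suc n) (Suc n) (\<lambda>(k, i). if i = 0 then 1 else y k ^ (i - 1) * (y k - y n))"
    by (intro eq_matI) (auto simp del: sum.lessThan_Suc)
  ultimately have V: "det ?V = det (mat (Suc n) (Suc n) (\<lambda>(k, i). if i = 0 then 1 else y k ^ (i - 1) * (y k - y n)))"
    (is "_ = det ?W") by simp
  have "det ?W = (\<Sum>j<Suc n. ?W $$ (n, j) * cofactor ?W n j)"
    by (rule laplace_expansion_row[of _ "Suc n"]) auto
  also have "\<dots> = (\<Sum>j\<in>{0}. ?W $$ (n, j) * cofactor ?W n j)"
    by (rule sum.mono_neutral_right) auto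
  also have "\<dots> = (- 1) ^ n * det (mat_delete ?W n 0)" by (simp add: cofactor_def)
  also have "mat_delete ?W n 0 = mat n n (\<lambda>(k, i). (y k - y n) * y k ^ i)"
    by (rule eq_matI) (auto simp: mat_delete_def)
  also have "det \<dots> = (\<Prod>k<n. y k - y n) * (\<Prod>l<n. \<Prod>k<l. y l - y k)"
    by (simp add: det_mat_scale_rows Suc.IH)
  also have "(- 1) ^ n * ((\<Prod>k<n. y k - y n) * (\<Prod>l<n. \<Prod>k<l. y l - y k)) =
      (\<Prod>k<n. y n - y k) * (\<Prod>l<n. \<Prod>k<l. y l - y k)"
  proof -
    have "(\<Prod>k<n. y n - y k) = (\<Prod>k<n. (- 1) * (y k - y n))" by simp
    also have "\<dots> = (- 1) ^ n * (\<Prod>k<n. y k - y n)" by (simp only: prod.distrib prod_constant card_lessThan)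
    finally show ?thesis by (simp only: mult.assoc)
  qed
  finally show ?case unfolding V by (simp add: mult.commute)
qed simp

text \<open>Taking the power n - 1 of \<open>a k\<close> out of row k leaves a Vandermonde matrix in
  the ratios b / a. The inverses \<open>a'\<close> are given explicitly because the entries will be
  power series, where only units can be inverted.\<close>

lemma det_homogeneous_vandermonde:
  fixes a b :: "nat \<Rightarrow> 'a::comm_ring_1"
  assumes "\<And>k. a k * a' k = 1"
  shows "det (mat n n (\<lambda>(k, i). a k ^ (n - 1 - i) * b k ^ i)) = (\<Prod>l<n. \<Prod>k<l. a k * b l - a l * b k)"
proof -
  define y where "y k = b k * a' k" for k
  have b: "b k = a k * y k" for k by (simp add: y_def mult.left_commute[of "a k"] assms)
  have *: "(\<Prod>l<n. \<Prod>k<l. a k * b l - a l * b k) = (\<Prod>k<n. a k ^ (n - 1)) * (\<Prod>l<n. \<Prod>k<l. y l - y k)" for n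
  proof (induction n)
    case (Suc n)
    have "(\<Prod>k<n. a k * b n - a n * b k) = (\<Prod>k<n. a k * (a n * (y n - y k)))"
      by (rule prod.cong) (auto simp: b algebra_simps)
    also have "\<dots> = (\<Prod>k<n. a k) * (a n ^ n * (\<Prod>k<n. y n - y k))" by (simp add: prod.distrib)
    finally have 1: "(\<Prod>k<n. a k * b n - a n * b k) = (\<Prod>k<n. a k) * (a n ^ n * (\<Prod>k<n. y n - y k))" .
    have "(\<Prod>k<n. a k ^ n) = (\<Prod>k<n. a k ^ (n - 1)) * (\<Prod>k<n. a k)"
      by (cases n) (simp_all add: prod.distrib mult.commute del: prod.lessThan_Suc)
    then show ?case using Suc 1 by (simp add: mult_ac)
  qed simp
  have "mat n n (\<lambda>(k, i). a k ^ (n - 1 - i) * b k ^ i) = mat n n (\<lambda>(k, i). a k ^ (n - 1) * y k ^ i)"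
  proof (rule eq_matI, simp_all, goal_cases)
    case (1 k i)
    then have "n - Suc 0 = (n - Suc i) + i" by simp
    then have "a k ^ (n - Suc 0) = a k ^ (n - Suc i) * a k ^ i" by (metis power_add)
    then show ?case by (simp add: b power_mult_distrib mult.assoc)
  qed
  then show ?thesis unfolding * by (simp add: det_mat_scale_rows det_vandermonde)
qed

text \<open>Chebyshev polynomials of the second kind in the variable x / 2, which makes them
  monic.\<close>

fun chebU :: "nat \<Rightarrow> 'a::comm_ring_1 poly" where
  "chebU 0 = 1"
| "chebU (Suc 0) = [:0, 1:]"
| "chebU (Suc (Suc n)) = [:0, 1:] * chebU (Suc n) - chebU n"

lemma coeff_chebU: "coeff (chebU n :: 'a::comm_ring_1 poly) n = 1 \<and> (\<forall>i>n. coeff (chebU n :: 'a poly) i = 0)"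
proof (induction n rule: chebU.induct)
  case (3 n)
  then have z: "\<And>i. n < i \<Longrightarrow> coeff (chebU n :: 'a poly) i = 0"
    "\<And>i. Suc n < i \<Longrightarrow> coeff (chebU (Suc n) :: 'a poly) i = 0" and o: "coeff (chebU (Suc n) :: 'a poly) (Suc n) = 1"
    by simp_all
  have "coeff (chebU (Suc (Suc n)) :: 'a poly) (Suc i) = coeff (chebU (Suc n)) i - coeff (chebU n) (Suc i)" for i
    by simp
  then show ?case using z o by (auto elim!: Suc_lessE)
qed (auto simp: coeff_pCons split: nat.splits)

lemma poly_chebU:
  fixes y :: "'a::field"
  assumes "y \<noteq> 0"
  shows "y ^ Suc n - (1 / y) ^ Suc n = (y - 1 / y) * poly (chebU n) (y + 1 / y)"
proof (induction n rule: chebU.induct)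
  case (3 n)
  define z where "z = 1 / y"
  have yz: "y * z = 1" using assms by (simp add: z_def)
  have "(y - z) * poly (chebU (Suc (Suc n))) (y + z) =
      (y + z) * ((y - z) * poly (chebU (Suc n)) (y + z)) - (y - z) * poly (chebU n) (y + z)"
    by (simp add: algebra_simps)
  also have "\<dots> = (y + z) * (y ^ Suc (Suc n) - z ^ Suc (Suc n)) - (y ^ Suc n - z ^ Suc n)"
    using 3 by (simp only: z_def)
  also have "\<dots> = y ^ Suc (Suc (Suc n)) - z ^ Suc (Suc (Suc n)) + (y * z) * y ^ Suc n - (y * z) * z ^ Suc n - (y ^ Suc n - z ^ Suc n)"
    by (simp add: algebra_simps)
  finally show ?case unfolding yz by (simp add: z_def)
qed (simp_all add: algebra_simps)

text \<open>Weyl's denominator formula of type C. After \<open>y - 1 / y\<close> is taken out of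
  each row, the entries are monic polynomials in \<open>y + 1 / y\<close> of degree k, so a
  unitriangular change of columns leaves a Vandermonde determinant.\<close>

lemma det_weyl_C:
  fixes y :: "nat \<Rightarrow> 'a::field"
  assumes "\<And>r. y r \<noteq> 0"
  shows "det (mat n n (\<lambda>(r, k). y r ^ Suc k - (1 / y r) ^ Suc k)) =
    (\<Prod>r<n. y r - 1 / y r) * (\<Prod>r<n. \<Prod>s<r. (y r + 1 / y r) - (y s + 1 / y s))"
proof -
  let ?C = "mat n n (\<lambda>(i, k). coeff (chebU k :: 'a poly) i)"
  have "det ?C = 1"
    by (rule det_upper_unitriangular) (simp_all add: coeff_chebU)
  moreover have "det (mat n n (\<lambda>(r, k). \<Sum>i<n. ((y r - 1 / y r) * (y r + 1 / y r) ^ i) * coeff (chebU k) i)) =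
      det (mat n n (\<lambda>(r, i). (y r - 1 / y r) * (y r + 1 / y r) ^ i)) * det ?C"
    by (rule det_mat_mult)
  moreover have "(\<Sum>i<n. ((y r - 1 / y r) * (y r + 1 / y r) ^ i) * coeff (chebU k) i) =
      y r ^ Suc k - (1 / y r) ^ Suc k" if "k < n" for r k
  proof -
    have deg: "degree (chebU k :: 'a poly) \<le> k" using coeff_chebU[of k, where 'a = 'a] by (intro degree_le) auto
    have "poly (chebU k) (y r + 1 / y r) = (\<Sum>i\<le>degree (chebU k :: 'a poly). coeff (chebU k) i * (y r + 1 / y r) ^ i)"
      by (rule poly_altdef)
    also have "\<dots> = (\<Sum>i<n. coeff (chebU k) i * (y r + 1 / y r) ^ i)"
      by (rule sum.mono_neutral_left) (use that deg in \<open>auto intro: coeff_eq_0\<close>)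
    finally show ?thesis
      unfolding poly_chebU[OF assms[of r]] by (simp add: sum_distrib_left mult_ac)
  qed
  then have "mat n n (\<lambda>(r, k). \<Sum>i<n. ((y r - 1 / y r) * (y r + 1 / y r) ^ i) * coeff (chebU k) i) =
      mat n n (\<lambda>(r, k). y r ^ Suc k - (1 / y r) ^ Suc k)"
    by (intro eq_matI) auto
  ultimately show ?thesis by (simp add: det_mat_scale_rows det_vandermonde)
qed

section \<open>Macdonald's identity of type C and its lattice expansion\<close>

lemma fps_nth_0_thA: "fps_nth (ev thA x) 0 = (1 :: 'a::field)"
proof -
  have "fps_nth (ev thA x) 0 = (\<Sum>k\<in>{0}. fps_nth (thA k * fps_const (x powi k)) 0)"
    unfolding ev_def
    by (rule fsum_nth) (auto simp: thA_def fps_X_power_nth split: if_splits elim!: evenE)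
  then show ?thesis by (simp add: thA_def)
qed

text \<open>The second determinant does not depend on \<open>x\<close>: it is the change of basis from the theta functions
  to the products \<open>D A\<^sup>i B\<^sup>j\<close>, which turns the first determinant into a homogeneous Vandermonde
  determinant.\<close>

lemma macdonald_C:
  fixes x :: "nat \<Rightarrow> 'a::field_char_0"
  assumes x: "\<And>k. x k \<noteq> 0"
  shows "det (mat n n (\<lambda>(k, r). theta (int n + 1) (int r + 1) (x k))) *
      det (mat n n (\<lambda>(r, i). prod_seq (n - 1 - i) i (int r + 1))) * (\<Prod>k<n. fps_const (x k ^ Suc k)) =
    (\<Prod>k<n. th ((x k)\<^sup>2)) * (\<Prod>l<n. \<Prod>k<l. th (x l * x k) * th (x l / x k))"
proof -
  have "det (mat n n (\<lambda>(k, r). theta (int n + 1) (int r + 1) (x k))) *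
      det (mat n n (\<lambda>(r, i). prod_seq (n - 1 - i) i (int r + 1))) =
    det (mat n n (\<lambda>(k, i). \<Sum>r<n. theta (int n + 1) (int r + 1) (x k) * prod_seq (n - 1 - i) i (int r + 1)))"
    by (rule det_mat_mult[symmetric])
  also have "mat n n (\<lambda>(k, i). \<Sum>r<n. theta (int n + 1) (int r + 1) (x k) * prod_seq (n - 1 - i) i (int r + 1)) =
      mat n n (\<lambda>(k, i). ev thD (x k) * (ev thA (x k) ^ (n - 1 - i) * ev thB (x k) ^ i))"
  proof -
    have "(\<Sum>r<n. theta (int n + 1) (int r + 1) (x k) * prod_seq (n - 1 - i) i (int r + 1)) =
        ev thD (x k) * (ev thA (x k) ^ (n - 1 - i) * ev thB (x k) ^ i)" if "i < n" for k i
      using theta_span[OF that x[of k]] by (simp only: mult_ac)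
    then show ?thesis by (intro eq_matI) auto
  qed
  also have "det \<dots> = (\<Prod>k<n. ev thD (x k)) *
      (\<Prod>l<n. \<Prod>k<l. ev thA (x k) * ev thB (x l) - ev thA (x l) * ev thB (x k))"
    by (subst det_mat_scale_rows, subst det_homogeneous_vandermonde[where a' = "\<lambda>k. inverse (ev thA (x k))"])
       (auto simp: inverse_mult_eq_1' fps_nth_0_thA)
  finally have 1: "det (mat n n (\<lambda>(k, r). theta (int n + 1) (int r + 1) (x k))) *
      det (mat n n (\<lambda>(r, i). prod_seq (n - 1 - i) i (int r + 1))) = \<dots>" .
  \<comment> \<open>Of the k + 1 factors \<open>x k\<close>, one turns D into the theta function of
    the long root, and the other k are the prefactors in Weierstrass' relation for the pairs with a
    smaller index.\<close>
  have 2: "(\<Prod>k<n. fps_const (x k ^ Suc k)) = (\<Prod>k<n. fps_const (x k)) * (\<Prod>l<n. \<Prod>k<l. fps_const (x l))"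
    unfolding prod.distrib[symmetric] by (rule prod.cong) (simp_all add: fps_const_power)
  have 3: "(\<Prod>k<n. ev thD (x k)) * (\<Prod>k<n. fps_const (x k)) = (\<Prod>k<n. th ((x k)\<^sup>2))"
  proof -
    have "ev thD (x k) * fps_const (x k) = th ((x k)\<^sup>2)" for k
    proof -
      have "ev thD (x k) * fps_const (x k) = (fps_const (1 / x k) * fps_const (x k)) * th ((x k)\<^sup>2)"
        unfolding ev_thD[OF x] by (simp only: mult_ac)
      then show ?thesis using x[of k] by simp
    qed
    then show ?thesis by (simp only: prod.distrib[symmetric])
  qed
  have 4: "(\<Prod>l<n. \<Prod>k<l. ev thA (x k) * ev thB (x l) - ev thA (x l) * ev thB (x k)) * (\<Prod>l<n. \<Prod>k<l. fps_const (x l)) =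
      (\<Prod>l<n. \<Prod>k<l. th (x l * x k) * th (x l / x k))"
    unfolding prod.distrib[symmetric] by (intro prod.cong refl) (simp add: th_mult x mult_ac)
  show ?thesis unfolding 1 2 3[symmetric] 4[symmetric] by (simp only: mult_ac)
qed

text \<open>The products have integral coefficient sequences. For the change-of-basis determinant,
  integrality takes the place of an evaluation.\<close>

lemma int_coeffs_det_prod_seq: "int_coeffs (det (mat n n (\<lambda>(r, i). prod_seq (f i) (g i) (h r))))"
  unfolding det_def
  by (auto simp: prod_seq_props(3) sign_def intro!: int_coeffs_sum int_coeffs_simps int_coeffs_prod)

text \<open>Row r of the transposed matrix is a sum over the integers, and by multilinearity the
  determinant expands over the choices \<open>\<phi>\<close> of one term per row. The power of T
  depends only on the row, so each choice leaves one monomial times an alternant of type C.\<close>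

lemma det_theta:
  fixes x :: "nat \<Rightarrow> 'a::field"
  shows "locfin ({..<n} \<rightarrow>\<^sub>E UNIV) (\<lambda>\<phi>. (\<Prod>r<n. fps_X ^ nat (int (Suc n) * (\<phi> r)\<^sup>2 + (int r + 1) * \<phi> r)) *
       fps_const (c \<phi> :: 'a))"
    and "det (mat n n (\<lambda>(k, r). theta (int n + 1) (int r + 1) (x k))) =
    fsum ({..<n} \<rightarrow>\<^sub>E UNIV) (\<lambda>\<phi>. (\<Prod>r<n. fps_X ^ nat (int (Suc n) * (\<phi> r)\<^sup>2 + (int r + 1) * \<phi> r)) *
       fps_const (det (mat n n (\<lambda>(r, k). x k powi (2 * int (Suc n) * \<phi> r + (int r + 1)) -
           x k powi (- (2 * int (Suc n) * \<phi> r + (int r + 1)))))))"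
proof -
  let ?t = "int (Suc n)"
  let ?e = "\<lambda>r m. nat (?t * m\<^sup>2 + (int r + 1) * m)"
  let ?w = "\<lambda>r m. 2 * ?t * m + (int r + 1)"
  let ?s = "\<lambda>k r m. x k powi ?w r m - x k powi (- ?w r m)"
  have lf: "locfin UNIV (\<lambda>m. fps_X ^ ?e r m * fps_const (c m))" if "r < n" for r and c :: "int \<Rightarrow> 'a"
    by (rule locfin_theta) (use that in auto)
  have lf1: "locfin UNIV (\<lambda>m. fps_X ^ ?e r m :: 'a fps)" if "r < n" for r
    using lf[OF that, of "\<lambda>_. 1"] by (simp del: of_nat_Suc)
  have "locfin ({..<n} \<rightarrow>\<^sub>E UNIV) (\<lambda>\<phi>. \<Prod>r<n. fps_X ^ ?e r (\<phi> r) :: 'a fps)"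
    by (rule locfin_prod) (auto simp: lf1 simp del: of_nat_Suc)
  then show lfc: "locfin ({..<n} \<rightarrow>\<^sub>E UNIV) (\<lambda>\<phi>. (\<Prod>r<n. fps_X ^ ?e r (\<phi> r)) * fps_const (c \<phi>))" for c :: "_ \<Rightarrow> 'a"
    by (rule locfin_mult_left)
  have "det (mat n n (\<lambda>(k, r). theta (int n + 1) (int r + 1) (x k))) =
      det (mat n n (\<lambda>(r, k). theta ?t (int r + 1) (x k)))"
  proof -
    have "mat n n (\<lambda>(r, k). theta ?t (int r + 1) (x k)) =
        transpose_mat (mat n n (\<lambda>(k, r). theta (int n + 1) (int r + 1) (x k)))"
      by (rule eq_matI) (auto simp: add.commute)
    then show ?thesis by (simp add: det_transpose[of _ n])
  qed
  also have "\<dots> = (\<Sum>p | p permutes {0..<n}. signof p * (\<Prod>r<n. theta ?t (int r + 1) (x (p r))))"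
    by (subst det_def'[of _ n]) (auto intro!: sum.cong arg_cong2[of _ _ _ _ "(*)"] prod.cong simp: permutes_in_image atLeast0LessThan)
  also have "\<dots> = (\<Sum>p | p permutes {0..<n}. fsum ({..<n} \<rightarrow>\<^sub>E UNIV) (\<lambda>\<phi>. (\<Prod>r<n. fps_X ^ ?e r (\<phi> r)) *
      fps_const (signof p * (\<Prod>r<n. ?s (p r) r (\<phi> r)))))"
  proof (rule sum.cong[OF refl])
    fix p assume "p \<in> {p. p permutes {0..<n}}"
    have sg: "(signof p :: 'a fps) = fps_const (signof p)" by (auto simp: sign_def simp flip: fps_const_neg)
    have "(\<Prod>r<n. theta ?t (int r + 1) (x (p r))) =
        fsum ({..<n} \<rightarrow>\<^sub>E UNIV) (\<lambda>\<phi>. \<Prod>r<n. fps_X ^ ?e r (\<phi> r) * fps_const (?s (p r) r (\<phi> r)))"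
      unfolding theta_def by (rule fsum_prod) (auto simp del: of_nat_Suc intro!: lf)
    also have "\<dots> = fsum ({..<n} \<rightarrow>\<^sub>E UNIV) (\<lambda>\<phi>. (\<Prod>r<n. fps_X ^ ?e r (\<phi> r)) * fps_const (\<Prod>r<n. ?s (p r) r (\<phi> r)))"
      by (simp only: prod.distrib fps_const_prod)
    finally have "signof p * (\<Prod>r<n. theta ?t (int r + 1) (x (p r))) =
      fsum ({..<n} \<rightarrow>\<^sub>E UNIV) (\<lambda>\<phi>. fps_const (signof p) * ((\<Prod>r<n. fps_X ^ ?e r (\<phi> r)) * fps_const (\<Prod>r<n. ?s (p r) r (\<phi> r))))"
      unfolding sg by (simp only: fsum_cmult[OF lfc])
    also have "\<dots> = fsum ({..<n} \<rightarrow>\<^sub>E UNIV) (\<lambda>\<phi>. (\<Prod>r<n. fps_X ^ ?e r (\<phi> r)) *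
      fps_const (signof p * (\<Prod>r<n. ?s (p r) r (\<phi> r))))"
      by (rule fsum_cong[OF refl]) (simp only: fps_const_mult[symmetric] mult_ac)
    finally show "signof p * (\<Prod>r<n. theta ?t (int r + 1) (x (p r))) = \<dots>" .
  qed
  also have "\<dots> = fsum ({..<n} \<rightarrow>\<^sub>E UNIV) (\<lambda>\<phi>. \<Sum>p | p permutes {0..<n}. (\<Prod>r<n. fps_X ^ ?e r (\<phi> r)) *
      fps_const (signof p * (\<Prod>r<n. ?s (p r) r (\<phi> r))))"
  proof -
    have "finite P \<Longrightarrow> (\<Sum>p\<in>P. fsum A (f p)) = fsum A (\<lambda>\<phi>. \<Sum>p\<in>P. f p \<phi>) \<and> locfin A (\<lambda>\<phi>. \<Sum>p\<in>P. f p \<phi>)"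
      if "\<And>p. locfin A (f p)" for P :: "(nat \<Rightarrow> nat) set" and A and f :: "_ \<Rightarrow> (nat \<Rightarrow> int) \<Rightarrow> 'a fps"
    proof (induction P rule: finite_induct)
      case empty
      show ?case by (simp add: fsum_def locfin_def fps_zero_def)
    next
      case (insert p P)
      then show ?case using that by (simp add: fsum_add locfin_add)
    qed
    then show ?thesis using lfc by (simp add: finite_permutations)
  qed
  also have "\<dots> = fsum ({..<n} \<rightarrow>\<^sub>E UNIV) (\<lambda>\<phi>. (\<Prod>r<n. fps_X ^ ?e r (\<phi> r)) *
      fps_const (det (mat n n (\<lambda>(r, k). ?s k r (\<phi> r)))))"
  proof (rule fsum_cong[OF refl])
    fix \<phi> :: "nat \<Rightarrow> int"
    have "det (mat n n (\<lambda>(r, k). ?s k r (\<phi> r))) = (\<Sum>p | p permutes {0..<n}. signof p * (\<Prod>r<n. ?s (p r) r (\<phi> r)))"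
      by (subst det_def'[of _ n]) (auto intro!: sum.cong arg_cong2[of _ _ _ _ "(*)"] prod.cong simp: permutes_in_image atLeast0LessThan)
    then show "(\<Sum>p | p permutes {0..<n}. (\<Prod>r<n. fps_X ^ ?e r (\<phi> r)) * fps_const (signof p * (\<Prod>r<n. ?s (p r) r (\<phi> r)))) =
       (\<Prod>r<n. fps_X ^ ?e r (\<phi> r)) * fps_const (det (mat n n (\<lambda>(r, k). ?s k r (\<phi> r))))"
      by (simp only: sum_distrib_left[symmetric] fps_const_sum)
  qed
  finally show "det (mat n n (\<lambda>(k, r). theta (int n + 1) (int r + 1) (x k))) = \<dots>" .
qed

section \<open>The sum over doubled distinct partitions at \<open>u = Q\<^sup>-\<^sup>t\<close>\<close>

text \<open>The two box ratios of a hook length that occurs once above and once below the diagonal,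
  in terms of U = u and Q = q^2.\<close>

definition hook_factor :: "'a::field \<Rightarrow> 'a \<Rightarrow> nat \<Rightarrow> 'a" where
  "hook_factor U Q h = (1 - Q ^ h / U\<^sup>2) * (1 - U\<^sup>2 * Q ^ h) / (1 - Q ^ h)\<^sup>2"

text \<open>Factors contributed by the outer hook of \<open>b\<close>: the signed power of U; the
  corner box of hook length 2 b combined with its diagonal ratio, where a common factor cancels; the
  column box of hook length b; and the remaining boxes, paired by equal hook lengths.\<close>

definition bead_weight :: "'a::field \<Rightarrow> 'a \<Rightarrow> nat set \<Rightarrow> nat \<Rightarrow> 'a" where
  "bead_weight U Q S b = - (1 / U) * ((1 + Q ^ b / U) * (1 - U * Q ^ b) / (1 - Q ^ (2 * b))) *
     ((1 - U\<^sup>2 * Q ^ b) / (1 - Q ^ b)) * (\<Prod>c=1..<b. hook_factor U Q (if c \<in> S then b + c else b - c))"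

definition weight :: "'a::field \<Rightarrow> 'a \<Rightarrow> nat set \<Rightarrow> 'a" where
  "weight U Q S = (\<Prod>b\<in>S. bead_weight U Q S b)"

lemma bead_weight_cong: "(\<And>c. c < b \<Longrightarrow> c \<in> S \<longleftrightarrow> c \<in> S') \<Longrightarrow> bead_weight U Q S b = bead_weight U Q S' b"
  unfolding bead_weight_def by (intro arg_cong2[of _ _ _ _ "(*)"] refl prod.cong) auto

lemma weight_insert:
  assumes "finite S" "\<And>c. c \<in> S \<Longrightarrow> c < b"
  shows "weight U Q (insert b S) = bead_weight U Q S b * weight U Q S"
proof -
  have "b \<notin> S" using assms(2) by blast
  then have "weight U Q (insert b S) = bead_weight U Q (insert b S) b * (\<Prod>c\<in>S. bead_weight U Q (insert b S) c)"
    unfolding weight_def using assms(1) by simp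
  also have "bead_weight U Q (insert b S) b = bead_weight U Q S b"
    by (rule bead_weight_cong) auto
  also have "(\<Prod>c\<in>S. bead_weight U Q (insert b S) c) = (\<Prod>c\<in>S. bead_weight U Q S c)"
    by (intro prod.cong refl bead_weight_cong) (use assms(2) in force)
  finally show ?thesis by (simp add: weight_def)
qed

text \<open>Charges: \<open>ch j\<close> counts the beads of residue \<open>j\<close> relative to the vacuum, and a position
  \<open>p \<noteq> 0\<close> carries a bead iff \<open>p div N < ch (p mod N)\<close>.\<close>

definition odd_charge :: "int \<Rightarrow> (int \<Rightarrow> int) \<Rightarrow> bool" where
  "odd_charge N ch \<longleftrightarrow> ch 0 = 0 \<and> (\<forall>j\<in>{1..<N}. ch (N - j) = - ch j)"

definition bead :: "int \<Rightarrow> (int \<Rightarrow> int) \<Rightarrow> int \<Rightarrow> bool" where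
  "bead N ch p \<longleftrightarrow> p div N < ch (p mod N)"

definition bead_set :: "int \<Rightarrow> (int \<Rightarrow> int) \<Rightarrow> nat set" where
  "bead_set N ch = {b. 0 < b \<and> bead N ch (int b)}"

section \<open>Positions and beads on the abacus\<close>

lemma mod_div_shift:
  fixes N x y k :: int
  assumes "0 < N" "x = y + N * k"
  shows "x mod N = y mod N" "x div N = y div N + k"
  using assms by simp_all

lemma mod_range: "0 < N \<Longrightarrow> p mod N \<noteq> 0 \<Longrightarrow> p mod N \<in> {1..<N}" for N p :: int
  unfolding atLeastLessThan_iff using pos_mod_sign[of N p] pos_mod_bound[of N p] by linarith

text \<open>Negation sends runner j, level d to runner N - j, level - d - 1 when j is nonzero, and
  odd charges turn "below the charge" into its negation. On runner 0 the charge is 0 and the level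
  merely changes sign.\<close>

lemma bead_uminus:
  assumes "odd_charge N ch" "0 < N" "p \<noteq> 0"
  shows "bead N ch (- p) \<longleftrightarrow> \<not> bead N ch p"
proof (cases "p mod N = 0")
  case True
  then obtain k where k: "p = N * k" by (auto simp: dvd_eq_mod_eq_0[symmetric])
  then have "(- p) div N = - k" "(- p) mod N = 0" "p div N = k" using assms(2) by (simp_all flip: mult_minus_right)
  then show ?thesis using k assms True by (auto simp: bead_def odd_charge_def)
next
  case False
  have m: "p mod N \<in> {1..<N}" using False assms(2) by (intro mod_range)
  have "(- p) mod N = N - p mod N" "(- p) div N = - (p div N) - 1"
    using False assms(2) by (simp_all add: zmod_zminus1_eq_if zdiv_zminus1_eq_if)
  then show ?thesis using assms(1) m unfolding bead_def odd_charge_def by auto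
qed

lemma finite_bead_set:
  assumes "0 < N"
  shows "finite (bead_set N ch)"
proof -
  define M where "M = Max (ch ` {0..<N})"
  have "bead_set N ch \<subseteq> {..nat (N * M + N)}"
  proof
    fix b assume "b \<in> bead_set N ch"
    then have b: "int b div N < ch (int b mod N)" by (simp add: bead_set_def bead_def)
    have "ch (int b mod N) \<le> M" unfolding M_def using assms by (intro Max_ge) auto
    with b have "int b div N \<le> M" by simp
    then have "N * (int b div N) \<le> N * M" using assms by simp
    moreover have "int b = N * (int b div N) + int b mod N" by simp
    moreover have "int b mod N < N" using assms by simp
    ultimately have "int b \<le> N * M + N" by linarith
    then show "b \<in> {..nat (N * M + N)}" by simp
  qed
  then show ?thesis by (rule finite_subset) simp
qed

locale generic_q =
  fixes Q :: "'a::field_char_0"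
  assumes Q_nonzero: "Q \<noteq> 0" and Q_power: "0 < m \<Longrightarrow> Q ^ m \<noteq> 1"
begin

lemma Q_powi_eq_1: "Q powi h = 1 \<longleftrightarrow> h = 0"
proof
  assume h: "Q powi h = 1"
  show "h = 0"
  proof (rule ccontr)
    assume "h \<noteq> 0"
    have "Q ^ nat \<bar>h\<bar> = 1"
    proof (cases "0 \<le> h")
      case True
      then show ?thesis using h by (simp add: power_int_def)
    next
      case False
      then have "inverse (Q ^ nat (- h)) = 1" using h by (simp add: power_int_def power_inverse)
      then show ?thesis using False by (simp add: inverse_eq_1_iff)
    qed
    with Q_power[of "nat \<bar>h\<bar>"] \<open>h \<noteq> 0\<close> show False by simp
  qed
qed simp

lemma Q_powi_inj: "Q powi a = Q powi b \<longleftrightarrow> a = b"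
proof
  assume "Q powi a = Q powi b"
  then have "Q powi (a - b) = 1" by (simp add: power_int_diff Q_nonzero)
  then show "a = b" by (simp add: Q_powi_eq_1)
qed simp

section \<open>Telescoping products of hook factors at \<open>U = 1 / Q ^ t\<close>\<close>

definition br :: "int \<Rightarrow> 'a" where
  "br h = 1 - Q powi h"

lemma br_eq_0_iff [simp]: "br h = 0 \<longleftrightarrow> h = 0"
  by (auto simp: br_def Q_powi_eq_1)

lemma br_uminus: "br (- h) = - (Q powi (- h)) * br h"
  by (simp add: br_def right_diff_distrib power_int_minus Q_nonzero)

text \<open>A factor in h - 2 t appears, so hooks of length 2 t are annihilated. The shape of the
  quotient, with shifts by 2 t up and down, is what telescopes along a runner.\<close>

lemma hook_factor_special:
  "hook_factor (1 / Q ^ t) Q h = br (int h + 2 * int t) * br (int h - 2 * int t) / (br (int h))\<^sup>2"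
proof -
  have "Q ^ h / (1 / Q ^ t)\<^sup>2 = Q powi (int h + 2 * int t)"
    using Q_nonzero by (simp add: power_int_add power_divide power_int_mult field_simps flip: power_mult)
  moreover have "(1 / Q ^ t)\<^sup>2 * Q ^ h = Q powi (int h - 2 * int t)"
    using Q_nonzero by (simp add: power_int_diff power_divide power_int_mult field_simps flip: power_mult)
  ultimately show ?thesis by (simp add: hook_factor_def br_def)
qed

text \<open>Along a progression of step 2 t each factor is a quotient of successive ratios, so only
  the two ends survive. As \<open>\<rho>\<close> is not divisible by 2 t, no denominator
  vanishes.\<close>

lemma prod_chain:
  assumes "0 < \<rho>" "\<rho> < 2 * int t"
  shows "(\<Prod>i<L. hook_factor (1 / Q ^ t) Q (nat (\<rho> + 2 * int t * int i))) =
    (br (\<rho> - 2 * int t) / br \<rho>) * (br (\<rho> + 2 * int t * int L) / br (\<rho> + 2 * int t * int L - 2 * int t))"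
proof (induction L)
  case (Suc L)
  define x where "x = \<rho> + 2 * int t * int L"
  have x: "0 < x" unfolding x_def using assms by (simp add: add_pos_nonneg)
  have L: "\<rho> + 2 * int t * int (Suc L) = x + 2 * int t" by (simp add: x_def algebra_simps)
  have nz: "br x \<noteq> 0" "br (x - 2 * int t) \<noteq> 0"
  proof -
    show "br x \<noteq> 0" using x by simp
    have "x \<noteq> 2 * int t"
    proof
      assume "x = 2 * int t"
      then have "\<rho> mod (2 * int t) = 0" unfolding x_def by (metis mod_mult_self2 mod_self)
      then show False using assms by (simp add: mod_pos_pos_trivial)
    qed
    then show "br (x - 2 * int t) \<noteq> 0" by simp
  qed
  have "(\<Prod>i<Suc L. hook_factor (1 / Q ^ t) Q (nat (\<rho> + 2 * int t * int i))) =
     (br (\<rho> - 2 * int t) / br \<rho>) * (br x / br (x - 2 * int t)) * (br (x + 2 * int t) * br (x - 2 * int t) / (br x)\<^sup>2)"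
    using Suc x by (simp add: x_def[symmetric] hook_factor_special)
  also have "\<dots> = (br (\<rho> - 2 * int t) / br \<rho>) * (br (x + 2 * int t) / br x)"
    using nz by (simp add: power2_eq_square)
  finally show ?case unfolding L by simp
qed (use assms in simp)

lemma prod_br_ratio:
  assumes "0 < t"
  shows "(\<Prod>\<rho>\<in>{1..<2 * int t}. br (\<rho> - 2 * int t) / br \<rho>) = - (Q powi (- (int t * (2 * int t - 1))))"
proof -
  let ?N = "2 * int t"
  have "(\<Prod>\<rho>\<in>{1..<?N}. br (\<rho> - ?N) / br \<rho>) = (\<Prod>\<rho>\<in>{1..<?N}. br (\<rho> - ?N)) / (\<Prod>\<rho>\<in>{1..<?N}. br \<rho>)"
    by (rule prod_dividef)
  also have "(\<Prod>\<rho>\<in>{1..<?N}. br (\<rho> - ?N)) = (\<Prod>\<rho>\<in>{1..<?N}. br (- \<rho>))"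
    by (rule prod.reindex_bij_witness[of _ "\<lambda>\<rho>. ?N - \<rho>" "\<lambda>\<rho>. ?N - \<rho>"]) auto
  also have "\<dots> = (\<Prod>\<rho>\<in>{1..<?N}. - (Q powi (- \<rho>))) * (\<Prod>\<rho>\<in>{1..<?N}. br \<rho>)"
    by (simp only: br_uminus prod.distrib)
  also have "\<dots> / (\<Prod>\<rho>\<in>{1..<?N}. br \<rho>) = (\<Prod>\<rho>\<in>{1..<?N}. - (Q powi (- \<rho>)))" by simp
  also have "\<dots> = (\<Prod>\<rho>\<in>{1..<?N}. - 1) * (\<Prod>\<rho>\<in>{1..<?N}. Q powi (- \<rho>))"
    unfolding prod.distrib[symmetric] by simp
  also have "(\<Prod>\<rho>\<in>{1..<?N}. - 1 :: 'a) = - 1"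
  proof -
    have "odd (nat (?N - 1))" using assms by (simp add: nat_diff_distrib nat_mult_distrib)
    then show ?thesis by simp
  qed
  also have "(\<Prod>\<rho>\<in>{1..<?N}. Q powi (- \<rho>)) = Q powi (- (int t * (2 * int t - 1)))"
    using assms
  proof (induction t rule: nat_induct_non_zero)
    case 1
    have "{1..<2 * int 1} = {1}" by auto
    then show ?case by simp
  next
    case (Suc n)
    have "{1..<2 * int (Suc n)} = insert (2 * int n) (insert (2 * int n + 1) {1..<2 * int n})" using Suc by auto
    then have "(\<Prod>\<rho>\<in>{1..<2 * int (Suc n)}. Q powi (- \<rho>)) =
        Q powi (- (2 * int n)) * (Q powi (- (2 * int n + 1)) * Q powi (- (int n * (2 * int n - 1))))"
      using Suc by simp
    also have "\<dots> = Q powi (- (int (Suc n) * (2 * int (Suc n) - 1)))"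
      unfolding power_int_add[OF disjI1[OF Q_nonzero], symmetric] by (simp add: algebra_simps)
    finally show ?case .
  qed
  finally show ?thesis by simp
qed

text \<open>The hook lengths are the distances from the hole \<open>- b\<close> up to the beads
  above it. The configuration is flush and full below \<open>- b\<close>, so on each runner these
  distances form an unbroken progression, and telescoping leaves the first free position
  \<open>j + N * ch j\<close> of the runner. The residue of \<open>- b\<close> itself contributes no
  bead.\<close>

lemma prod_hook_factor:
  fixes t b :: nat
  defines "N \<equiv> 2 * int t"
  assumes t: "0 < t" and ch: "odd_charge N ch" and b: "0 < b"
    and less: "\<And>c. c \<in> bead_set N ch \<Longrightarrow> c < b"
    and first: "int b div N = ch (int b mod N)" and bmod: "int b mod N \<noteq> 0"
  shows "(\<Prod>c=1..<b. hook_factor (1 / Q ^ t) Q (if c \<in> bead_set N ch then b + c else b - c)) =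
    - (Q powi (- (int t * (N - 1)))) *
    (\<Prod>j\<in>{0..<N} - {(- int b) mod N}. br (int b + j + N * ch j) / br (int b + j + N * ch j - N))"
proof -
  have N: "0 < N" using t by (simp add: N_def)
  let ?F = "hook_factor (1 / Q ^ t) Q"
  define H where "H = {h::int. 0 < h \<and> bead N ch (h - int b)}"
  define L where "L \<rho> = nat (ch ((\<rho> - int b) mod N) - (\<rho> - int b) div N)" for \<rho>
  have big: "\<not> bead N ch p" if "p \<ge> int b" for p
  proof
    assume "bead N ch p"
    then have "nat p \<in> bead_set N ch" using that b by (auto simp: bead_set_def)
    then have "nat p < b" by (rule less)
    with that b show False by simp
  qed
  \<comment> \<open>A free position below \<open>- b\<close> would have a mirror image that is a
    bead above \<open>b\<close>, contrary to the maximality of \<open>b\<close>; so \<open>L\<close>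
    counts without truncation.\<close>
  have Lpos: "0 \<le> ch ((\<rho> - int b) mod N) - (\<rho> - int b) div N" if "\<rho> \<in> {1..<N}" for \<rho>
  proof (rule ccontr)
    assume neg: "\<not> ?thesis"
    define p where "p = \<rho> - int b - N"
    have "(\<rho> - int b) = p + N" by (simp add: p_def)
    then have "(\<rho> - int b) mod N = p mod N" "(\<rho> - int b) div N = p div N + 1"
      using N by (simp_all add: div_add_self2)
    with neg have "\<not> bead N ch p" by (simp add: bead_def)
    moreover have "p < - int b" using that by (simp add: p_def)
    ultimately have "bead N ch (- p)" using bead_uminus[OF ch N, of p] by auto
    then show False using big[of "- p"] \<open>p < - int b\<close> by simp
  qed
  have Lb: "\<rho> + N * int (L \<rho>) = int b + (\<rho> - int b) mod N + N * ch ((\<rho> - int b) mod N)"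
    if "\<rho> \<in> {1..<N}" for \<rho>
  proof -
    have "N * int (L \<rho>) = N * ch ((\<rho> - int b) mod N) - N * ((\<rho> - int b) div N)"
      using Lpos[OF that] by (simp add: L_def right_diff_distrib)
    moreover have "\<rho> - int b = N * ((\<rho> - int b) div N) + (\<rho> - int b) mod N" by simp
    ultimately show ?thesis by linarith
  qed
  have "(\<Prod>c=1..<b. ?F (if c \<in> bead_set N ch then b + c else b - c)) = (\<Prod>h\<in>H. ?F (nat h))"
  proof (rule prod.reindex_bij_witness[of _ "\<lambda>h. nat \<bar>h - int b\<bar>"
        "\<lambda>c. if c \<in> bead_set N ch then int b + int c else int b - int c"])
    fix c assume c: "c \<in> {1..<b}"
    then show "nat \<bar>(if c \<in> bead_set N ch then int b + int c else int b - int c) - int b\<bar> = c" by auto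
    show "(if c \<in> bead_set N ch then int b + int c else int b - int c) \<in> H"
      using c bead_uminus[OF ch N, of "int c"] by (auto simp: H_def bead_set_def)
    show "?F (nat (if c \<in> bead_set N ch then int b + int c else int b - int c)) =
        ?F (if c \<in> bead_set N ch then b + c else b - c)"
      using c by (auto intro!: arg_cong[of _ _ ?F])
  next
    fix h assume h: "h \<in> H"
    have "\<not> bead N ch 0" using ch by (simp add: bead_def odd_charge_def)
    with h have h0: "h \<noteq> int b" "0 < h" "bead N ch (h - int b)" by (auto simp: H_def)
    have hb: "h - int b < int b" using big[of "h - int b"] h0 by force
    show "nat \<bar>h - int b\<bar> \<in> {1..<b}" using h0 hb by auto
    show "(if nat \<bar>h - int b\<bar> \<in> bead_set N ch then int b + int (nat \<bar>h - int b\<bar>) else int b - int (nat \<bar>h - int b\<bar>)) = h"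
    proof (cases "h > int b")
      case True
      then show ?thesis using h0 by (simp add: bead_set_def)
    next
      case False
      then have "\<not> bead N ch (int b - h)" using bead_uminus[OF ch N, of "h - int b"] h0 by auto
      then show ?thesis using False h0 by (simp add: bead_set_def)
    qed
  qed
  also have "H = (\<lambda>(\<rho>, i). \<rho> + N * int i) ` (SIGMA \<rho>:{1..<N}. {..<L \<rho>})"
  proof (intro equalityI subsetI)
    fix h assume h: "h \<in> H"
    define \<rho> where "\<rho> = h mod N"
    define i where "i = nat (h div N)"
    have hi: "h = \<rho> + N * int i" using h N by (simp add: \<rho>_def i_def H_def pos_imp_zdiv_nonneg_iff)
    have bd: "bead N ch (h - int b)" and hpos: "0 < h" using h by (simp_all add: H_def)
    have "h - int b = (\<rho> - int b) + N * int i" using hi by simp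
    note dm = mod_div_shift[OF N this]
    \<comment> \<open>As \<open>b\<close> is the first free position of its runner,
      \<open>- b\<close> is the highest bead position allowed on the mirror runner by the charge,
      and nothing lies above it.\<close>
    have "\<rho> \<noteq> 0"
    proof
      assume r0: "\<rho> = 0"
      have m: "int b mod N \<in> {1..<N}" using bmod N by (intro mod_range)
      have e: "(- int b) mod N = N - int b mod N" "(- int b) div N = - (int b div N) - 1"
        using bmod N by (simp_all add: zmod_zminus1_eq_if zdiv_zminus1_eq_if)
      have "ch (N - int b mod N) = - ch (int b mod N)" using ch m by (auto simp: odd_charge_def)
      then have "- (int b div N) - 1 + int i < - (int b div N)"
        using bd unfolding bead_def dm r0 using e first by simp
      then have "i = 0" by simp
      then show False using hi r0 hpos by simp
    qed
    moreover have "0 \<le> \<rho>" "\<rho> < N" using N by (simp_all add: \<rho>_def)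
    ultimately have \<rho>: "\<rho> \<in> {1..<N}" by auto
    have "int i < ch ((\<rho> - int b) mod N) - (\<rho> - int b) div N" using bd unfolding bead_def dm by simp
    then have "i < L \<rho>" by (simp add: L_def)
    with \<rho> hi show "h \<in> (\<lambda>(\<rho>, i). \<rho> + N * int i) ` (SIGMA \<rho>:{1..<N}. {..<L \<rho>})"
      by (intro image_eqI[of _ _ "(\<rho>, i)"]) auto
  next
    fix h assume "h \<in> (\<lambda>(\<rho>, i). \<rho> + N * int i) ` (SIGMA \<rho>:{1..<N}. {..<L \<rho>})"
    then obtain \<rho> i where \<rho>: "\<rho> \<in> {1..<N}" and i: "i < L \<rho>" and h: "h = \<rho> + N * int i" by auto
    have "h - int b = (\<rho> - int b) + N * int i" using h by simp
    note mod_div_shift[OF N this]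
    moreover have "int i < ch ((\<rho> - int b) mod N) - (\<rho> - int b) div N" using i by (simp add: L_def)
    moreover have "0 < h" using \<rho> N h by (simp add: add_pos_nonneg)
    ultimately show "h \<in> H" by (simp add: H_def bead_def)
  qed
  also have "(\<Prod>h\<in>\<dots>. ?F (nat h)) = (\<Prod>(\<rho>, i)\<in>(SIGMA \<rho>:{1..<N}. {..<L \<rho>}). ?F (nat (\<rho> + N * int i)))"
  proof (subst prod.reindex)
    show "inj_on (\<lambda>(\<rho>, i). \<rho> + N * int i) (SIGMA \<rho>:{1..<N}. {..<L \<rho>})"
    proof (rule inj_onI, clarify)
      fix \<rho> i \<rho>' i' assume *: "\<rho> \<in> {1..<N}" "\<rho>' \<in> {1..<N}" "\<rho> + N * int i = \<rho>' + N * int i'"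
      have "\<rho> mod N = \<rho>' mod N"
        using mod_div_shift(1)[OF N *(3)] mod_div_shift(1)[OF N refl, of \<rho> "int i"] by simp
      then have "\<rho> = \<rho>'" using * by simp
      with * N show "\<rho> = \<rho>' \<and> i = i'" by simp
    qed
  qed (auto intro!: prod.cong)
  also have "\<dots> = (\<Prod>\<rho>\<in>{1..<N}. \<Prod>i<L \<rho>. ?F (nat (\<rho> + N * int i)))"
    by (subst prod.Sigma) auto
  also have "\<dots> = (\<Prod>\<rho>\<in>{1..<N}. (br (\<rho> - N) / br \<rho>) *
      (br (int b + (\<rho> - int b) mod N + N * ch ((\<rho> - int b) mod N)) /
       br (int b + (\<rho> - int b) mod N + N * ch ((\<rho> - int b) mod N) - N)))"
  proof (rule prod.cong[OF refl])
    fix \<rho> assume \<rho>: "\<rho> \<in> {1..<N}"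
    then show "(\<Prod>i<L \<rho>. ?F (nat (\<rho> + N * int i))) = (br (\<rho> - N) / br \<rho>) *
      (br (int b + (\<rho> - int b) mod N + N * ch ((\<rho> - int b) mod N)) /
       br (int b + (\<rho> - int b) mod N + N * ch ((\<rho> - int b) mod N) - N))"
      using prod_chain[of \<rho> t "L \<rho>", folded N_def] unfolding Lb[OF \<rho>, symmetric] by auto
  qed
  also have "\<dots> = (\<Prod>\<rho>\<in>{1..<N}. br (\<rho> - N) / br \<rho>) *
     (\<Prod>\<rho>\<in>{1..<N}. br (int b + (\<rho> - int b) mod N + N * ch ((\<rho> - int b) mod N)) /
       br (int b + (\<rho> - int b) mod N + N * ch ((\<rho> - int b) mod N) - N))" by (rule prod.distrib)
  also have "(\<Prod>\<rho>\<in>{1..<N}. br (\<rho> - N) / br \<rho>) = - (Q powi (- (int t * (N - 1))))"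
    unfolding N_def by (rule prod_br_ratio[OF t])
  also have "(\<Prod>\<rho>\<in>{1..<N}. br (int b + (\<rho> - int b) mod N + N * ch ((\<rho> - int b) mod N)) /
       br (int b + (\<rho> - int b) mod N + N * ch ((\<rho> - int b) mod N) - N)) =
    (\<Prod>j\<in>{0..<N} - {(- int b) mod N}. br (int b + j + N * ch j) / br (int b + j + N * ch j - N))"
  proof (rule prod.reindex_bij_witness[of _ "\<lambda>j. (j + int b) mod N" "\<lambda>\<rho>. (\<rho> - int b) mod N"])
    fix \<rho> assume \<rho>: "\<rho> \<in> {1..<N}"
    then show "((\<rho> - int b) mod N + int b) mod N = \<rho>" by (simp add: mod_simps)
    have "(\<rho> - int b) mod N \<noteq> (- int b) mod N"
    proof
      assume "(\<rho> - int b) mod N = (- int b) mod N"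
      then have "((\<rho> - int b) mod N + int b) mod N = ((- int b) mod N + int b) mod N" by simp
      then show False using \<rho> by (simp add: mod_simps)
    qed
    then show "(\<rho> - int b) mod N \<in> {0..<N} - {(- int b) mod N}" using N by simp
  next
    fix j assume j: "j \<in> {0..<N} - {(- int b) mod N}"
    then show "((j + int b) mod N - int b) mod N = j" by (simp add: mod_simps)
    have "(j + int b) mod N \<noteq> 0"
    proof
      assume "(j + int b) mod N = 0"
      then have "((j + int b) mod N - int b) mod N = (- int b) mod N" by simp
      then show False using j by (simp add: mod_simps)
    qed
    then show "(j + int b) mod N \<in> {1..<N}" using N by (intro mod_range)
  qed simp
  finally show ?thesis .
qed

end

text \<open>Here t = n + 1 and N = 2 t. Oddness leaves n free charges, those of the runners t + r +
  1; the mirror runners t - r - 1 carry the negatives, and the self-mirrored runners 0 and t carry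
  0.\<close>

definition charge :: "nat \<Rightarrow> (nat \<Rightarrow> int) \<Rightarrow> int \<Rightarrow> int" where
  "charge n \<phi> j = (if int (Suc n) < j then \<phi> (nat (j - int (Suc n) - 1))
     else if 0 < j \<and> j < int (Suc n) then - \<phi> (nat (int (Suc n) - j - 1)) else 0)"

lemma odd_charge_charge: "odd_charge (2 * int (Suc n)) (charge n \<phi>)"
  unfolding odd_charge_def
proof (intro conjI ballI)
  fix j assume j: "j \<in> {1..<2 * int (Suc n)}"
  consider "j < int (Suc n)" | "j = int (Suc n)" | "int (Suc n) < j" by linarith
  then show "charge n \<phi> (2 * int (Suc n) - j) = - charge n \<phi> j"
  proof cases
    case 1
    have "2 * int (Suc n) - j - int (Suc n) - 1 = int (Suc n) - j - 1" by simp
    then show ?thesis using j 1 by (simp add: charge_def)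
  next
    case 3
    have "int (Suc n) - (2 * int (Suc n) - j) - 1 = j - int (Suc n) - 1" by simp
    then show ?thesis using j 3 by (simp add: charge_def)
  qed (simp add: charge_def)
qed (simp add: charge_def)

lemma charge_upper: "charge n \<phi> (int (Suc n) + int s + 1) = \<phi> s"
  by (simp add: charge_def)

lemma charge_lower: "s < n \<Longrightarrow> charge n \<phi> (int (Suc n) - int s - 1) = - \<phi> s"
  by (simp add: charge_def)

lemma prod_residues:
  fixes f :: "int \<Rightarrow> 'b::comm_monoid_mult"
  shows "(\<Prod>j\<in>{0..<2 * int (Suc n)}. f j) =
    f 0 * f (int (Suc n)) * (\<Prod>s<n. f (int (Suc n) + int s + 1) * f (int (Suc n) - int s - 1))"
proof -
  let ?t = "int (Suc n)"
  have split: "{0..<2 * ?t} = insert 0 (insert ?t ((\<lambda>s. ?t + int s + 1) ` {..<n} \<union> (\<lambda>s. ?t - int s - 1) ` {..<n}))"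
  proof (intro equalityI subsetI)
    fix j assume j: "j \<in> {0..<2 * ?t}"
    consider "j = 0" | "j = ?t" | "0 < j" "j < ?t" | "?t < j" using j by force
    then show "j \<in> insert 0 (insert ?t ((\<lambda>s. ?t + int s + 1) ` {..<n} \<union> (\<lambda>s. ?t - int s - 1) ` {..<n}))"
    proof cases
      case 3
      then have "j = ?t - int (nat (?t - j - 1)) - 1" "nat (?t - j - 1) < n" by auto
      then show ?thesis by blast
    next
      case 4
      then have "j = ?t + int (nat (j - ?t - 1)) + 1" "nat (j - ?t - 1) < n" using j by auto
      then show ?thesis by blast
    qed auto
  qed auto
  have "prod f ((\<lambda>s. ?t + int s + 1) ` {..<n}) = (\<Prod>s<n. f (?t + int s + 1))"
    by (subst prod.reindex) (auto simp: inj_on_def)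
  moreover have "prod f ((\<lambda>s. ?t - int s - 1) ` {..<n}) = (\<Prod>s<n. f (?t - int s - 1))"
    by (subst prod.reindex) (auto simp: inj_on_def)
  ultimately show ?thesis
    unfolding split by (subst prod.insert, simp, force, subst prod.insert, simp, force, subst prod.union_disjoint)
      (auto simp: prod.distrib mult.assoc)
qed

text \<open>The effect on a Vandermonde product of replacing one entry, in cross-multiplied form so
  that coinciding entries are allowed. In the induction the new row contributes the factor
  \<open>\<psi> n - a\<close>, which moves to the other side as \<open>a - \<psi> n\<close>.\<close>

lemma prod_diff_update:
  fixes \<psi> :: "nat \<Rightarrow> 'b::comm_ring_1"
  shows "r < n \<Longrightarrow> (\<Prod>l<n. \<Prod>k<l. (\<psi>(r := a)) l - (\<psi>(r := a)) k) * (\<Prod>s\<in>{..<n} - {r}. b - \<psi> s) =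
    (\<Prod>l<n. \<Prod>k<l. (\<psi>(r := b)) l - (\<psi>(r := b)) k) * (\<Prod>s\<in>{..<n} - {r}. a - \<psi> s)"
proof (induction n)
  case (Suc n)
  let ?V = "\<lambda>a. \<Prod>l<n. \<Prod>k<l. (\<psi>(r := a)) l - (\<psi>(r := a)) k"
  show ?case
  proof (cases "r = n")
    case True
    have V: "?V a = (\<Prod>l<n. \<Prod>k<l. \<psi> l - \<psi> k)" for a
      by (intro prod.cong refl) (use True in auto)
    have "(\<Prod>k<n. (\<psi>(r := a)) n - (\<psi>(r := a)) k) = (\<Prod>k<n. a - \<psi> k)" for a
      by (rule prod.cong) (use True in auto)
    moreover have "{..<Suc n} - {r} = {..<n}" using True by auto
    ultimately show ?thesis by (simp only: prod.lessThan_Suc V) (simp add: mult_ac)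
  next
    case False
    then have r: "r < n" using Suc.prems by simp
    have P: "(\<Prod>k<n. (\<psi>(r := a)) n - (\<psi>(r := a)) k) = (\<psi> n - a) * (\<Prod>s\<in>{..<n} - {r}. \<psi> n - \<psi> s)" for a
    proof -
      have "(\<Prod>k<n. (\<psi>(r := a)) n - (\<psi>(r := a)) k) = ((\<psi>(r := a)) n - (\<psi>(r := a)) r) *
          (\<Prod>k\<in>{..<n} - {r}. (\<psi>(r := a)) n - (\<psi>(r := a)) k)"
        using r by (subst prod.remove[of _ r]) auto
      also have "(\<Prod>k\<in>{..<n} - {r}. (\<psi>(r := a)) n - (\<psi>(r := a)) k) = (\<Prod>s\<in>{..<n} - {r}. \<psi> n - \<psi> s)"
        by (rule prod.cong) (use False in auto)
      finally show ?thesis using False by simp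
    qed
    have "{..<Suc n} - {r} = insert n ({..<n} - {r})" using r by auto
    then have R: "(\<Prod>s\<in>{..<Suc n} - {r}. b - \<psi> s) = (b - \<psi> n) * (\<Prod>s\<in>{..<n} - {r}. b - \<psi> s)" for b
      by simp
    have "?V a * (\<Prod>s\<in>{..<n} - {r}. b - \<psi> s) = ?V b * (\<Prod>s\<in>{..<n} - {r}. a - \<psi> s)"
      by (rule Suc.IH[OF r])
    then have "(?V a * (\<Prod>s\<in>{..<n} - {r}. b - \<psi> s)) * ((\<psi> n - a) * (b - \<psi> n) * (\<Prod>s\<in>{..<n} - {r}. \<psi> n - \<psi> s)) =
       (?V b * (\<Prod>s\<in>{..<n} - {r}. a - \<psi> s)) * ((\<psi> n - b) * (a - \<psi> n) * (\<Prod>s\<in>{..<n} - {r}. \<psi> n - \<psi> s))"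
      by (simp add: algebra_simps)
    then show ?thesis by (simp only: prod.lessThan_Suc P R mult_ac)
  qed
qed simp

section \<open>The generating series of the weights and the energy of a charge\<close>

definition strict_sets :: "nat \<Rightarrow> nat set set" where
  "strict_sets k = {S. finite S \<and> 0 \<notin> S \<and> \<Sum>S = k}"

lemma finite_strict_sets: "finite (strict_sets k)"
proof -
  have "strict_sets k \<subseteq> Pow {..k}"
    by (auto simp: strict_sets_def intro: member_le_sum[of _ _ "\<lambda>x. x", simplified])
  then show ?thesis by (rule finite_subset) simp
qed

definition weight_series :: "'a::field \<Rightarrow> 'a \<Rightarrow> 'a fps" where
  "weight_series U Q = Abs_fps (\<lambda>k. \<Sum>S\<in>strict_sets k. weight U Q S)"

text \<open>The exponent of T belonging to \<open>\<phi>\<close> in the expanded theta determinant;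
  it turns out to be the sum of the positions in the bead set.\<close>

definition energy :: "nat \<Rightarrow> (nat \<Rightarrow> int) \<Rightarrow> nat" where
  "energy n \<phi> = (\<Sum>r<n. nat (int (Suc n) * (\<phi> r)\<^sup>2 + (int r + 1) * \<phi> r))"

context generic_q
begin

definition sn :: "int \<Rightarrow> 'a" where "sn w = Q powi w - Q powi (- w)"
definition cs :: "int \<Rightarrow> 'a" where "cs w = Q powi w + Q powi (- w)"

text \<open>The Weyl denominator of type C at the points \<open>Q powi w r\<close>, in the product
  form of \<open>det_weyl_C\<close>.\<close>

definition weyl :: "nat \<Rightarrow> (nat \<Rightarrow> int) \<Rightarrow> 'a" where
  "weyl n w = (\<Prod>r<n. sn (w r)) * (\<Prod>r<n. \<Prod>s<r. cs (w r) - cs (w s))"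

lemma sn_br: "sn w = - (Q powi (- w)) * br (2 * w)"
  using Q_nonzero by (simp add: sn_def br_def algebra_simps power_int_mult power2_eq_square mult_2 power_int_add power_int_minus)

lemma cs_diff: "cs a - cs w = Q powi (- a) * (br (a + w) * br (a - w))"
  using Q_nonzero by (simp add: cs_def br_def power_int_add power_int_diff power_int_minus field_simps)

lemma sn_uminus: "sn (- w) = - sn w" and cs_uminus: "cs (- w) = cs w"
  by (simp_all add: sn_def cs_def add.commute)

lemma weyl_cong: "(\<And>r. r < n \<Longrightarrow> w r = w' r) \<Longrightarrow> weyl n w = weyl n w'"
  unfolding weyl_def by (intro arg_cong2[of _ _ _ _ "(*)"] prod.cong refl) auto

lemma weyl_update:
  assumes r: "r < n"
  shows "weyl n (w(r := a)) * (sn b * (\<Prod>s\<in>{..<n} - {r}. cs b - cs (w s))) =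
    weyl n (w(r := b)) * (sn a * (\<Prod>s\<in>{..<n} - {r}. cs a - cs (w s)))"
proof -
  let ?P = "\<Prod>s\<in>{..<n} - {r}. sn (w s)"
  have S: "(\<Prod>k<n. sn ((w(r := a)) k)) = sn a * ?P" for a
  proof -
    have "(\<Prod>k<n. sn ((w(r := a)) k)) = sn ((w(r := a)) r) * (\<Prod>k\<in>{..<n} - {r}. sn ((w(r := a)) k))"
      using r by (subst prod.remove[of _ r]) auto
    also have "(\<Prod>k\<in>{..<n} - {r}. sn ((w(r := a)) k)) = ?P" by (rule prod.cong) auto
    finally show ?thesis by simp
  qed
  have C: "(\<Prod>l<n. \<Prod>k<l. cs ((w(r := a)) l) - cs ((w(r := a)) k)) =
      (\<Prod>l<n. \<Prod>k<l. ((\<lambda>s. cs (w s))(r := cs a)) l - ((\<lambda>s. cs (w s))(r := cs a)) k)" for a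
    by (intro prod.cong refl) auto
  show ?thesis
    unfolding weyl_def S C using prod_diff_update[OF r, of "\<lambda>s. cs (w s)" "cs a" "cs b"]
    by (simp add: mult_ac)
qed

text \<open>Up to sign, b - t and b + t are the values of \<open>w r\<close> before and after the
  bead \<open>b\<close> is added. All other factors cancel, so adding a bead multiplies by the
  quotient of the corresponding Weyl denominators.\<close>

lemma bead_weight_special:
  fixes n b r :: nat and \<phi> :: "nat \<Rightarrow> int"
  defines "t \<equiv> Suc n" and "N \<equiv> 2 * int (Suc n)" and "w \<equiv> \<lambda>s. 2 * int (Suc n) * \<phi> s + (int s + 1)"
  assumes r: "r < n" and b: "0 < b"
    and less: "\<And>c. c \<in> bead_set N (charge n \<phi>) \<Longrightarrow> c < b"
    and first: "int b div N = charge n \<phi> (int b mod N)"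
    and bmod: "int b mod N \<in> {int t + int r + 1, int t - int r - 1}"
  shows "bead_weight (1 / Q ^ t) Q (bead_set N (charge n \<phi>)) b =
    sn (int b + int t) / sn (int b - int t) *
      (\<Prod>s\<in>{..<n} - {r}. (cs (int b + int t) - cs (w s)) / (cs (int b - int t) - cs (w s)))"
proof -
  let ?b = "int b" and ?t = "int t"
  have N: "0 < N" "N = 2 * ?t" by (simp_all add: N_def t_def)
  define f where "f j = br (?b + j + N * charge n \<phi> j) / br (?b + j + N * charge n \<phi> j - N)" for j
  define jb where "jb = ?b mod N"
  have bj: "jb = ?t + int r + 1 \<or> jb = ?t - int r - 1" using bmod by (auto simp: jb_def)
  have jb0: "jb \<noteq> 0" "jb \<noteq> ?t" using bmod r by (auto simp: jb_def t_def)
  have jbm: "(- ?b) mod N = N - jb" using jb0 N(1) by (simp add: jb_def zmod_zminus1_eq_if)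
  have b_eq: "?b = jb + N * charge n \<phi> jb"
    unfolding jb_def first[symmetric] by simp
  have b_ne: "?b \<noteq> ?t" "?b \<noteq> N"
  proof -
    show "?b \<noteq> ?t"
    proof
      assume "?b = ?t"
      then have "jb = ?t mod (2 * ?t)" by (simp add: jb_def N(2))
      also have "\<dots> = ?t" by (rule mod_pos_pos_trivial) (auto simp: t_def)
      finally show False using jb0 by simp
    qed
    show "?b \<noteq> N" using jb0 by (auto simp: jb_def)
  qed
  have fjb: "f jb = br (2 * ?b) / br (2 * ?b - N)" unfolding f_def using b_eq by (simp add: algebra_simps)
  have f0: "f 0 = br ?b / br (?b - N)" by (simp add: f_def charge_def)
  have ft: "f ?t = br (?b + ?t) / br (?b - ?t)"
  proof -
    have "charge n \<phi> ?t = 0" "?b + ?t - N = ?b - ?t" by (simp_all add: charge_def t_def N_def)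
    then show ?thesis by (simp only: f_def mult_zero_right add_0_right)
  qed
  have fu: "f (?t + int s + 1) = br (?b + ?t + w s) / br (?b - ?t + w s)" for s
    unfolding f_def t_def charge_upper by (simp add: w_def N_def algebra_simps)
  have fl: "f (?t - int s - 1) = br (?b + ?t - w s) / br (?b - ?t - w s)" if "s < n" for s
    unfolding f_def t_def charge_lower[OF that] by (simp add: w_def N_def algebra_simps)
  \<comment> \<open>The excluded residue is the mirror image of the runner of \<open>b\<close>.
    Replacing its factor by 1 keeps the pairing of mirror runners; the pair of \<open>b\<close> then
    contributes the single factor \<open>f jb\<close>.\<close>
  have "(\<Prod>j\<in>{0..<N} - {(- ?b) mod N}. f j) = (\<Prod>j\<in>{0..<N}. if j = N - jb then 1 else f j)"
  proof -
    have "(\<Prod>j\<in>{0..<N} - {N - jb}. f j) = (\<Prod>j\<in>{0..<N} - {N - jb}. if j = N - jb then 1 else f j)"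
      by (rule prod.cong) auto
    also have "\<dots> = (\<Prod>j\<in>{0..<N}. if j = N - jb then 1 else f j)"
      by (rule prod.mono_neutral_left) auto
    finally show ?thesis by (simp only: jbm)
  qed
  also have "\<dots> = f 0 * f ?t * (\<Prod>s<n. (if ?t + int s + 1 = N - jb then 1 else f (?t + int s + 1)) *
      (if ?t - int s - 1 = N - jb then 1 else f (?t - int s - 1)))"
  proof -
    have "0 \<noteq> N - jb" using pos_mod_bound[OF N(1), of ?b] by (simp add: jb_def)
    moreover have "?t \<noteq> N - jb" using jb0 N(2) by simp
    moreover have "(\<Prod>j\<in>{0..<N}. g j) = g 0 * g ?t * (\<Prod>s<n. g (?t + int s + 1) * g (?t - int s - 1))" for g :: "int \<Rightarrow> 'a"
      unfolding N_def t_def by (rule prod_residues)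
    ultimately show ?thesis by (simp only: if_False)
  qed
  also have "(\<Prod>s<n. (if ?t + int s + 1 = N - jb then 1 else f (?t + int s + 1)) *
      (if ?t - int s - 1 = N - jb then 1 else f (?t - int s - 1))) =
    f jb * (\<Prod>s\<in>{..<n} - {r}. f (?t + int s + 1) * f (?t - int s - 1))"
  proof -
    have "(\<Prod>s\<in>{..<n} - {r}. (if ?t + int s + 1 = N - jb then 1 else f (?t + int s + 1)) *
      (if ?t - int s - 1 = N - jb then 1 else f (?t - int s - 1))) =
      (\<Prod>s\<in>{..<n} - {r}. f (?t + int s + 1) * f (?t - int s - 1))"
      by (rule prod.cong) (use bj in \<open>auto simp: N(2)\<close>)
    moreover have "(if ?t + int r + 1 = N - jb then 1 else f (?t + int r + 1)) *
      (if ?t - int r - 1 = N - jb then 1 else f (?t - int r - 1)) = f jb"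
      using bj by (auto simp: N(2))
    ultimately show ?thesis using r by (subst prod.remove[of _ r]) auto
  qed
  finally have F: "(\<Prod>j\<in>{0..<N} - {(- ?b) mod N}. f j) =
    f 0 * f ?t * (f jb * (\<Prod>s\<in>{..<n} - {r}. f (?t + int s + 1) * f (?t - int s - 1)))" .
  have ratio: "f (?t + int s + 1) * f (?t - int s - 1) =
      Q powi (2 * ?t) * ((cs (?b + ?t) - cs (w s)) / (cs (?b - ?t) - cs (w s)))" if "s < n" for s
  proof -
    have "Q powi (2 * ?t) * Q powi (- (?b + ?t)) = Q powi (- (?b - ?t))"
      by (simp add: Q_nonzero flip: power_int_add)
    then have "Q powi (2 * ?t) * ((cs (?b + ?t) - cs (w s)) / (cs (?b - ?t) - cs (w s))) =
       (Q powi (- (?b - ?t)) * (br (?b + ?t + w s) * br (?b + ?t - w s))) /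
       (Q powi (- (?b - ?t)) * (br (?b - ?t + w s) * br (?b - ?t - w s)))"
      unfolding cs_diff by (simp flip: mult.assoc)
    also have "\<dots> = (br (?b + ?t + w s) * br (?b + ?t - w s)) / (br (?b - ?t + w s) * br (?b - ?t - w s))"
      using Q_nonzero by (intro mult_divide_mult_cancel_left) simp
    finally show ?thesis unfolding fu fl[OF that] by simp
  qed
  have "(\<Prod>s\<in>{..<n} - {r}. f (?t + int s + 1) * f (?t - int s - 1)) =
    (\<Prod>s\<in>{..<n} - {r}. Q powi (2 * ?t) * ((cs (?b + ?t) - cs (w s)) / (cs (?b - ?t) - cs (w s))))"
    by (rule prod.cong) (use ratio in auto)
  also have "\<dots> = Q powi (2 * ?t * (int n - 1)) *
      (\<Prod>s\<in>{..<n} - {r}. (cs (?b + ?t) - cs (w s)) / (cs (?b - ?t) - cs (w s)))" (is "_ = _ * ?C")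
  proof -
    have "int n - 1 = int (n - 1)" using r by simp
    then have "(Q powi (2 * ?t)) ^ (n - 1) = Q powi (2 * ?t * (int n - 1))"
      by (simp only: power_int_mult power_int_of_nat)
    moreover have "card ({..<n} - {r}) = n - 1" using r by simp
    ultimately show ?thesis by (simp only: prod.distrib prod_constant)
  qed
  finally have P: "(\<Prod>s\<in>{..<n} - {r}. f (?t + int s + 1) * f (?t - int s - 1)) = Q powi (2 * ?t * (int n - 1)) * ?C" .
  have "bead_weight (1 / Q ^ t) Q (bead_set N (charge n \<phi>)) b =
      - (Q ^ t) * ((1 + Q ^ (b + t)) * br (?b - ?t) / br (2 * ?b)) * (br (?b - N) / br ?b) *
      (- (Q powi (- (?t * (N - 1)))) * (\<Prod>j\<in>{0..<N} - {(- ?b) mod N}. f j))"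
  proof -
    have "(\<Prod>c=1..<b. hook_factor (1 / Q ^ t) Q (if c \<in> bead_set N (charge n \<phi>) then b + c else b - c)) =
       - (Q powi (- (?t * (N - 1)))) * (\<Prod>j\<in>{0..<N} - {(- ?b) mod N}. f j)"
      unfolding f_def N(2)
      by (rule prod_hook_factor)
         (use b less first jb0 odd_charge_charge[of n \<phi>] in \<open>auto simp: jb_def N_def t_def\<close>)
    moreover have "1 - 1 / Q ^ t * Q ^ b = br (?b - ?t)"
      by (simp add: br_def power_int_diff Q_nonzero)
    moreover have "1 - (1 / Q ^ t)\<^sup>2 * Q ^ b = br (?b - N)"
    proof -
      have "Q powi N = Q ^ (2 * t)" unfolding N(2) using power_int_of_nat[of Q "2 * t"] by simp
      also have "\<dots> = (Q ^ t)\<^sup>2" by (simp add: mult.commute flip: power_mult)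
      finally show ?thesis by (simp add: br_def power_int_diff Q_nonzero power_divide)
    qed
    moreover have "1 - Q ^ (2 * b) = br (2 * ?b)" using power_int_of_nat[of Q "2 * b"] by (simp add: br_def)
    moreover have "1 - Q ^ b = br ?b" by (simp add: br_def)
    moreover have "Q ^ b / (1 / Q ^ t) = Q ^ (b + t)" by (simp add: power_add)
    moreover have "1 / (1 / Q ^ t) = Q ^ t" by simp
    ultimately show ?thesis unfolding bead_weight_def by (simp only:)
  qed
  also have "\<dots> = Q ^ t * Q powi (- (?t * (N - 1))) * Q powi (2 * ?t * (int n - 1)) *
      ((1 + Q ^ (b + t)) * br (?b + ?t) / br (2 * ?b - N)) * ?C"
  proof -
    have nz: "br (?b - ?t) \<noteq> 0" "br (2 * ?b) \<noteq> 0" "br (?b - N) \<noteq> 0" "br ?b \<noteq> 0"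
      using b_ne b by auto
    have alg: "- q * (p * A / B) * (C / D) * (- y * ((D / C) * (E / A) * ((B / G) * (z * c)))) =
        q * y * z * (p * E / G) * c" if "A \<noteq> 0" "B \<noteq> 0" "C \<noteq> 0" "D \<noteq> 0" for q p A B C D E G y z c :: 'a
      using that by simp
    show ?thesis unfolding F P f0 ft fjb by (rule alg[OF nz])
  qed
  also have "(1 + Q ^ (b + t)) * br (?b + ?t) = br (2 * (?b + ?t))"
  proof -
    have 1: "Q powi (?b + ?t) = Q ^ (b + t)" using power_int_of_nat[of Q "b + t"] by simp
    have "Q powi (2 * (?b + ?t)) = Q powi (?b + ?t) * Q powi (?b + ?t)"
      unfolding power_int_add[OF disjI1[OF Q_nonzero], symmetric] by (simp only: mult_2)
    note this[unfolded 1] 1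
    then show ?thesis by (simp add: br_def algebra_simps)
  qed
  \<comment> \<open>With N = 2 t and n = t - 1 the exponents t, - t (N - 1) and 2 t (n - 1) add up
    to - 2 t.\<close>
  also have "Q ^ t * Q powi (- (?t * (N - 1))) * Q powi (2 * ?t * (int n - 1)) = Q powi (- (2 * ?t))"
  proof -
    have e: "?t + - (?t * (N - 1)) + 2 * ?t * (int n - 1) = - (2 * ?t)"
      by (simp add: N(2) t_def algebra_simps)
    have "Q ^ t = Q powi ?t" by simp
    then show ?thesis by (simp only: power_int_add[OF disjI1[OF Q_nonzero], symmetric] e)
  qed
  also have "Q powi (- (2 * ?t)) * (br (2 * (?b + ?t)) / br (2 * ?b - N)) = sn (?b + ?t) / sn (?b - ?t)"
  proof -
    define c d where "c = Q powi (- (?b - ?t))" and "d = Q powi (- (2 * ?t))"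
    have "c \<noteq> 0" using Q_nonzero by (simp add: c_def)
    have dc: "Q powi (- (?b + ?t)) = d * c"
      unfolding c_def d_def power_int_add[OF disjI1[OF Q_nonzero], symmetric] by (simp add: algebra_simps)
    have "2 * (?b - ?t) = 2 * ?b - N" by (simp add: N(2))
    then show ?thesis unfolding sn_br dc c_def[symmetric] d_def[symmetric] using \<open>c \<noteq> 0\<close> by simp
  qed
  finally show ?thesis .
qed

text \<open>Modulo 2 (n + 1) the numbers \<open>w r\<close> are r + 1, distinct and strictly between
  0 and n + 1. So no \<open>w r\<close>, no sum and no difference of two of them vanishes.\<close>

lemma weyl_nonzero:
  assumes "\<And>r. r < n \<Longrightarrow> w r = 2 * int (Suc n) * \<phi> r + (int r + 1)"
  shows "weyl n w \<noteq> 0"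
proof -
  let ?N = "2 * int (Suc n)"
  have mod: "(?N * m + x) mod ?N = x" if "0 \<le> x" "x < ?N" for m x
    using mod_div_shift(1)[of ?N "?N * m + x" x m] that by simp
  have "sn (w r) \<noteq> 0" if "r < n" for r
  proof -
    have "w r mod ?N = int r + 1" unfolding assms[OF that] using that by (intro mod) auto
    then have "w r \<noteq> 0" by auto
    then show ?thesis using Q_nonzero by (simp add: sn_br)
  qed
  moreover have "cs (w r) - cs (w s) \<noteq> 0" if "r < n" "s < r" for r s
  proof -
    have m: "w x mod ?N = int x + 1" if "x < n" for x
      unfolding assms[OF that] by (rule mod) (use that in auto)
    have "w r + w s = ?N * (\<phi> r + \<phi> s) + (int r + int s + 2)" using that by (simp add: assms algebra_simps)
    then have "(w r + w s) mod ?N = int r + int s + 2" using that mod[of "int r + int s + 2" "\<phi> r + \<phi> s"] by simp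
    then have "w r + w s \<noteq> 0" by auto
    moreover have "w r \<noteq> w s" using m[of r] m[of s] that by auto
    ultimately show ?thesis using Q_nonzero by (simp add: cs_diff)
  qed
  ultimately show ?thesis unfolding weyl_def by (auto simp: prod_zero_iff)
qed

text \<open>Induction on the number of beads, removing the largest. It is the top bead of its
  runner, so its removal changes one charge by one unit, and the bead weight and the position
  account for the change of the Weyl denominator and of the energy.\<close>

lemma weight_bead_set:
  fixes n :: nat and \<phi> :: "nat \<Rightarrow> int"
  defines "W \<equiv> \<lambda>\<phi> r. 2 * int (Suc n) * \<phi> r + (int r + 1)" and "N \<equiv> 2 * int (Suc n)"
  shows "weight (1 / Q ^ Suc n) Q (bead_set N (charge n \<phi>)) * weyl n (\<lambda>r. int r + 1) = weyl n (W \<phi>) \<and>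
    \<Sum>(bead_set N (charge n \<phi>)) = energy n \<phi>"
proof (induction "card (bead_set N (charge n \<phi>))" arbitrary: \<phi>)
  case 0
  have N: "0 < N" by (simp add: N_def)
  have empty: "bead_set N (charge n \<phi>) = {}" using 0 finite_bead_set[OF N] by simp
  have "\<phi> r = 0" if r: "r < n" for r
  proof -
    have le: "charge n \<phi> j \<le> 0" if j: "j \<in> {1..<N}" for j
    proof (rule ccontr)
      assume "\<not> charge n \<phi> j \<le> 0"
      then have "nat j \<in> bead_set N (charge n \<phi>)" using j by (simp add: bead_set_def bead_def)
      with empty show False by simp
    qed
    have "\<phi> r \<le> 0" using le[of "int (Suc n) + int r + 1"] r by (simp add: charge_upper N_def del: of_nat_Suc)
    moreover have "- \<phi> r \<le> 0" using le[of "int (Suc n) - int r - 1"] r charge_lower[OF r, of \<phi>] by (simp add: N_def)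
    ultimately show ?thesis by simp
  qed
  then have "weyl n (W \<phi>) = weyl n (\<lambda>r. int r + 1)" "energy n \<phi> = 0"
    by (auto simp: W_def energy_def intro!: weyl_cong)
  then show ?case by (simp add: empty weight_def)
next
  case (Suc k)
  let ?S = "bead_set N (charge n \<phi>)" and ?t = "int (Suc n)"
  have N: "0 < N" "N = 2 * ?t" by (simp_all add: N_def)
  have fin: "finite ?S" by (rule finite_bead_set[OF N(1)])
  have ne: "?S \<noteq> {}" using Suc.hyps(2) by auto
  define b where "b = Max ?S"
  have bS: "b \<in> ?S" unfolding b_def by (rule Max_in[OF fin ne])
  have bmax: "c \<le> b" if "c \<in> ?S" for c unfolding b_def by (rule Max_ge[OF fin that])
  define jb where "jb = int b mod N"
  define q where "q = int b div N"
  have b_eq: "int b = jb + N * q" by (simp add: jb_def q_def)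
  have q: "0 \<le> q" using N(1) by (simp add: q_def pos_imp_zdiv_nonneg_iff)
  have jb: "0 \<le> jb" "jb < N" using N(1) by (simp_all add: jb_def)
  have qlt: "q < charge n \<phi> jb" using bS by (simp add: bead_set_def bead_def q_def jb_def)
  \<comment> \<open>A larger charge would place a bead at b + N, beyond the largest one.\<close>
  have qeq: "charge n \<phi> jb = q + 1"
  proof (rule ccontr)
    assume "charge n \<phi> jb \<noteq> q + 1"
    then have "q + 1 < charge n \<phi> jb" using qlt by simp
    moreover have "int (b + nat N) = jb + N * (q + 1)" using N(1) b_eq by (simp add: algebra_simps)
    moreover from mod_div_shift[OF N(1) this] have "int (b + nat N) mod N = jb" "int (b + nat N) div N = q + 1"
      using jb by simp_all
    ultimately have "b + nat N \<in> ?S" using bS by (simp add: bead_set_def bead_def)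
    from bmax[OF this] N(1) show False by simp
  qed
  have jb0: "jb \<noteq> 0" "jb \<noteq> ?t" using qlt q by (auto simp: charge_def)
  \<comment> \<open>Runners beyond t carry \<open>\<phi> r\<close> and runners before t carry
    \<open>- \<phi> r\<close>, so removing \<open>b\<close> lowers \<open>\<phi> r\<close> in the
    first case and raises it in the second. In both cases \<open>W\<close> at r moves from b + t to
    b - t, up to one common sign.\<close>
  obtain r a where r: "r < n" and jbr: "jb \<in> {?t + int r + 1, ?t - int r - 1}"
    and ch': "charge n (\<phi>(r := a)) jb = q" "charge n (\<phi>(r := a)) (N - jb) = - q"
      "\<And>j. j \<in> {0..<N} \<Longrightarrow> j \<noteq> jb \<Longrightarrow> j \<noteq> N - jb \<Longrightarrow> charge n (\<phi>(r := a)) j = charge n \<phi> j"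
    and w: "(W \<phi> r = int b + ?t \<and> W (\<phi>(r := a)) r = int b - ?t) \<or>
      (W \<phi> r = - (int b + ?t) \<and> W (\<phi>(r := a)) r = - (int b - ?t))"
    and en: "?t * (\<phi> r)\<^sup>2 + (int r + 1) * \<phi> r = int b + (?t * a\<^sup>2 + (int r + 1) * a)"
  proof (cases "?t < jb")
    case True
    define r where "r = nat (jb - ?t - 1)"
    have rj: "jb = ?t + int r + 1" using True by (simp add: r_def)
    have r: "r < n" using rj jb N(2) by simp
    have \<phi>r: "\<phi> r = q + 1" using qeq unfolding rj charge_upper .
    show ?thesis
    proof (rule that[of r q])
      show "charge n (\<phi>(r := q)) jb = q" unfolding rj charge_upper by simp
      have "N - jb = ?t - int r - 1" using rj N(2) by simp
      then show "charge n (\<phi>(r := q)) (N - jb) = - q" using charge_lower[OF r] by simp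
      show "charge n (\<phi>(r := q)) j = charge n \<phi> j" if "j \<in> {0..<N}" "j \<noteq> jb" "j \<noteq> N - jb" for j
        using that rj N(2) by (auto simp: charge_def)
      show "?t * (\<phi> r)\<^sup>2 + (int r + 1) * \<phi> r = int b + (?t * q\<^sup>2 + (int r + 1) * q)"
        unfolding b_eq rj \<phi>r N(2) by (simp add: algebra_simps power2_eq_square)
    qed (use r rj in \<open>auto simp: b_eq \<phi>r N(2) W_def algebra_simps\<close>)
  next
    case False
    then have "jb < ?t" using jb0 by simp
    define r where "r = nat (?t - jb - 1)"
    have rj: "jb = ?t - int r - 1" using \<open>jb < ?t\<close> by (simp add: r_def)
    have r: "r < n" using rj jb jb0 by simp
    have \<phi>r: "\<phi> r = - (q + 1)" using qeq unfolding rj charge_lower[OF r] by simp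
    show ?thesis
    proof (rule that[of r "- q"])
      show "charge n (\<phi>(r := - q)) jb = q" unfolding rj charge_lower[OF r] by simp
      have "N - jb = ?t + int r + 1" using rj N(2) by simp
      then show "charge n (\<phi>(r := - q)) (N - jb) = - q" using charge_upper by simp
      show "charge n (\<phi>(r := - q)) j = charge n \<phi> j" if "j \<in> {0..<N}" "j \<noteq> jb" "j \<noteq> N - jb" for j
        using that rj N(2) by (auto simp: charge_def)
      show "?t * (\<phi> r)\<^sup>2 + (int r + 1) * \<phi> r = int b + (?t * (- q)\<^sup>2 + (int r + 1) * (- q))"
        unfolding b_eq rj \<phi>r N(2) by (simp add: algebra_simps power2_eq_square)
    qed (use r rj in \<open>auto simp: b_eq \<phi>r N(2) W_def algebra_simps\<close>)
  qed
  define \<phi>' where "\<phi>' = \<phi>(r := a)"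
  let ?S' = "bead_set N (charge n \<phi>')"
  have chN: "charge n \<phi> (N - jb) = - (q + 1)"
    using odd_charge_charge[of n \<phi>] jb jb0 qeq by (auto simp: odd_charge_def N_def)
  have jbN: "jb \<noteq> N - jb" using jb0 N(2) by auto
  have S': "?S' = ?S - {b}"
  proof (rule Set.set_eqI)
    fix x
    define j where "j = int x mod N"
    have j: "j \<in> {0..<N}" using N(1) by (simp add: j_def)
    have x0: "0 \<le> int x div N" using N(1) by (simp add: pos_imp_zdiv_nonneg_iff)
    consider "j = jb" | "j = N - jb" | "j \<noteq> jb" "j \<noteq> N - jb" by blast
    then show "x \<in> ?S' \<longleftrightarrow> x \<in> ?S - {b}"
    proof cases
      case 1
      have "x = b \<longleftrightarrow> int x div N = q"
        using 1 unfolding j_def by (metis b_eq div_mult_mod_eq add.commute mult.commute of_nat_eq_iff q_def)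
      then show ?thesis using 1 qeq ch'(1) by (auto simp: bead_set_def bead_def j_def \<phi>'_def)
    next
      case 2
      then have "x \<noteq> b" using jbN by (auto simp: j_def jb_def)
      then show ?thesis using 2 chN ch'(2) q x0 by (auto simp: bead_set_def bead_def j_def \<phi>'_def)
    next
      case 3
      then have "x \<noteq> b" by (auto simp: j_def jb_def)
      then show ?thesis using 3 ch'(3)[OF j] by (auto simp: bead_set_def bead_def j_def \<phi>'_def)
    qed
  qed
  have Sins: "?S = insert b ?S'" using S' bS by auto
  have lessb: "c < b" if "c \<in> ?S'" for c using that S' bmax[of c] by auto
  have "k = card ?S'" using Suc.hyps(2) S' bS fin by simp
  from Suc.hyps(1)[OF this]
  have IH: "weight (1 / Q ^ Suc n) Q ?S' * weyl n (\<lambda>r. int r + 1) = weyl n (W \<phi>')" "\<Sum>?S' = energy n \<phi>'" by auto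
  have "weight (1 / Q ^ Suc n) Q ?S = bead_weight (1 / Q ^ Suc n) Q ?S' b * weight (1 / Q ^ Suc n) Q ?S'"
    unfolding Sins by (rule weight_insert) (use lessb finite_bead_set[OF N(1)] in auto)
  then have wS: "weight (1 / Q ^ Suc n) Q ?S * weyl n (\<lambda>r. int r + 1) = bead_weight (1 / Q ^ Suc n) Q ?S' b * weyl n (W \<phi>')"
    using IH(1) by (simp only: mult.assoc)
  let ?C = "\<lambda>x. \<Prod>s\<in>{..<n} - {r}. cs x - cs (W \<phi> s)"
  have bw: "bead_weight (1 / Q ^ Suc n) Q ?S' b = (sn (int b + ?t) * ?C (int b + ?t)) / (sn (int b - ?t) * ?C (int b - ?t))"
  proof -
    have b0: "0 < b" using bS by (simp add: bead_set_def)
    have "bead_weight (1 / Q ^ Suc n) Q ?S' b = sn (int b + ?t) / sn (int b - ?t) *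
      (\<Prod>s\<in>{..<n} - {r}. (cs (int b + ?t) - cs (W \<phi>' s)) / (cs (int b - ?t) - cs (W \<phi>' s)))"
      unfolding N_def W_def
      by (rule bead_weight_special[OF r b0])
         (use lessb ch'(1) jbr in \<open>auto simp: N_def \<phi>'_def q_def jb_def\<close>)
    also have "(\<Prod>s\<in>{..<n} - {r}. (cs (int b + ?t) - cs (W \<phi>' s)) / (cs (int b - ?t) - cs (W \<phi>' s))) =
      (\<Prod>s\<in>{..<n} - {r}. (cs (int b + ?t) - cs (W \<phi> s)) / (cs (int b - ?t) - cs (W \<phi> s)))"
      by (rule prod.cong) (auto simp: \<phi>'_def W_def)
    finally show ?thesis by (simp add: prod_dividef)
  qed
  have upd: "weyl n (W \<phi>) * (sn (W \<phi>' r) * ?C (W \<phi>' r)) = weyl n (W \<phi>') * (sn (W \<phi> r) * ?C (W \<phi> r))"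
  proof -
    have "weyl n (W \<phi>') = weyl n ((W \<phi>)(r := W \<phi>' r))"
      by (rule weyl_cong) (auto simp: W_def \<phi>'_def)
    then show ?thesis using weyl_update[OF r, of "W \<phi>" "W \<phi> r" "W \<phi>' r"] by simp
  qed
  \<comment> \<open>The common sign is harmless: \<open>cs\<close> is even, and the sign of the odd
    \<open>sn\<close> occurs on both sides.\<close>
  have upd': "weyl n (W \<phi>) * (sn (int b - ?t) * ?C (int b - ?t)) = weyl n (W \<phi>') * (sn (int b + ?t) * ?C (int b + ?t))"
    using w
  proof
    assume "W \<phi> r = - (int b + ?t) \<and> W (\<phi>(r := a)) r = - (int b - ?t)"
    then have "W \<phi> r = - (int b + ?t)" "W \<phi>' r = - (int b - ?t)" by (simp_all add: \<phi>'_def)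
    from upd[unfolded this sn_uminus cs_uminus] show ?thesis by simp
  qed (use upd in \<open>simp add: \<phi>'_def\<close>)
  \<comment> \<open>Up to sign the factors of this denominator are factors of the nonvanishing Weyl
    denominator for \<open>\<phi>'\<close>.\<close>
  have nz: "sn (int b - ?t) * ?C (int b - ?t) \<noteq> 0"
  proof -
    have "weyl n (W \<phi>') \<noteq> 0" by (rule weyl_nonzero[of n _ \<phi>']) (simp add: W_def)
    then have sn0: "sn (W \<phi>' r) \<noteq> 0" and cs0: "\<And>u v. u < n \<Longrightarrow> v < u \<Longrightarrow> cs (W \<phi>' u) \<noteq> cs (W \<phi>' v)"
      using r unfolding weyl_def by (auto simp: prod_zero_iff)
    have "cs (W \<phi>' r) - cs (W \<phi> s) \<noteq> 0" if "s \<in> {..<n} - {r}" for s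
    proof -
      have "W \<phi> s = W \<phi>' s" using that by (simp add: W_def \<phi>'_def)
      moreover have "cs (W \<phi>' r) \<noteq> cs (W \<phi>' s)"
        using that r cs0[of r s] cs0[of s r] by (cases "s < r") force+
      ultimately show ?thesis by simp
    qed
    then have "?C (W \<phi>' r) \<noteq> 0" by (simp add: prod_zero_iff)
    moreover have "W \<phi>' r = int b - ?t \<or> W \<phi>' r = - (int b - ?t)" using w by (auto simp: \<phi>'_def)
    then have "sn (int b - ?t) * ?C (int b - ?t) = sn (W \<phi>' r) * ?C (W \<phi>' r) \<or>
        sn (int b - ?t) * ?C (int b - ?t) = - (sn (W \<phi>' r) * ?C (W \<phi>' r))"
    proof
      assume e: "W \<phi>' r = - (int b - ?t)"
      show ?thesis unfolding e sn_uminus cs_uminus by simp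
    qed simp
    ultimately show ?thesis using sn0 by (metis mult_eq_0_iff neg_equal_0_iff_equal)
  qed
  have "weight (1 / Q ^ Suc n) Q ?S * weyl n (\<lambda>r. int r + 1) = weyl n (W \<phi>)"
    unfolding wS bw using nz upd' by (simp add: divide_eq_eq mult.commute)
  moreover have "\<Sum>?S = energy n \<phi>"
  proof -
    have "b \<notin> ?S'" using S' by simp
    then have "\<Sum>?S = b + energy n \<phi>'" unfolding Sins using IH(2) finite_bead_set[OF N(1)] by simp
    also have "\<dots> = energy n \<phi>"
    proof -
      let ?e = "\<lambda>\<phi> r. nat (?t * (\<phi> r)\<^sup>2 + (int r + 1) * \<phi> r)"
      have rest: "(\<Sum>s\<in>{..<n} - {r}. ?e \<phi>' s) = (\<Sum>s\<in>{..<n} - {r}. ?e \<phi> s)"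
        by (rule sum.cong) (auto simp: \<phi>'_def)
      have "0 \<le> ?t * a\<^sup>2 + (int r + 1) * a" by (rule square_plus_nonneg) (use r in auto)
      then have "?e \<phi> r = b + ?e \<phi>' r" using en by (simp add: \<phi>'_def nat_add_distrib)
      moreover have "energy n \<psi> = ?e \<psi> r + (\<Sum>s\<in>{..<n} - {r}. ?e \<psi> s)" for \<psi>
        unfolding energy_def using r by (subst sum.remove[of _ r]) auto
      ultimately show ?thesis using rest by simp
    qed
    finally show ?thesis .
  qed
  ultimately show ?case by blast
qed

lemma hook_factor_special_eq_0: "h = 2 * t \<Longrightarrow> hook_factor (1 / Q ^ t) Q h = 0"
  by (simp add: hook_factor_special)

text \<open>A nonzero weight excludes hooks of length N = 2 t. For the beads this means: a bead b >
  N forces one at b - N, the positions b and N - b are never both occupied, and t and N are excluded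
  by the single factors of \<open>bead_weight\<close>. These conditions describe a flush, odd
  configuration.\<close>

lemma weight_nonzero_imp_bead_set:
  assumes fin: "finite S" and S0: "0 \<notin> S" and nz: "weight (1 / Q ^ Suc n) Q S \<noteq> 0"
  shows "\<exists>\<phi> \<in> {..<n} \<rightarrow>\<^sub>E UNIV. S = bead_set (2 * int (Suc n)) (charge n \<phi>)"
proof -
  define t where "t = Suc n"
  let ?N = "2 * t"
  have tpos: "0 < t" by (simp add: t_def)
  have bw: "bead_weight (1 / Q ^ t) Q S b \<noteq> 0" if "b \<in> S" for b
    using nz that fin by (auto simp: weight_def t_def prod_zero_iff)
  \<comment> \<open>At position t the factor \<open>1 - U * Q ^ b\<close> vanishes, at position 2 t
    the factor \<open>1 - U^2 * Q ^ b\<close>.\<close>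
  have t_notin: "t \<notin> S" and N_notin: "?N \<notin> S"
  proof -
    have "1 - 1 / Q ^ t * Q ^ t = 0" "1 - (1 / Q ^ t)\<^sup>2 * Q ^ ?N = 0"
      using Q_nonzero by (simp_all add: power_divide mult.commute flip: power_mult)
    then have "bead_weight (1 / Q ^ t) Q S t = 0" "bead_weight (1 / Q ^ t) Q S ?N = 0"
      by (auto simp: bead_weight_def)
    then show "t \<notin> S" "?N \<notin> S" using bw by blast+
  qed
  have hook: "(if c \<in> S then b + c else b - c) \<noteq> ?N" if "b \<in> S" "1 \<le> c" "c < b" for b c
  proof
    assume "(if c \<in> S then b + c else b - c) = ?N"
    then have "hook_factor (1 / Q ^ t) Q (if c \<in> S then b + c else b - c) = 0" by (rule hook_factor_special_eq_0)
    then have "(\<Prod>c=1..<b. hook_factor (1 / Q ^ t) Q (if c \<in> S then b + c else b - c)) = 0"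
      using that by (intro prod_zero bexI[of _ c]) simp_all
    then show False using bw[OF that(1)] by (simp add: bead_weight_def)
  qed
  have down: "b - ?N \<in> S" if "b \<in> S" "?N < b" for b
  proof (rule ccontr)
    assume "b - ?N \<notin> S"
    moreover have "1 \<le> b - ?N" "b - ?N < b" "b - (b - ?N) = ?N" using that tpos by linarith+
    ultimately show False using hook[OF that(1), of "b - ?N"] by simp
  qed
  have mirror: "?N - b \<notin> S" if "b \<in> S" "b < ?N" for b
  proof
    assume *: "?N - b \<in> S"
    have "b \<noteq> t" "b \<noteq> 0" using t_notin S0 that by metis+
    then consider "t < b" | "b < t" "b \<noteq> 0" by linarith
    then show False
    proof cases
      case 1
      then have "1 \<le> ?N - b" "?N - b < b" "b + (?N - b) = ?N" using that by linarith+
      then show False using hook[OF that(1), of "?N - b"] * by simp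
    next
      case 2
      then have "1 \<le> b" "b < ?N - b" "(?N - b) + b = ?N" using that by linarith+
      then show False using hook[OF *, of b] that by simp
    qed
  qed
  define K where "K j = {k. j + ?N * k \<in> S}" for j
  define cnt where "cnt j = card (K j)" for j
  have K_down: "k \<in> K j" if "Suc k \<in> K j" "0 < j" for j k
  proof -
    have "j + ?N * Suc k - ?N \<in> S" by (rule down) (use that in \<open>auto simp: K_def\<close>)
    then show ?thesis by (simp add: K_def)
  qed
  have K_fin: "finite (K j)" for j
  proof (rule finite_imageD)
    show "finite ((\<lambda>k. j + ?N * k) ` K j)" by (rule finite_subset[OF _ fin]) (auto simp: K_def)
    show "inj_on (\<lambda>k. j + ?N * k) (K j)" using tpos by (auto simp: inj_on_def)
  qed
  have K_eq: "K j = {..<cnt j}" if j: "0 < j" for j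
  proof -
    have le: "k' \<in> K j" if "k' \<le> k" "k \<in> K j" for k k'
      using that by (induction k rule: dec_induct) (use K_down j in auto)
    have "\<exists>m. K j = {..<m}"
    proof (cases "K j = {}")
      case True
      then show ?thesis by (intro exI[of _ 0]) simp
    next
      case False
      have mk: "k \<in> K j \<longleftrightarrow> k \<le> Max (K j)" for k
        using le[OF _ Max_in[OF K_fin False], of k] Max_ge[OF K_fin, of k j] by blast
      have "K j = {..<Suc (Max (K j))}"
      proof (rule Set.set_eqI)
        fix x
        show "x \<in> K j \<longleftrightarrow> x \<in> {..<Suc (Max (K j))}"
          unfolding lessThan_iff less_Suc_eq_le by (rule mk)
      qed
      then show ?thesis by (rule exI)
    qed
    then obtain m where m: "K j = {..<m}" by (elim exE)
    have "cnt j = m" unfolding cnt_def m by simp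
    with m show ?thesis by simp
  qed
  have K_excl: "cnt (?N - j) = 0 \<or> cnt j = 0" if j: "0 < j" "j < ?N" for j
  proof (rule ccontr)
    assume "\<not> ?thesis"
    then have "0 \<in> K j" "0 \<in> K (?N - j)" using K_eq[of j] K_eq[of "?N - j"] j by auto
    then show False using mirror[of j] j by (auto simp: K_def)
  qed
  \<comment> \<open>A runner and its mirror image cannot both hold positive beads. The difference is
    therefore the number of positive beads on runner j, or minus the number of those on its mirror
    image.\<close>
  define c where "c j = int (cnt (nat j)) - int (cnt (nat (int ?N - j)))" for j
  have cneg: "c (int ?N - j) = - c j" for j by (simp add: c_def)
  have ct: "c (int t) = 0" by (simp add: c_def)
  define \<phi> where "\<phi> = (\<lambda>r\<in>{..<n}. c (int t + int r + 1))"
  have ch: "charge n \<phi> j = c j" if j: "0 < j" "j < int ?N" for j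
  proof -
    consider "j < int t" | "j = int t" | "int t < j" by linarith
    then show ?thesis
    proof cases
      case 1
      then have lt: "nat (int t - j - 1) < n" and e: "int t + int (nat (int t - j - 1)) + 1 = int ?N - j"
        using j by (auto simp: t_def)
      have "charge n \<phi> j = - \<phi> (nat (int t - j - 1))" using 1 j by (simp add: charge_def t_def)
      also have "\<phi> (nat (int t - j - 1)) = c (int t + int (nat (int t - j - 1)) + 1)" using lt by (simp add: \<phi>_def)
      finally show ?thesis unfolding e cneg by simp
    next
      case 2
      then show ?thesis using ct by (simp add: charge_def t_def)
    next
      case 3
      then have lt: "nat (j - int t - 1) < n" and e: "int t + int (nat (j - int t - 1)) + 1 = j"
        using j by (auto simp: t_def)
      have "charge n \<phi> j = \<phi> (nat (j - int t - 1))" using 3 j by (simp add: charge_def t_def)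
      also have "\<dots> = c (int t + int (nat (j - int t - 1)) + 1)" using lt by (simp add: \<phi>_def)
      finally show ?thesis unfolding e .
    qed
  qed
  have mult_notin: "?N * k \<notin> S" for k
  proof (induction k)
    case (Suc k)
    show ?case
    proof
      assume *: "?N * Suc k \<in> S"
      have "k \<noteq> 0"
      proof
        assume "k = 0"
        with * N_notin show False by simp
      qed
      then have "?N * Suc k - ?N \<in> S" using * tpos by (intro down) auto
      then show False using Suc by simp
    qed
  qed (use S0 in simp)
  have "S = bead_set (int ?N) (charge n \<phi>)"
  proof (rule Set.set_eqI)
    fix b
    define j k where "j = b mod ?N" and "k = b div ?N"
    have b: "b = j + ?N * k" by (simp add: j_def k_def)
    have jN: "j < ?N" by (simp add: j_def t_def)
    have mem: "b \<in> bead_set (int ?N) (charge n \<phi>) \<longleftrightarrow> 0 < b \<and> int k < charge n \<phi> (int j)"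
      by (simp add: bead_set_def bead_def j_def k_def zdiv_int zmod_int)
    show "b \<in> S \<longleftrightarrow> b \<in> bead_set (int ?N) (charge n \<phi>)"
    proof (cases "j = 0")
      case True
      then show ?thesis using mult_notin[of k] b mem by (simp add: charge_def)
    next
      case False
      have e: "nat (int ?N - int j) = ?N - j" by simp
      have "b \<in> S \<longleftrightarrow> k \<in> K j" by (simp add: K_def b)
      also have "\<dots> \<longleftrightarrow> k < cnt j" using K_eq[of j] False by simp
      also have "\<dots> \<longleftrightarrow> int k < c (int j)"
        using K_excl[of j] False jN unfolding c_def e nat_int by auto
      also have "\<dots> \<longleftrightarrow> b \<in> bead_set (int ?N) (charge n \<phi>)"
        unfolding mem using ch[of "int j"] False jN b by simp
      finally show ?thesis .
    qed
  qed
  then show ?thesis by (intro bexI[of _ \<phi>]) (auto simp: t_def \<phi>_def)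
qed

text \<open>Only positive positions are recorded, but a negative charge is visible as positive beads
  on the mirror runner. Two different charges thus disagree at a positive position of one of the two
  runners.\<close>

lemma bead_set_inj: "inj_on (\<lambda>\<phi>. bead_set (2 * int (Suc n)) (charge n \<phi>)) ({..<n} \<rightarrow>\<^sub>E UNIV)"
proof (rule inj_onI)
  let ?N = "2 * int (Suc n)" and ?t = "int (Suc n)"
  have not_less: False if r: "r < n" and eq: "bead_set ?N (charge n \<phi>) = bead_set ?N (charge n \<phi>')" and lt: "\<phi> r < \<phi>' r" for \<phi> \<phi>' r
  proof -
    have mem: "nat (j + ?N * k) \<in> bead_set ?N (charge n \<psi>) \<longleftrightarrow> k < charge n \<psi> j"
      if "0 < j" "j < ?N" "0 \<le> k" for j k \<psi>
    proof -
      have "0 < j + ?N * k" using that by (simp add: add_pos_nonneg)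
      moreover have "(j + ?N * k) mod ?N = j" "(j + ?N * k) div ?N = k"
        using mod_div_shift[of ?N "j + ?N * k" j k] that by simp_all
      ultimately show ?thesis by (simp add: bead_set_def bead_def)
    qed
    show False
    proof (cases "0 < \<phi>' r")
      case True
      define k where "k = max 0 (\<phi> r)"
      have "k < charge n \<phi>' (?t + int r + 1)" "\<not> k < charge n \<phi> (?t + int r + 1)"
        unfolding charge_upper using True lt by (auto simp: k_def)
      moreover have rng: "0 < ?t + int r + 1" "?t + int r + 1 < ?N" "0 \<le> k" using r by (auto simp: k_def)
      ultimately show False using mem[OF rng, of \<phi>] mem[OF rng, of \<phi>'] eq by blast
    next
      case False
      define k where "k = - \<phi>' r"
      have "k < charge n \<phi> (?t - int r - 1)" "\<not> k < charge n \<phi>' (?t - int r - 1)"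
        unfolding charge_lower[OF r] using False lt by (auto simp: k_def)
      moreover have rng: "0 < ?t - int r - 1" "?t - int r - 1 < ?N" "0 \<le> k" using r False by (auto simp: k_def)
      ultimately show False using mem[OF rng, of \<phi>] mem[OF rng, of \<phi>'] eq by blast
    qed
  qed
  fix \<phi> \<phi>' :: "nat \<Rightarrow> int"
  assume *: "\<phi> \<in> {..<n} \<rightarrow>\<^sub>E UNIV" "\<phi>' \<in> {..<n} \<rightarrow>\<^sub>E UNIV" "bead_set ?N (charge n \<phi>) = bead_set ?N (charge n \<phi>')"
  show "\<phi> = \<phi>'"
  proof (rule PiE_ext[OF *(1,2)])
    fix r assume "r \<in> {..<n}"
    then show "\<phi> r = \<phi>' r" using not_less[of r \<phi> \<phi>'] not_less[of r \<phi>' \<phi>] * by force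
  qed
qed

text \<open>Principal specialization: since \<open>(Q ^ Suc k) powi w = (Q powi w) ^ Suc k\<close>,
  every alternant in the expanded determinant is a Weyl denominator in the
  \<open>Q powi w r\<close>, that is, a weight times the Weyl denominator of charge 0. Sets that are
  not bead sets of a charge have weight 0.\<close>

lemma weight_series_special:
  "fps_const (weyl n (\<lambda>r. int r + 1)) * weight_series (1 / Q ^ Suc n) Q =
    det (mat n n (\<lambda>(k, r). theta (int n + 1) (int r + 1) (Q ^ Suc k)))"
proof -
  let ?P = "{..<n} \<rightarrow>\<^sub>E (UNIV :: int set)" and ?B = "\<lambda>\<phi>. bead_set (2 * int (Suc n)) (charge n \<phi>)"
  let ?W = "\<lambda>\<phi> r. 2 * int (Suc n) * \<phi> r + (int r + 1)"
  have det: "det (mat n n (\<lambda>(r, k). (Q ^ Suc k) powi ?W \<phi> r - (Q ^ Suc k) powi (- ?W \<phi> r))) = weyl n (?W \<phi>)" for \<phi>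
  proof -
    have p: "(Q ^ Suc k) powi w = (Q powi w) ^ Suc k" for k w
      by (metis mult.commute power_int_mult power_int_of_nat)
    have m: "Q powi (- w) = 1 / Q powi w" for w by (simp add: power_int_minus inverse_eq_divide)
    show ?thesis
      unfolding p m weyl_def sn_def cs_def by (rule det_weyl_C) (simp add: Q_nonzero)
  qed
  have mono: "(\<Prod>r<n. fps_X ^ nat (int (Suc n) * (\<phi> r)\<^sup>2 + (int r + 1) * \<phi> r)) * fps_const c = fps_X ^ energy n \<phi> * fps_const (c :: 'a)" for \<phi> c
    by (simp only: energy_def power_sum)
  have D: "det (mat n n (\<lambda>(k, r). theta (int n + 1) (int r + 1) (Q ^ Suc k))) =
      fsum ?P (\<lambda>\<phi>. fps_X ^ energy n \<phi> * fps_const (weyl n (?W \<phi>)))"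
    unfolding det_theta(2) det mono ..
  have sum: "\<Sum>(?B \<phi>) = energy n \<phi>" and wt: "weight (1 / Q ^ Suc n) Q (?B \<phi>) * weyl n (\<lambda>r. int r + 1) = weyl n (?W \<phi>)" for \<phi>
    using weight_bead_set[of n \<phi>] by auto
  have strict: "?B \<phi> \<in> strict_sets k \<longleftrightarrow> energy n \<phi> = k" for \<phi> k
  proof -
    have "finite (?B \<phi>)" by (rule finite_bead_set) simp
    moreover have "0 \<notin> ?B \<phi>" by (simp add: bead_set_def)
    ultimately show ?thesis unfolding strict_sets_def mem_Collect_eq sum by blast
  qed
  show ?thesis unfolding D
  proof (rule fps_ext)
    fix k
    let ?E = "{\<phi> \<in> ?P. energy n \<phi> = k}"
    have inj: "inj_on ?B ?E" using bead_set_inj by (rule inj_on_subset) auto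
    have sub: "?B ` ?E \<subseteq> strict_sets k" using strict by auto
    have finE: "finite ?E" by (rule finite_imageD[OF finite_subset[OF sub finite_strict_sets] inj])
    have "fps_nth (fps_const (weyl n (\<lambda>r. int r + 1)) * weight_series (1 / Q ^ Suc n) Q) k =
        (\<Sum>S\<in>strict_sets k. weyl n (\<lambda>r. int r + 1) * weight (1 / Q ^ Suc n) Q S)"
      by (simp add: weight_series_def sum_distrib_left)
    also have "\<dots> = (\<Sum>S\<in>?B ` ?E. weyl n (\<lambda>r. int r + 1) * weight (1 / Q ^ Suc n) Q S)"
    proof (rule sum.mono_neutral_right[OF finite_strict_sets sub], rule ballI)
      fix S assume S: "S \<in> strict_sets k - ?B ` ?E"
      have "weight (1 / Q ^ Suc n) Q S = 0"
      proof (rule ccontr)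
        assume "weight (1 / Q ^ Suc n) Q S \<noteq> 0"
        then obtain \<phi> where "\<phi> \<in> ?P" "S = ?B \<phi>"
          using weight_nonzero_imp_bead_set[of S n] S by (auto simp: strict_sets_def)
        then show False using S strict by auto
      qed
      then show "weyl n (\<lambda>r. int r + 1) * weight (1 / Q ^ Suc n) Q S = 0" by simp
    qed
    also have "\<dots> = (\<Sum>\<phi>\<in>?E. weyl n (\<lambda>r. int r + 1) * weight (1 / Q ^ Suc n) Q (?B \<phi>))"
      by (rule sum.reindex_cong[OF inj refl refl])
    also have "\<dots> = (\<Sum>\<phi>\<in>?E. fps_nth (fps_X ^ energy n \<phi> * fps_const (weyl n (?W \<phi>))) k)"
      by (rule sum.cong) (use wt in \<open>auto simp: mult.commute\<close>)
    also have "\<dots> = fps_nth (fsum ?P (\<lambda>\<phi>. fps_X ^ energy n \<phi> * fps_const (weyl n (?W \<phi>)))) k"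
      by (rule fsum_nth[symmetric]) (use finE in \<open>auto simp: fps_X_power_nth split: if_splits\<close>)
    finally show "fps_nth (fps_const (weyl n (\<lambda>r. int r + 1)) * weight_series (1 / Q ^ Suc n) Q) k =
        fps_nth (fsum ?P (\<lambda>\<phi>. fps_X ^ energy n \<phi> * fps_const (weyl n (?W \<phi>)))) k" .
  qed
qed

lemma weyl_rho_nonzero: "weyl n (\<lambda>r. int r + 1) \<noteq> 0"
  by (rule weyl_nonzero[of n _ "\<lambda>_. 0"]) simp

end

section \<open>Logarithmic derivatives\<close>

text \<open>\<open>s\<close> is T f' / f, written without division so that it also makes sense over
  coefficient rings that are not fields.\<close>

definition has_dlog :: "'a::comm_ring_1 fps \<Rightarrow> 'a fps \<Rightarrow> bool" where
  "has_dlog f s \<longleftrightarrow> fps_nth f 0 = 1 \<and> fps_X * fps_deriv f = s * f"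

lemma has_dlog_1: "has_dlog 1 0"
  by (simp add: has_dlog_def)

lemma has_dlog_mult: "has_dlog f s \<Longrightarrow> has_dlog g r \<Longrightarrow> has_dlog (f * g) (s + r)"
proof -
  assume *: "has_dlog f s" "has_dlog g r"
  have "fps_X * fps_deriv (f * g) = (fps_X * fps_deriv f) * g + f * (fps_X * fps_deriv g)"
    by (simp add: algebra_simps)
  also have "\<dots> = (s + r) * (f * g)" using * by (simp add: has_dlog_def algebra_simps)
  finally show ?thesis using * by (simp add: has_dlog_def)
qed

lemma has_dlog_prod: "(\<And>i. i \<in> A \<Longrightarrow> has_dlog (f i) (s i)) \<Longrightarrow> has_dlog (\<Prod>i\<in>A. f i) (\<Sum>i\<in>A. s i)"
  by (induction A rule: infinite_finite_induct) (auto simp: has_dlog_1 intro: has_dlog_mult)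

lemma has_dlog_power: "has_dlog f s \<Longrightarrow> has_dlog (f ^ n) (of_nat n * s)"
  by (induction n) (auto simp: has_dlog_1 distrib_right intro: has_dlog_mult)

lemma has_dlog_quotient:
  fixes f g h :: "'a::idom fps"
  assumes "h * g = f" "has_dlog f s" "has_dlog g r"
  shows "has_dlog h (s - r)"
proof -
  have g0: "fps_nth g 0 = 1" and f0: "fps_nth f 0 = 1" using assms by (auto simp: has_dlog_def)
  have "fps_nth (h * g) 0 = 1" using assms(1) f0 by simp
  then have h0: "fps_nth h 0 = 1" using g0 by simp
  have "g * (fps_X * fps_deriv h) + h * (fps_X * fps_deriv g) = fps_X * fps_deriv (h * g)"
    by (simp add: algebra_simps)
  also have "\<dots> = s * (h * g)" using assms by (simp add: has_dlog_def)
  also have "fps_X * fps_deriv g = r * g" using assms(3) by (simp add: has_dlog_def)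
  finally have "g * (fps_X * fps_deriv h) = s * (h * g) - h * (r * g)" by (simp only: eq_diff_eq)
  then have "g * (fps_X * fps_deriv h) = g * ((s - r) * h)" by (simp add: algebra_simps)
  moreover have "g \<noteq> 0" using g0 by auto
  ultimately have "fps_X * fps_deriv h = (s - r) * h" by simp
  with h0 show ?thesis by (simp add: has_dlog_def)
qed

text \<open>The geometric series of T d/dT log (1 - c T^m), that is, minus the sum over i > 0 of m
  c^i T^(m i).\<close>

definition lin_dlog :: "nat \<Rightarrow> 'a::comm_ring_1 \<Rightarrow> 'a fps" where
  "lin_dlog m c = Abs_fps (\<lambda>k. if 0 < k \<and> m dvd k then - (of_nat m * c ^ (k div m)) else 0)"

lemma has_dlog_lin:
  assumes m: "0 < m"
  shows "has_dlog (1 - fps_X ^ m * fps_const c) (lin_dlog m (c :: 'a::comm_ring_1))"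
proof -
  have d: "fps_X * fps_deriv (fps_X ^ m :: 'a fps) = fps_const (of_nat m) * fps_X ^ m"
  proof (rule fps_ext)
    fix k
    have "fps_nth (fps_X * fps_deriv g) k = of_nat k * fps_nth g k" for g :: "'a fps" by (cases k) simp_all
    then show "fps_nth (fps_X * fps_deriv (fps_X ^ m :: 'a fps)) k = fps_nth (fps_const (of_nat m) * fps_X ^ m) k"
      by (simp only: fps_mult_left_const_nth) (simp add: fps_X_power_nth)
  qed
  have "fps_X * fps_deriv (1 - fps_X ^ m * fps_const c) = - (fps_X * fps_deriv (fps_X ^ m)) * fps_const c"
    by (simp add: algebra_simps)
  also have "\<dots> = - (fps_X ^ m * fps_const (of_nat m * c))" unfolding d by (simp add: mult_ac flip: fps_const_mult)
  also have "\<dots> = lin_dlog m c * (1 - fps_X ^ m * fps_const c)"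
  proof (rule fps_ext)
    fix k
    have "lin_dlog m c * (1 - fps_X ^ m * fps_const c) = lin_dlog m c - fps_X ^ m * (fps_const c * lin_dlog m c)"
      by (simp add: algebra_simps)
    then have R: "fps_nth (lin_dlog m c * (1 - fps_X ^ m * fps_const c)) k =
        fps_nth (lin_dlog m c) k - (if k < m then 0 else c * fps_nth (lin_dlog m c) (k - m))"
      by (simp add: fps_X_power_mult_nth)
    have L: "fps_nth (- (fps_X ^ m * fps_const (of_nat m * c))) k = (if k = m then - (of_nat m * c) else 0)"
      by simp
    consider "k < m" | "k = m" | "m < k" by linarith
    then show "fps_nth (- (fps_X ^ m * fps_const (of_nat m * c))) k = fps_nth (lin_dlog m c * (1 - fps_X ^ m * fps_const c)) k"
    proof cases
      case 1
      then have "\<not> (0 < k \<and> m dvd k)" by (auto dest: dvd_imp_le)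
      then show ?thesis unfolding R L using 1 by (auto simp: lin_dlog_def)
    next
      case 2
      then show ?thesis unfolding R L using m by (simp add: lin_dlog_def)
    next
      case 3
      then have "m dvd k \<longleftrightarrow> m dvd k - m" by (simp add: dvd_minus_self)
      moreover have "k div m = Suc ((k - m) div m)" using 3 m by (simp add: le_div_geq)
      ultimately show ?thesis unfolding R L using 3 m by (simp add: lin_dlog_def)
    qed
  qed
  finally show ?thesis using m by (simp add: has_dlog_def)
qed

lemma has_dlog_iprod:
  fixes f :: "nat \<Rightarrow> 'a::comm_ring_1 fps"
  assumes f: "unital f" and d: "\<And>m. 1 \<le> m \<Longrightarrow> has_dlog (f m) (s m)"
    and z: "\<And>m k. 1 \<le> m \<Longrightarrow> k < m \<Longrightarrow> fps_nth (s m) k = 0"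
  shows "has_dlog (iprod f) (Abs_fps (\<lambda>k. \<Sum>m=1..k. fps_nth (s m) k))"
proof -
  have "fps_X * fps_deriv (iprod f) = Abs_fps (\<lambda>k. \<Sum>m=1..k. fps_nth (s m) k) * iprod f"
  proof (rule fps_ext)
    fix n
    let ?P = "\<Prod>m=1..n. f m"
    have P: "has_dlog ?P (\<Sum>m=1..n. s m)" by (rule has_dlog_prod) (use d in auto)
    have X: "fps_nth (fps_X * fps_deriv g) n = of_nat n * fps_nth g n" for g :: "'a fps"
      by (cases n) simp_all
    have "fps_nth (fps_X * fps_deriv (iprod f)) n = fps_nth (fps_X * fps_deriv ?P) n"
      unfolding X iprod_nth[OF f order_refl] ..
    also have "\<dots> = (\<Sum>i=0..n. fps_nth (\<Sum>m=1..n. s m) i * fps_nth ?P (n - i))"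
      using P by (simp add: has_dlog_def fps_mult_nth)
    also have "\<dots> = (\<Sum>i=0..n. (\<Sum>m=1..i. fps_nth (s m) i) * fps_nth (iprod f) (n - i))"
    proof (intro sum.cong refl arg_cong2[of _ _ _ _ "(*)"])
      fix i assume i: "i \<in> {0..n}"
      show "fps_nth (\<Sum>m=1..n. s m) i = (\<Sum>m=1..i. fps_nth (s m) i)"
        unfolding fps_sum_nth by (rule sum.mono_neutral_right) (use i z in auto)
      show "fps_nth ?P (n - i) = fps_nth (iprod f) (n - i)" by (rule iprod_nth[OF f]) simp
    qed
    also have "\<dots> = fps_nth (Abs_fps (\<lambda>k. \<Sum>m=1..k. fps_nth (s m) k) * iprod f) n" by (simp add: fps_mult_nth)
    finally show "fps_nth (fps_X * fps_deriv (iprod f)) n = fps_nth (Abs_fps (\<lambda>k. \<Sum>m=1..k. fps_nth (s m) k) * iprod f) n" .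
  qed
  then show ?thesis by (simp add: has_dlog_def)
qed

text \<open>The solution of T f' = s f with f(0) = 1, found coefficient by coefficient;
  characteristic 0 permits the division. Only the values of \<open>s\<close> at positive arguments
  enter.\<close>

fun exp_coeff :: "(nat \<Rightarrow> 'a::field_char_0) \<Rightarrow> nat \<Rightarrow> 'a" where
  "exp_coeff s 0 = 1"
| "exp_coeff s (Suc n) = (\<Sum>i\<le>n. s (Suc i) * exp_coeff s (n - i)) / of_nat (Suc n)"

lemma has_dlog_nth_Suc:
  assumes "has_dlog f s"
  shows "of_nat (Suc n) * fps_nth f (Suc n) = (\<Sum>i\<le>n. fps_nth s (Suc i) * fps_nth f (n - i))"
proof -
  have f0: "fps_nth f 0 = 1" and e: "fps_X * fps_deriv f = s * f" using assms by (auto simp: has_dlog_def)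
  have "fps_nth (fps_X * fps_deriv f) 0 = fps_nth (s * f) 0" unfolding e ..
  then have s0: "fps_nth s 0 = 0" using f0 by simp
  have "of_nat (Suc n) * fps_nth f (Suc n) = fps_nth (fps_X * fps_deriv f) (Suc n)" by simp
  also have "\<dots> = (\<Sum>i\<le>Suc n. fps_nth s i * fps_nth f (Suc n - i))" unfolding e by (simp add: fps_mult_nth atLeast0AtMost)
  also have "\<dots> = (\<Sum>i\<le>n. fps_nth s (Suc i) * fps_nth f (n - i))" by (subst sum.atMost_Suc_shift) (simp add: s0)
  finally show ?thesis .
qed

lemma has_dlog_imp_exp_coeff:
  fixes f :: "'a::field_char_0 fps"
  assumes "has_dlog f s"
  shows "fps_nth f n = exp_coeff (fps_nth s) n"
proof (induction n rule: less_induct)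
  case (less n)
  show ?case
  proof (cases n)
    case 0
    then show ?thesis using assms by (simp add: has_dlog_def)
  next
    case (Suc n')
    have "of_nat (Suc n') * fps_nth f n = (\<Sum>i\<le>n'. fps_nth s (Suc i) * exp_coeff (fps_nth s) (n' - i))"
      unfolding Suc has_dlog_nth_Suc[OF assms] by (rule sum.cong) (use less Suc in auto)
    then show ?thesis unfolding Suc by (simp add: field_simps del: of_nat_Suc)
  qed
qed

lemma exp_coeff_cong: "(\<And>k. 1 \<le> k \<Longrightarrow> k \<le> n \<Longrightarrow> s k = r k) \<Longrightarrow> exp_coeff s n = exp_coeff r n"
proof (induction n rule: less_induct)
  case (less n)
  then show ?case by (cases n) (auto intro!: sum.cong arg_cong2[of _ _ _ _ "(*)"] arg_cong2[of _ _ _ _ "(/)"])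
qed

section \<open>The product side\<close>

text \<open>The sum over \<open>r\<close> of the coefficients of \<open>T\<^sup>m\<close> in the linear part of the logarithm: a factor
  \<open>1 - c T\<^sup>m\<close> contributes \<open>- c\<close> in the numerator and \<open>c\<close> in the denominator.\<close>

definition prod_exponent :: "'a::field \<Rightarrow> 'a \<Rightarrow> 'a" where
  "prod_exponent U Q = (- (1 / U) + U * Q) / (1 - Q) +
     (1 + Q ^ 3 - Q / U\<^sup>2 - U\<^sup>2 * Q\<^sup>2) / ((1 - Q) * (1 - Q\<^sup>2)) - 1"

text \<open>Coefficient of T^k in the logarithmic derivative of the product. A factor with T^m
  contributes the j-th power of its coefficient, weighted by m, at T^(m j); so with m = k / j the
  linear exponent is taken at the j-th powers of U and Q.\<close>

definition prod_dlog :: "'a::field \<Rightarrow> 'a \<Rightarrow> nat \<Rightarrow> 'a" where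
  "prod_dlog U Q k = (\<Sum>j | 1 \<le> j \<and> j dvd k. of_nat (k div j) * prod_exponent (U ^ j) (Q ^ j))"

definition lin_prod :: "'a::field_char_0 \<Rightarrow> 'a fps" where
  "lin_prod c = iprod (\<lambda>m. 1 - fps_X ^ m * fps_const c)"

definition div_sum :: "'a::field_char_0 \<Rightarrow> 'a fps" where
  "div_sum c = Abs_fps (\<lambda>k. \<Sum>j | 1 \<le> j \<and> j dvd k \<and> 0 < k. - (of_nat (k div j) * c ^ j))"

lemma has_dlog_lin_prod: "has_dlog (lin_prod c) (div_sum c)"
proof -
  have "has_dlog (lin_prod c) (Abs_fps (\<lambda>k. \<Sum>m=1..k. fps_nth (lin_dlog m c) k))"
    unfolding lin_prod_def
  proof (rule has_dlog_iprod)
    show "unital (\<lambda>m. 1 - fps_X ^ m * fps_const c)" by (rule unital_lin)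
    show "has_dlog (1 - fps_X ^ m * fps_const c) (lin_dlog m c)" if "1 \<le> m" for m
      by (rule has_dlog_lin) (use that in simp)
    show "fps_nth (lin_dlog m c) k = 0" if "1 \<le> m" "k < m" for m k
      using that by (auto simp: lin_dlog_def dest: dvd_imp_le)
  qed
  also have "Abs_fps (\<lambda>k. \<Sum>m=1..k. fps_nth (lin_dlog m c) k) = div_sum c"
  proof (rule fps_ext)
    fix k
    show "fps_nth (Abs_fps (\<lambda>k. \<Sum>m=1..k. fps_nth (lin_dlog m c) k)) k = fps_nth (div_sum c) k"
    proof (cases "k = 0")
      case False
      have "(\<Sum>m=1..k. fps_nth (lin_dlog m c) k) = (\<Sum>m | 1 \<le> m \<and> m dvd k. - (of_nat m * c ^ (k div m)))"
        by (rule sum.mono_neutral_cong_right) (use False in \<open>auto simp: lin_dlog_def dest: dvd_imp_le\<close>)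
      also have "\<dots> = (\<Sum>j | 1 \<le> j \<and> j dvd k. - (of_nat (k div j) * c ^ j))"
        by (rule sum.reindex_bij_witness[of _ "\<lambda>j. k div j" "\<lambda>j. k div j"])
           (use False in \<open>auto elim!: dvdE simp: Suc_le_eq\<close>)
      finally show ?thesis using False by (simp add: div_sum_def)
    qed (simp add: div_sum_def)
  qed
  finally show ?thesis .
qed

lemma theta_prod_eq: "theta_prod z = lin_prod z * lin_prod (1 / z)"
  unfolding theta_prod_def lin_prod_def by (rule iprod_mult) (rule unital_lin)+

lemma euler_prod_eq: "euler_prod = lin_prod 1"
  by (simp add: euler_prod_def lin_prod_def)

lemma int_coeffs_euler_prod: "int_coeffs euler_prod"
  unfolding euler_prod_def by (rule int_coeffs_iprod) auto

text \<open>The character of the adjoint representation of type C_n at x_k = q^(k + 1): the rank,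
  the long roots and the short roots.\<close>

definition root_sum :: "nat \<Rightarrow> 'a::field \<Rightarrow> 'a" where
  "root_sum n q = of_nat n + (\<Sum>k<n. q ^ (2 * Suc k) + 1 / q ^ (2 * Suc k)) +
     (\<Sum>l<n. \<Sum>k<l. (q ^ Suc l * q ^ Suc k + 1 / (q ^ Suc l * q ^ Suc k)) + (q ^ Suc l / q ^ Suc k + q ^ Suc k / q ^ Suc l))"

text \<open>Induction on the rank. One more coordinate adds a zero weight, two long roots and short
  roots that sum to four geometric progressions; this matches the change of the rational function on
  the left.\<close>

lemma prod_exponent_special:
  fixes q :: "'a::field_char_0"
  assumes q: "q \<noteq> 0" "1 - q \<noteq> 0" "1 - q\<^sup>2 \<noteq> 0"
  shows "prod_exponent (1 / q ^ Suc n) q = - root_sum n q"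
proof (induction n)
  case 0
  have "prod_exponent (1 / q) q = 0"
  proof -
    have "prod_exponent (1 / q) q = (- q + 1) / (1 - q) + (1 + q ^ 3 - q * q\<^sup>2 - 1) / ((1 - q) * (1 - q\<^sup>2)) - 1"
      unfolding prod_exponent_def using q by (simp add: power_divide)
    also have "\<dots> = 0" using q by (simp add: power3_eq_cube power2_eq_square)
    finally show ?thesis .
  qed
  then show ?case by (simp add: root_sum_def)
next
  case (Suc n)
  \<comment> \<open>With names for the inverse and the denominators, the claim becomes a polynomial
    identity modulo \<open>y * z = 1\<close>, \<open>w * (1 - q) = 1\<close> and the relation
    between \<open>v\<close> and \<open>w\<close>.\<close>
  define y z w v where "y = q ^ Suc n" and "z = 1 / q ^ Suc n" and "w = 1 / (1 - q)"
    and "v = 1 / ((1 - q) * (1 - q\<^sup>2))"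
  have yz: "y * z = 1" using q by (simp add: y_def z_def)
  have w: "w * (1 - q) = 1" using q by (simp add: w_def)
  have v: "(1 - q\<^sup>2) * v = w" using q by (simp add: v_def w_def)
  have geo1: "(1 - q) * (\<Sum>k<m. q ^ Suc k) = q - q ^ Suc m" for m
  proof (induction m)
    case (Suc m)
    have "(1 - q) * (\<Sum>k<Suc m. q ^ Suc k) = (q - q ^ Suc m) + (1 - q) * q ^ Suc m"
      by (simp only: sum.lessThan_Suc distrib_left Suc)
    also have "\<dots> = q - q ^ Suc (Suc m)" by (simp add: algebra_simps)
    finally show ?case .
  qed simp
  have geo2: "(1 - q) * (\<Sum>k<m. 1 / q ^ Suc k) = 1 / q ^ m - 1" for m
  proof (induction m)
    case (Suc m)
    have "(1 - q) * (\<Sum>k<Suc m. 1 / q ^ Suc k) = (1 - q) * (\<Sum>k<m. 1 / q ^ Suc k) + (1 - q) * (1 / q ^ Suc m)"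
      by (simp only: sum.lessThan_Suc distrib_left)
    then show ?case unfolding Suc using q by (simp add: field_simps)
  qed simp
  have S1: "(\<Sum>k<n. q ^ Suc k) = (q - y) * w"
  proof -
    have "(\<Sum>k<n. q ^ Suc k) = (w * (1 - q)) * (\<Sum>k<n. q ^ Suc k)" using w by simp
    also have "\<dots> = w * (q - y)" using geo1[of n] by (simp only: mult.assoc y_def)
    finally show ?thesis by (simp add: mult.commute)
  qed
  have S2: "(\<Sum>k<n. 1 / q ^ Suc k) = (q * z - 1) * w"
  proof -
    have "(\<Sum>k<n. 1 / q ^ Suc k) = (w * (1 - q)) * (\<Sum>k<n. 1 / q ^ Suc k)" using w by simp
    also have "\<dots> = w * (1 / q ^ n - 1)" using geo2[of n] by (simp only: mult.assoc)
    also have "1 / q ^ n = q * z" using q by (simp add: z_def)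
    finally show ?thesis by (simp add: mult.commute)
  qed
  have A: "(\<Sum>k<n. q ^ Suc n * q ^ Suc k) = y * ((q - y) * w)"
    by (simp only: y_def[symmetric] sum_distrib_left[symmetric] S1)
  have B: "(\<Sum>k<n. 1 / (q ^ Suc n * q ^ Suc k)) = z * ((q * z - 1) * w)"
    unfolding S2[symmetric] sum_distrib_left by (rule sum.cong) (simp_all add: z_def)
  have C: "(\<Sum>k<n. q ^ Suc n / q ^ Suc k) = y * ((q * z - 1) * w)"
    unfolding S2[symmetric] sum_distrib_left by (rule sum.cong) (simp_all add: y_def)
  have D: "(\<Sum>k<n. q ^ Suc k / q ^ Suc n) = z * ((q - y) * w)"
    unfolding S1[symmetric] sum_distrib_left by (rule sum.cong) (simp_all add: z_def)
  have "root_sum (Suc n) q = root_sum n q + 1 + (q ^ (2 * Suc n) + 1 / q ^ (2 * Suc n)) +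
      (((\<Sum>k<n. q ^ Suc n * q ^ Suc k) + (\<Sum>k<n. 1 / (q ^ Suc n * q ^ Suc k))) +
       ((\<Sum>k<n. q ^ Suc n / q ^ Suc k) + (\<Sum>k<n. q ^ Suc k / q ^ Suc n)))"
    unfolding root_sum_def by (simp only: sum.lessThan_Suc sum.distrib of_nat_Suc) (simp only: algebra_simps)
  moreover have "q ^ (2 * Suc n) = y\<^sup>2" unfolding y_def by (metis mult.commute power_mult)
  moreover from this have "1 / q ^ (2 * Suc n) = z\<^sup>2" by (simp add: z_def y_def power_divide del: power_Suc)
  ultimately have rs: "root_sum (Suc n) q = root_sum n q + 1 + (y\<^sup>2 + z\<^sup>2) +
      ((y * ((q - y) * w) + z * ((q * z - 1) * w)) + (y * ((q * z - 1) * w) + z * ((q - y) * w)))"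
    unfolding A B C D by simp
  have pe: "prod_exponent (1 / x) q = (- x + q / x) * w + (1 + q ^ 3 - q * x\<^sup>2 - q\<^sup>2 / x\<^sup>2) * v - 1" for x
    unfolding prod_exponent_def w_def v_def by (simp add: power_divide)
  have qz12: "q / (q * y) = z" "q / y = q * z"
    using q by (simp_all add: y_def z_def)
  have qz34: "q\<^sup>2 / (q * y)\<^sup>2 = z\<^sup>2" "q\<^sup>2 / y\<^sup>2 = q\<^sup>2 * z\<^sup>2"
    by (simp_all only: power_divide[symmetric] qz12 power_mult_distrib[symmetric])
  note qz = qz12 qz34
  have "prod_exponent (1 / q ^ Suc (Suc n)) q =
      (- (q * y) + z) * w + (1 + q ^ 3 - q * (q * y)\<^sup>2 - z\<^sup>2) * v - 1"
    unfolding power_Suc[of q "Suc n"] y_def[symmetric] pe qz ..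
  also have "\<dots> = ((- y + q * z) * w + (1 + q ^ 3 - q * y\<^sup>2 - q\<^sup>2 * z\<^sup>2) * v - 1) +
      (y + z) * (w * (1 - q)) + (q * y\<^sup>2 - z\<^sup>2) * ((1 - q\<^sup>2) * v)"
    by (simp add: algebra_simps power2_eq_square power3_eq_cube)
  also have "(- y + q * z) * w + (1 + q ^ 3 - q * y\<^sup>2 - q\<^sup>2 * z\<^sup>2) * v - 1 = - root_sum n q"
    using Suc.IH unfolding y_def[symmetric] pe qz .
  also have "- root_sum n q + (y + z) * (w * (1 - q)) + (q * y\<^sup>2 - z\<^sup>2) * ((1 - q\<^sup>2) * v) = - root_sum (Suc n) q"
    unfolding v w rs
  proof -
    have "(q * y\<^sup>2 - z\<^sup>2) * w + (y + z) * 1 + 1 + (y\<^sup>2 + z\<^sup>2) +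
        ((y * ((q - y) * w) + z * ((q * z - 1) * w)) + (y * ((q * z - 1) * w) + z * ((q - y) * w))) = 0"
    proof -
      define E where "E = (y + z) * 1 + 1 + (y\<^sup>2 + z\<^sup>2)"
      have "(q * y\<^sup>2 - z\<^sup>2) * w + (y + z) * 1 + 1 + (y\<^sup>2 + z\<^sup>2) +
        ((y * ((q - y) * w) + z * ((q * z - 1) * w)) + (y * ((q * z - 1) * w) + z * ((q - y) * w))) =
        (q * y\<^sup>2 - z\<^sup>2) * w + (w * (1 - q)) * E +
        ((y * ((q - y) * w) + z * ((q * z - 1) * w)) + (y * ((q * z - 1) * w) + z * ((q - y) * w)))"
        unfolding w E_def by simp
      also have "\<dots> = w * ((1 - q) * (1 - y * z))"
        by (simp add: E_def algebra_simps power2_eq_square)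
      finally show ?thesis unfolding yz by simp
    qed
    then show "- root_sum n q + (y + z) * 1 + (q * y\<^sup>2 - z\<^sup>2) * w = - (root_sum n q + 1 + (y\<^sup>2 + z\<^sup>2) +
        ((y * ((q - y) * w) + z * ((q * z - 1) * w)) + (y * ((q * z - 1) * w) + z * ((q - y) * w))))"
      by (simp add: algebra_simps)
  qed
  finally show ?case .
qed

section \<open>The product side as a product over the affine roots of type C\<close>

definition prod_series :: "'a::field_char_0 \<Rightarrow> 'a \<Rightarrow> 'a fps" where
  "prod_series U Q = Abs_fps (exp_coeff (prod_dlog U Q))"

text \<open>One Euler product for each dimension of the Cartan subalgebra and one
  \<open>theta_prod\<close> for each pair of opposite roots: the product side of Macdonald's
  identity without its part of order T^0.\<close>

definition full_prod :: "nat \<Rightarrow> (nat \<Rightarrow> 'a::field_char_0) \<Rightarrow> 'a fps" where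
  "full_prod n x = euler_prod ^ n * (\<Prod>k<n. theta_prod ((x k)\<^sup>2)) *
     (\<Prod>l<n. \<Prod>k<l. theta_prod (x l * x k) * theta_prod (x l / x k))"

text \<open>Both logarithmic derivatives are divisor sums. On the left the j-th term is minus the
  adjoint character at the j-th power of Q, on the right it is \<open>prod_exponent\<close> there,
  and \<open>prod_exponent_special\<close> equates them.\<close>

lemma (in generic_q) full_prod_eq_prod_series: "full_prod n (\<lambda>k. Q ^ Suc k) = prod_series (1 / Q ^ Suc n) Q"
proof -
  let ?x = "\<lambda>k. Q ^ Suc k"
  define S where "S = of_nat n * div_sum (1 :: 'a) + (\<Sum>k<n. div_sum ((?x k)\<^sup>2) + div_sum (1 / (?x k)\<^sup>2)) +
    (\<Sum>l<n. \<Sum>k<l. (div_sum (?x l * ?x k) + div_sum (1 / (?x l * ?x k))) +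
      (div_sum (?x l / ?x k) + div_sum (1 / (?x l / ?x k))))"
  have dlog: "has_dlog (full_prod n ?x) S"
    unfolding full_prod_def S_def theta_prod_eq euler_prod_eq
    by (intro has_dlog_mult has_dlog_power has_dlog_prod has_dlog_lin_prod)
  have S_nth: "fps_nth S k = prod_dlog (1 / Q ^ Suc n) Q k" if k: "1 \<le> k" for k
  proof -
    let ?J = "{j. 1 \<le> j \<and> j dvd k}"
    define \<Lambda> where "\<Lambda> f = (\<Sum>j\<in>?J. of_nat (k div j) * (- f j))" for f :: "nat \<Rightarrow> 'a"
    have add: "\<Lambda> f + \<Lambda> g = \<Lambda> (\<lambda>j. f j + g j)" for f g
      by (simp add: \<Lambda>_def sum.distrib[symmetric] algebra_simps)
    have sum: "(\<Sum>i\<in>I. \<Lambda> (f i)) = \<Lambda> (\<lambda>j. \<Sum>i\<in>I. f i j)" for I :: "nat set" and f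
      unfolding \<Lambda>_def by (subst sum.swap) (simp add: sum_negf[symmetric] sum_distrib_left del: sum_negf)
    have ds: "fps_nth (div_sum c) k = \<Lambda> (\<lambda>j. c ^ j)" for c
      using k by (simp add: div_sum_def \<Lambda>_def)
    have n: "of_nat n * \<Lambda> (\<lambda>j. 1 ^ j) = \<Lambda> (\<lambda>j. of_nat n)"
      by (simp add: \<Lambda>_def sum_distrib_left mult_ac)
    have "fps_nth S k = \<Lambda> (\<lambda>j. of_nat n + (\<Sum>k<n. ((?x k)\<^sup>2) ^ j + (1 / (?x k)\<^sup>2) ^ j) +
       (\<Sum>l<n. \<Sum>k<l. ((?x l * ?x k) ^ j + (1 / (?x l * ?x k)) ^ j) + ((?x l / ?x k) ^ j + (1 / (?x l / ?x k)) ^ j)))"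
    proof -
      have "fps_nth (of_nat n * div_sum 1) k = of_nat n * fps_nth (div_sum (1 :: 'a)) k"
        by (simp flip: fps_of_nat)
      then show ?thesis unfolding S_def fps_add_nth fps_sum_nth ds by (simp only: n add sum)
    qed
    also have "\<dots> = \<Lambda> (\<lambda>j. root_sum n (Q ^ j))"
    proof -
      have p: "(Q ^ a) ^ j = (Q ^ j) ^ a" for a j by (metis mult.commute power_mult)
      have "((?x k)\<^sup>2) ^ j = (Q ^ j) ^ (2 * Suc k)" "(1 / (?x k)\<^sup>2) ^ j = 1 / (Q ^ j) ^ (2 * Suc k)"
        "(?x l * ?x k) ^ j = (Q ^ j) ^ Suc l * (Q ^ j) ^ Suc k"
        "(1 / (?x l * ?x k)) ^ j = 1 / ((Q ^ j) ^ Suc l * (Q ^ j) ^ Suc k)"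
        "(?x l / ?x k) ^ j = (Q ^ j) ^ Suc l / (Q ^ j) ^ Suc k"
        "(1 / (?x l / ?x k)) ^ j = (Q ^ j) ^ Suc k / (Q ^ j) ^ Suc l" for k l j
      proof -
        have "(?x k)\<^sup>2 = Q ^ (2 * Suc k)" by (metis mult.commute power_mult)
        then show "((?x k)\<^sup>2) ^ j = (Q ^ j) ^ (2 * Suc k)" "(1 / (?x k)\<^sup>2) ^ j = 1 / (Q ^ j) ^ (2 * Suc k)"
          by (simp_all only: power_divide power_one p)
        show "(?x l * ?x k) ^ j = (Q ^ j) ^ Suc l * (Q ^ j) ^ Suc k"
          "(1 / (?x l * ?x k)) ^ j = 1 / ((Q ^ j) ^ Suc l * (Q ^ j) ^ Suc k)"
          "(?x l / ?x k) ^ j = (Q ^ j) ^ Suc l / (Q ^ j) ^ Suc k"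
          by (simp_all only: power_divide power_one power_mult_distrib p)
        have "1 / (?x l / ?x k) = ?x k / ?x l" by simp
        then show "(1 / (?x l / ?x k)) ^ j = (Q ^ j) ^ Suc k / (Q ^ j) ^ Suc l"
          by (simp only: power_divide p)
      qed
      then show ?thesis unfolding root_sum_def by (simp only:)
    qed
    also have "\<dots> = prod_dlog (1 / Q ^ Suc n) Q k"
      unfolding \<Lambda>_def prod_dlog_def
    proof (rule sum.cong[OF refl])
      fix j assume j: "j \<in> ?J"
      have "Q ^ j \<noteq> 1" "(Q ^ j)\<^sup>2 \<noteq> 1" using j Q_power[of j] Q_power[of "j * 2"] by (auto simp: power_mult)
      then have "prod_exponent (1 / (Q ^ j) ^ Suc n) (Q ^ j) = - root_sum n (Q ^ j)"
        using Q_nonzero by (intro prod_exponent_special) auto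
      moreover have "(1 / Q ^ Suc n) ^ j = 1 / (Q ^ j) ^ Suc n"
        unfolding power_divide power_one by (metis mult.commute power_mult)
      ultimately show "of_nat (k div j) * (- root_sum n (Q ^ j)) = of_nat (k div j) * prod_exponent ((1 / Q ^ Suc n) ^ j) (Q ^ j)"
        by simp
    qed
    finally show ?thesis .
  qed
  show ?thesis
  proof (rule fps_ext)
    fix k
    have "exp_coeff (fps_nth S) k = exp_coeff (prod_dlog (1 / Q ^ Suc n) Q) k"
      by (rule exp_coeff_cong) (rule S_nth)
    then show "fps_nth (full_prod n ?x) k = fps_nth (prod_series (1 / Q ^ Suc n) Q) k"
      by (simp only: has_dlog_imp_exp_coeff[OF dlog] prod_series_def fps_nth_Abs_fps)
  qed
qed

text \<open>The two series agree up to a ratio of integral series in T and a constant.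
  \<open>D\<close> is the unknown change-of-basis determinant, \<open>G\<close> the surplus of Euler
  products, and \<open>\<kappa>\<close> gathers all factors free of T, including the Weyl
  denominator of charge 0.\<close>

lemma (in generic_q) weight_series_prod_series_special:
  "\<exists>D G \<kappa>. int_coeffs D \<and> int_coeffs G \<and> fps_nth G 0 = 1 \<and> \<kappa> \<noteq> 0 \<and>
    D * weight_series (1 / Q ^ Suc n) Q = fps_const \<kappa> * G * prod_series (1 / Q ^ Suc n) Q"
proof -
  let ?x = "\<lambda>k. Q ^ Suc k"
  define D where "D = (det (mat n n (\<lambda>(r, i). prod_seq (n - 1 - i) i (int r + 1))) :: 'a fps)"
  \<comment> \<open>The theta functions bring n^2 Euler products; n of them belong to
    \<open>full_prod\<close>, and the two for each pair of indices are collected here.\<close>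
  define G where "G = (euler_prod ^ (\<Sum>l<n. 2 * l) :: 'a fps)"
  define c1 where "c1 = (\<Prod>k<n. ?x k ^ Suc k)"
  define c0 where "c0 = (\<Prod>k<n. 1 - (?x k)\<^sup>2) * (\<Prod>l<n. \<Prod>k<l. (1 - ?x l * ?x k) * (1 - ?x l / ?x k))"
  let ?L = "weight_series (1 / Q ^ Suc n) Q" and ?w = "weyl n (\<lambda>r. int r + 1)"
  have x: "?x k \<noteq> 0" for k using Q_nonzero by simp
  have "fps_const ?w * ?L * D * fps_const c1 = (\<Prod>k<n. th ((?x k)\<^sup>2)) * (\<Prod>l<n. \<Prod>k<l. th (?x l * ?x k) * th (?x l / ?x k))"
    using macdonald_C[of ?x n, OF x] unfolding weight_series_special[symmetric] D_def c1_def fps_const_prod .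
  also have "\<dots> = fps_const c0 * G * full_prod n ?x"
  proof -
    have 1: "(\<Prod>k<n. th ((?x k)\<^sup>2)) = fps_const (\<Prod>k<n. 1 - (?x k)\<^sup>2) * (euler_prod ^ n * (\<Prod>k<n. theta_prod ((?x k)\<^sup>2)))"
    proof -
      have "(\<Prod>k<n. th ((?x k)\<^sup>2)) = (\<Prod>k<n. fps_const (1 - (?x k)\<^sup>2) * (euler_prod * theta_prod ((?x k)\<^sup>2)))"
        by (rule prod.cong) (use x in \<open>auto intro!: jacobi_triple_product\<close>)
      then show ?thesis by (simp only: prod.distrib prod_constant card_lessThan fps_const_prod)
    qed
    have 2: "(\<Prod>l<n. \<Prod>k<l. th (?x l * ?x k) * th (?x l / ?x k)) =
       fps_const (\<Prod>l<n. \<Prod>k<l. (1 - ?x l * ?x k) * (1 - ?x l / ?x k)) *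
       (G * (\<Prod>l<n. \<Prod>k<l. theta_prod (?x l * ?x k) * theta_prod (?x l / ?x k)))"
    proof -
      have "th (?x l * ?x k) * th (?x l / ?x k) = fps_const ((1 - ?x l * ?x k) * (1 - ?x l / ?x k)) *
          (euler_prod ^ 2 * (theta_prod (?x l * ?x k) * theta_prod (?x l / ?x k)))" for k l
      proof -
        have nz: "?x l * ?x k \<noteq> 0" "?x l / ?x k \<noteq> 0" using x by simp_all
        show ?thesis
          unfolding jacobi_triple_product[OF nz(1)] jacobi_triple_product[OF nz(2)] power2_eq_square fps_const_mult[symmetric]
          by (simp only: mult_ac)
      qed
      then show ?thesis
        by (simp only: prod.distrib prod_constant card_lessThan fps_const_prod fps_const_mult[symmetric]
            power_mult[symmetric] power_sum[symmetric] G_def)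
    qed
    show ?thesis unfolding 1 2 c0_def full_prod_def fps_const_mult[symmetric] by (simp only: mult_ac)
  qed
  finally have main: "fps_const ?w * ?L * D * fps_const c1 = fps_const c0 * G * prod_series (1 / Q ^ Suc n) Q"
    unfolding full_prod_eq_prod_series .
  have c1: "c1 \<noteq> 0" unfolding c1_def using x by (auto simp: prod_zero_iff)
  have c0: "c0 \<noteq> 0"
  proof -
    have "(?x k)\<^sup>2 \<noteq> 1" for k using Q_power[of "Suc k * 2"] by (simp only: power_mult) simp
    moreover have "?x l * ?x k \<noteq> 1" for k l using Q_power[of "Suc l + Suc k"] by (simp only: power_add) simp
    moreover have "?x l / ?x k \<noteq> 1" if "k < l" for k l
    proof -
      have "Q powi (int (Suc l)) \<noteq> Q powi (int (Suc k))" unfolding Q_powi_inj using that by simp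
      then have "?x l \<noteq> ?x k" by (simp only: power_int_of_nat) simp
      then show ?thesis using x by simp
    qed
    ultimately show ?thesis unfolding c0_def by (auto simp: prod_zero_iff simp del: power_Suc)
  qed
  have w: "?w \<noteq> 0" by (rule weyl_rho_nonzero)
  define \<kappa> where "\<kappa> = c0 / (?w * c1)"
  have "D * ?L = fps_const (1 / (?w * c1)) * (fps_const ?w * ?L * D * fps_const c1)"
  proof -
    have "fps_const (1 / (?w * c1)) * (fps_const ?w * fps_const c1) = 1" using w c1 by simp
    then show ?thesis by (metis (no_types, lifting) mult.assoc mult.commute mult_1)
  qed
  also have "\<dots> = fps_const \<kappa> * G * prod_series (1 / Q ^ Suc n) Q"
    unfolding main \<kappa>_def by (simp flip: mult.assoc)
  finally have "D * ?L = fps_const \<kappa> * G * prod_series (1 / Q ^ Suc n) Q" .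
  moreover have "int_coeffs D" unfolding D_def by (rule int_coeffs_det_prod_seq)
  moreover have "int_coeffs G" unfolding G_def by (intro int_coeffs_power int_coeffs_euler_prod)
  moreover have "fps_nth G 0 = 1" unfolding G_def euler_prod_def by (simp add: fps_power_zeroth)
  moreover have "\<kappa> \<noteq> 0" using c0 c1 w by (simp add: \<kappa>_def)
  ultimately show ?thesis by blast
qed

text \<open>In rank 0 the determinant and the root product are empty, so both series are 1.\<close>

lemma (in generic_q) weight_series_prod_series_1: "weight_series (1 / Q) Q = prod_series (1 / Q) Q"
  using weight_series_special[of 0] full_prod_eq_prod_series[of 0]
  by (simp add: weyl_def full_prod_def)

section \<open>Interpolation in \<open>u\<close>\<close>

definition laurent :: "('a::field \<Rightarrow> 'a) \<Rightarrow> bool" where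
  "laurent f \<longleftrightarrow> (\<exists>p M. \<forall>U. U \<noteq> 0 \<longrightarrow> f U * U ^ M = poly p U)"

lemma laurentI: "(\<And>U. U \<noteq> 0 \<Longrightarrow> f U * U ^ M = poly p U) \<Longrightarrow> laurent f"
  unfolding laurent_def by blast

lemma laurent_const: "laurent (\<lambda>U. c)"
  by (rule laurentI[of _ 0 "[:c:]"]) simp

lemma laurent_id: "laurent (\<lambda>U. U)"
  by (rule laurentI[of _ 0 "[:0, 1:]"]) simp

lemma laurent_inverse: "laurent (\<lambda>U. 1 / U)"
  by (rule laurentI[of _ 1 "[:1:]"]) simp

lemma laurent_add:
  assumes "laurent f" "laurent g"
  shows "laurent (\<lambda>U. f U + g U)"
proof -
  obtain p M q N where *: "\<And>U. U \<noteq> 0 \<Longrightarrow> f U * U ^ M = poly p U" "\<And>U. U \<noteq> 0 \<Longrightarrow> g U * U ^ N = poly q U"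
    using assms unfolding laurent_def by blast
  show ?thesis
  proof (rule laurentI[of _ "M + N" "p * monom 1 N + q * monom 1 M"])
    fix U :: 'a assume U: "U \<noteq> 0"
    have "(f U + g U) * U ^ (M + N) = (f U * U ^ M) * U ^ N + (g U * U ^ N) * U ^ M"
      by (simp add: algebra_simps power_add)
    then show "(f U + g U) * U ^ (M + N) = poly (p * monom 1 N + q * monom 1 M) U"
      unfolding *[OF U] by (simp add: poly_monom)
  qed
qed

lemma laurent_mult:
  assumes "laurent f" "laurent g"
  shows "laurent (\<lambda>U. f U * g U)"
proof -
  obtain p M q N where *: "\<And>U. U \<noteq> 0 \<Longrightarrow> f U * U ^ M = poly p U" "\<And>U. U \<noteq> 0 \<Longrightarrow> g U * U ^ N = poly q U"
    using assms unfolding laurent_def by blast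
  show ?thesis
  proof (rule laurentI[of _ "M + N" "p * q"])
    fix U :: 'a assume U: "U \<noteq> 0"
    have "(f U * g U) * U ^ (M + N) = (f U * U ^ M) * (g U * U ^ N)"
      by (simp add: algebra_simps power_add)
    then show "(f U * g U) * U ^ (M + N) = poly (p * q) U" unfolding *[OF U] by simp
  qed
qed

lemma laurent_uminus: "laurent f \<Longrightarrow> laurent (\<lambda>U. - f U)"
  using laurent_mult[OF laurent_const[of "- 1"]] by simp

lemma laurent_diff: "laurent f \<Longrightarrow> laurent g \<Longrightarrow> laurent (\<lambda>U. f U - g U)"
  using laurent_add[OF _ laurent_uminus, of f g] by simp

lemma laurent_divide_const: "laurent f \<Longrightarrow> laurent (\<lambda>U. f U / c)"
  using laurent_mult[OF _ laurent_const[of "1 / c"], of f] by simp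

lemma laurent_sum: "(\<And>i. i \<in> A \<Longrightarrow> laurent (f i)) \<Longrightarrow> laurent (\<lambda>U. \<Sum>i\<in>A. f i U)"
  by (induction A rule: infinite_finite_induct) (auto intro: laurent_const laurent_add)

lemma laurent_prod: "(\<And>i. i \<in> A \<Longrightarrow> laurent (f i)) \<Longrightarrow> laurent (\<lambda>U. \<Prod>i\<in>A. f i U)"
  by (induction A rule: infinite_finite_induct) (auto intro: laurent_const laurent_mult)

lemma laurent_power: "laurent f \<Longrightarrow> laurent (\<lambda>U. f U ^ n)"
  by (induction n) (auto intro: laurent_const laurent_mult)

lemma laurent_const_divide_power: "laurent (\<lambda>U. c / U ^ n)"
  using laurent_mult[OF laurent_const[of c] laurent_power[OF laurent_inverse, of n]] by (simp add: power_divide)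

lemma laurent_const_divide: "laurent (\<lambda>U. c / U)"
  using laurent_const_divide_power[of c 1] by simp

lemmas laurent_intros = laurent_const laurent_id laurent_inverse laurent_add laurent_mult laurent_uminus
  laurent_diff laurent_divide_const laurent_sum laurent_prod laurent_power laurent_const_divide_power laurent_const_divide

section \<open>Both sides as Laurent polynomials in u, and their rigidity\<close>

lemma laurent_weight: "laurent (\<lambda>U. weight U Q S)"
  unfolding weight_def bead_weight_def hook_factor_def by (intro laurent_intros)

lemma laurent_prod_dlog: "laurent (\<lambda>U. prod_dlog U Q k)"
proof -
  have "(U ^ j)\<^sup>2 = U ^ (j * 2)" for U :: 'a and j by (simp add: power_mult)
  then show ?thesis unfolding prod_dlog_def prod_exponent_def by (simp only:) (intro laurent_intros)
qed

lemma laurent_exp_coeff: "(\<And>k. laurent (\<lambda>U. s U k)) \<Longrightarrow> laurent (\<lambda>U. exp_coeff (s U) n)"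
proof (induction n rule: less_induct)
  case (less n)
  show ?case
  proof (cases n)
    case 0
    then show ?thesis by (simp add: laurent_const)
  next
    case (Suc n')
    show ?thesis unfolding Suc exp_coeff.simps
      by (intro laurent_divide_const laurent_sum laurent_mult less) (use Suc in auto)
  qed
qed

text \<open>As t grows, the argument X^(2 t) becomes small and low coefficients only see the
  constant term of \<open>g\<close>. For m > 0 the right side has order at least 2 t, so this term
  is 0 and one power of the argument cancels; for m = 0 it determines the number
  \<open>c t\<close>.\<close>

lemma eventually_constant:
  fixes g :: "'a::field fps poly" and c :: "nat \<Rightarrow> 'a"
  assumes "\<And>t. 1 \<le> t \<Longrightarrow> poly g ((fps_X\<^sup>2) ^ t) = fps_X ^ e * fps_const (c t) * (fps_X\<^sup>2) ^ (t * m)"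
  shows "\<exists>T c0. \<forall>t\<ge>T. c t = c0"
  using assms
proof (induction m arbitrary: g)
  case 0
  obtain g0 g' where g: "g = pCons g0 g'" by (cases g)
  have "c t = fps_nth g0 e" if t: "t \<ge> Suc e" for t
  proof -
    have "fps_nth (poly g ((fps_X\<^sup>2) ^ t)) e = c t" using 0[of t] t by (simp add: fps_X_power_mult_nth)
    moreover have "fps_nth (poly g ((fps_X\<^sup>2) ^ t)) e = fps_nth g0 e"
      using t unfolding g by (simp add: fps_X_power_mult_nth flip: power_mult)
    ultimately show ?thesis by simp
  qed
  then show ?case by blast
next
  case (Suc m)
  obtain g0 g' where g: "g = pCons g0 g'" by (cases g)
  have "g0 = 0"
  proof (rule fps_ext)
    fix i
    let ?t = "Suc i"
    have "fps_nth (poly g ((fps_X\<^sup>2) ^ ?t)) i = 0"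
    proof -
      define Y where "Y = fps_X ^ e * fps_const (c ?t) * (fps_X\<^sup>2) ^ (?t * m)"
      have "fps_X ^ e * fps_const (c ?t) * (fps_X\<^sup>2) ^ (?t * Suc m) = fps_X ^ (2 * ?t) * Y"
        unfolding Y_def power_mult[of fps_X 2 ?t] by (simp only: mult_Suc_right power_add mult_ac)
      moreover have "fps_nth (fps_X ^ (2 * ?t) * Y) i = 0" by (simp only: fps_X_power_mult_nth) simp
      ultimately show ?thesis using Suc.prems[of ?t] by simp
    qed
    moreover have "fps_nth (poly g ((fps_X\<^sup>2) ^ ?t)) i = fps_nth g0 i"
      unfolding g by (simp add: fps_X_power_mult_nth del: power_Suc flip: power_mult)
    ultimately show "fps_nth g0 i = fps_nth 0 i" by simp
  qed
  have "poly g' ((fps_X\<^sup>2) ^ t) = fps_X ^ e * fps_const (c t) * (fps_X\<^sup>2) ^ (t * m)" if t: "1 \<le> t" for t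
  proof -
    have "(fps_X\<^sup>2) ^ t * poly g' ((fps_X\<^sup>2) ^ t) = (fps_X\<^sup>2) ^ t * (fps_X ^ e * fps_const (c t) * (fps_X\<^sup>2) ^ (t * m))"
      using Suc.prems[OF t] unfolding g \<open>g0 = 0\<close> by (simp add: power_add mult_ac)
    then show ?thesis by simp
  qed
  then show ?case by (rule Suc.IH)
qed

lemma fls_clear_denominator: "\<exists>e b. fls_X ^ e * (a :: 'a::comm_ring_1 fls) = fps_to_fls b"
proof -
  define e where "e = nat (- fls_subdegree a)"
  have "0 \<le> fls_subdegree (fls_X ^ e * a)"
    by (rule fls_subdegree_ge0I) (auto simp: e_def fls_X_power_times_conv_shift)
  then have "fls_X ^ e * a = fps_to_fls (fls_regpart (fls_X ^ e * a))" by simp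
  then show ?thesis by blast
qed

lemma fls_poly_clear_denominators:
  fixes h :: "'a::field fls poly"
  shows "\<exists>e g. \<forall>y. fls_X ^ e * poly h (fps_to_fls y) = fps_to_fls (poly g y)"
proof (induction h)
  case 0
  show ?case by (intro exI[of _ 0]) simp
next
  case (pCons a h)
  obtain e2 g2 where h: "\<And>y. fls_X ^ e2 * poly h (fps_to_fls y) = fps_to_fls (poly g2 y)" using pCons.IH by blast
  obtain e1 b where a: "fls_X ^ e1 * a = fps_to_fls b" using fls_clear_denominator by blast
  have X: "fls_X ^ n = fps_to_fls (fps_X ^ n :: 'a fps)" for n by (simp add: fps_to_fls_power)
  have "fls_X ^ (e1 + e2) * poly (pCons a h) (fps_to_fls y) = fps_to_fls (poly (pCons (fps_X ^ e2 * b) (Polynomial.smult (fps_X ^ e1) g2)) y)" for y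
  proof -
    have "fls_X ^ (e1 + e2) * poly (pCons a h) (fps_to_fls y) =
        fls_X ^ e2 * (fls_X ^ e1 * a) + fps_to_fls y * (fls_X ^ e1 * (fls_X ^ e2 * poly h (fps_to_fls y)))"
      by (simp add: algebra_simps power_add)
    then show ?thesis unfolding a h unfolding X by (simp add: fls_times_fps_to_fls)
  qed
  then show ?case by blast
qed

lemma generic_q_fls: "generic_q ((fls_X :: 'a::field_char_0 fls)\<^sup>2)"
proof
  show "(fls_X :: 'a fls)\<^sup>2 \<noteq> 0" by simp
  fix m :: nat assume m: "0 < m"
  have "fls_nth ((fls_X :: 'a fls) ^ (2 * m)) 0 = 0" using m by simp
  then show "((fls_X :: 'a fls)\<^sup>2) ^ m \<noteq> 1" by (metis fls_one_nth power_mult zero_neq_one)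
qed

text \<open>The constants \<open>c t\<close> may a priori vary with t. Comparing q-adic orders makes
  them eventually constant, and then infinitely many values agree with a single constant, which
  determines a Laurent polynomial.\<close>

lemma laurent_constant:
  fixes f :: "'a::field_char_0 fls \<Rightarrow> 'a fls"
  assumes f: "laurent f" and c: "\<And>t. 1 \<le> t \<Longrightarrow> f (1 / (fls_X\<^sup>2) ^ t) = fls_const (c t)"
  shows "\<exists>c0. \<forall>U. U \<noteq> 0 \<longrightarrow> f U = c0"
proof -
  interpret generic_q "(fls_X :: 'a fls)\<^sup>2" by (rule generic_q_fls)
  let ?Q = "(fls_X :: 'a fls)\<^sup>2"
  obtain p M where p: "\<And>U. U \<noteq> 0 \<Longrightarrow> f U * U ^ M = poly p U" using f unfolding laurent_def by blast
  \<comment> \<open>Reversing \<open>p\<close> replaces the points 1 / Q^t, of negative order in q,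
    by Q^t, of positive order. The factor of degree M compensates the power of U in the definition
    of \<open>laurent\<close>.\<close>
  define d h where "d = degree p" and "h = monom 1 M * reflect_poly p"
  obtain e g where g: "\<And>y. fls_X ^ e * poly h (fps_to_fls y) = fps_to_fls (poly g y)"
    using fls_poly_clear_denominators by blast
  have "poly g ((fps_X\<^sup>2) ^ t) = fps_X ^ e * fps_const (c t) * (fps_X\<^sup>2) ^ (t * d)" if t: "1 \<le> t" for t
  proof -
    have Q: "fps_to_fls ((fps_X\<^sup>2) ^ n) = ?Q ^ n" for n by (simp add: fps_to_fls_power)
    have nz: "?Q ^ t \<noteq> 0" by simp
    have "poly h (?Q ^ t) = (?Q ^ t) ^ M * ((?Q ^ t) ^ d * poly p (1 / ?Q ^ t))"
      unfolding h_def d_def by (simp only: poly_mult poly_monom poly_reflect_poly_nz[OF nz] inverse_eq_divide) simp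
    also have "poly p (1 / ?Q ^ t) = fls_const (c t) * (1 / ?Q ^ t) ^ M" using p[of "1 / ?Q ^ t"] c[OF t] nz by simp
    also have "(?Q ^ t) ^ M * ((?Q ^ t) ^ d * (fls_const (c t) * (1 / ?Q ^ t) ^ M)) = fls_const (c t) * (?Q ^ t) ^ d"
    proof -
      have "(?Q ^ t) ^ M * (1 / ?Q ^ t) ^ M = 1" using nz by (simp add: power_divide)
      moreover have "a * (b * (x * y)) = (a * y) * (x * b)" for a b x y :: "'a fls" by (simp only: mult_ac)
      ultimately show ?thesis by (simp only: mult_1)
    qed
    finally have "fps_to_fls (poly g ((fps_X\<^sup>2) ^ t)) = fls_X ^ e * (fls_const (c t) * (?Q ^ t) ^ d)"
      using g[of "(fps_X\<^sup>2) ^ t"] unfolding Q by simp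
    also have "\<dots> = fps_to_fls (fps_X ^ e * fps_const (c t) * (fps_X\<^sup>2) ^ (t * d))"
      by (simp add: fls_times_fps_to_fls fps_to_fls_power power_mult mult.assoc)
    finally show ?thesis by (simp only: fps_to_fls_eq_iff)
  qed
  then obtain T c0 where T: "\<And>t. t \<ge> T \<Longrightarrow> c t = c0" using eventually_constant[of g e c d] by blast
  \<comment> \<open>Every 1 / Q^t with large t is a root of \<open>r\<close>, and these points are
    pairwise distinct.\<close>
  define r where "r = p - Polynomial.smult (fls_const c0) (monom 1 M)"
  have "r = 0"
  proof (rule ccontr)
    assume "r \<noteq> 0"
    then have fin: "finite {x. poly r x = 0}" by (rule poly_roots_finite)
    have sub: "(\<lambda>t. 1 / ?Q ^ t) ` {Suc T..} \<subseteq> {x. poly r x = 0}"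
    proof (rule image_subsetI)
      fix t assume t: "t \<in> {Suc T..}"
      have "f (1 / ?Q ^ t) = fls_const c0" using c[of t] T[of t] t by simp
      then show "1 / ?Q ^ t \<in> {x. poly r x = 0}" using p[of "1 / ?Q ^ t"] by (simp add: r_def poly_monom)
    qed
    have inj: "inj_on (\<lambda>t. 1 / ?Q ^ t) {Suc T..}"
    proof (rule inj_onI)
      fix s t assume "1 / ?Q ^ s = 1 / ?Q ^ t"
      then have "?Q powi int s = ?Q powi int t" by simp
      then show "s = t" by (simp only: Q_powi_inj of_nat_eq_iff)
    qed
    have "finite {Suc T..}" by (rule finite_imageD[OF finite_subset[OF sub fin] inj])
    then show False using infinite_Ici by blast
  qed
  then have "poly p U = fls_const c0 * U ^ M" for U unfolding r_def by (simp add: poly_monom)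
  then have "f U = fls_const c0" if "U \<noteq> 0" for U using p[OF that] that by simp
  then show ?thesis by blast
qed

lemma strict_sets_0: "strict_sets 0 = {{}}"
  by (auto simp: strict_sets_def)

theorem weight_series_eq_prod_series:
  fixes U :: "'a::field_char_0 fls"
  assumes "U \<noteq> 0"
  shows "weight_series U (fls_X\<^sup>2) = prod_series U (fls_X\<^sup>2)"
proof -
  let ?Q = "(fls_X :: 'a fls)\<^sup>2"
  interpret generic_q ?Q by (rule generic_q_fls)
  have "\<forall>U. U \<noteq> 0 \<longrightarrow> fps_nth (weight_series U ?Q) n = fps_nth (prod_series U ?Q) n" for n
  proof (induction n rule: less_induct)
    case (less n)
    have ws0: "fps_nth (weight_series U ?Q) 0 = 1" and ps0: "fps_nth (prod_series U ?Q) 0 = 1" for U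
      by (simp_all add: weight_series_def strict_sets_0 weight_def prod_series_def)
    show ?case
    proof (cases "n = 0")
      case True
      then show ?thesis by (simp add: ws0 ps0)
    next
      case False
      define f where "f U = fps_nth (weight_series U ?Q) n - fps_nth (prod_series U ?Q) n" for U
      have lf: "laurent f"
        unfolding f_def weight_series_def prod_series_def fps_nth_Abs_fps
        by (intro laurent_diff laurent_sum laurent_weight laurent_exp_coeff laurent_prod_dlog)
      have "\<exists>c. f (1 / ?Q ^ t) = fls_const c" if t: "1 \<le> t" for t
      proof -
        obtain m where m: "t = Suc m" using t by (cases t) auto
        let ?U = "1 / ?Q ^ Suc m"
        define L R where "L = weight_series ?U ?Q" and "R = prod_series ?U ?Q"
        obtain D G \<kappa> where D: "int_coeffs D" and G: "int_coeffs G" "fps_nth G 0 = 1" and \<kappa>: "\<kappa> \<noteq> 0"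
          and eq: "D * L = fps_const \<kappa> * G * R"
          using weight_series_prod_series_special[of m] unfolding L_def R_def by blast
        \<comment> \<open>\<open>E\<close> measures how far the unknown factor is from the expected
          one. Since L and R agree below T^n and start with 1, \<open>E\<close> is divisible by T^n,
          and its coefficient there determines that of L - R.\<close>
        define E where "E = D - fps_const \<kappa> * G"
        have L0: "fps_nth L 0 = 1" "fps_nth R 0 = 1" by (simp_all add: L_def R_def ws0 ps0)
        have "fps_nth (D * L) 0 = fps_nth (fps_const \<kappa> * G * R) 0" by (simp only: eq)
        then have D0: "fps_nth D 0 = \<kappa>" using L0 G by simp
        have main: "E * L + fps_const \<kappa> * G * (L - R) = 0" using eq by (simp add: E_def algebra_simps)
        have "fps_X ^ n dvd L - R"
          unfolding X_power_dvd_iff L_def R_def using less by simp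
        then obtain \<Delta> where \<Delta>: "L - R = fps_X ^ n * \<Delta>" by (rule dvdE)
        have E: "E = fps_X ^ n * (- (fps_const \<kappa> * G * \<Delta> * inverse L))"
        proof -
          have "L * inverse L = 1" using L0 by (simp add: inverse_mult_eq_1')
          then have "E = E * L * inverse L" by (simp add: mult.assoc)
          also have "E * L = - (fps_const \<kappa> * G * (fps_X ^ n * \<Delta>))" using main unfolding \<Delta> by (simp add: eq_neg_iff_add_eq_0)
          finally show ?thesis by (simp add: mult_ac)
        qed
        have fn: "f ?U = fps_nth \<Delta> 0"
        proof -
          have "f ?U = fps_nth (L - R) n" by (simp add: f_def L_def R_def)
          then show ?thesis unfolding \<Delta> by (simp add: fps_X_power_mult_nth)
        qed
        have "fps_nth E n = - (\<kappa> * fps_nth \<Delta> 0)"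
          using arg_cong[OF E, of "\<lambda>x. fps_nth x n"] G(2) L0 by (simp add: fps_X_power_mult_nth)
        then have "f ?U = - fps_nth E n / \<kappa>" unfolding fn using \<kappa> by simp
        also have "\<dots> = - (fps_nth D n - \<kappa> * fps_nth G n) / \<kappa>" by (simp add: E_def)
        finally have fU: "f ?U = (\<kappa> * fps_nth G n - fps_nth D n) / \<kappa>" by simp
        \<comment> \<open>A priori \<open>\<kappa>\<close> is an expression in Q, but as the
          constant term of \<open>D\<close> it is an integer. Hence the discrepancy is a quotient of
          integers and free of q.\<close>
        have "\<kappa> \<in> \<int>" using D D0 by (auto simp: int_coeffs_def)
        then have "\<kappa> * fps_nth G n - fps_nth D n \<in> \<int>" using D G by (auto simp: int_coeffs_def)
        then obtain a where a: "\<kappa> * fps_nth G n - fps_nth D n = of_int a" by (rule Ints_cases)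
        obtain b where b: "\<kappa> = of_int b" using \<open>\<kappa> \<in> \<int>\<close> by (rule Ints_cases)
        have "f ?U = fls_const (of_int a / of_int b)" unfolding fU a unfolding b by (simp add: fls_of_int fls_const_divide_const)
        then show ?thesis unfolding m by blast
      qed
      then obtain c where "\<And>t. 1 \<le> t \<Longrightarrow> f (1 / ?Q ^ t) = fls_const (c t)" by metis
      then obtain c0 where c0: "\<And>U. U \<noteq> 0 \<Longrightarrow> f U = c0" using laurent_constant[OF lf] by blast
      have "f (1 / ?Q) = 0" unfolding f_def weight_series_prod_series_1 by simp
      moreover have "f (1 / ?Q) = c0" by (rule c0) (simp only: divide_eq_0_iff one_neq_zero Q_nonzero simp_thms)
      ultimately have "c0 = 0" by (simp only:)
      then show ?thesis using c0 by (auto simp: f_def)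
    qed
  qed
  then show ?thesis using assms by (intro fps_ext) blast
qed

section \<open>The sum over partitions\<close>

lemma fps_const_divide_unit:
  fixes a b :: "'a::field fps"
  assumes "fps_nth b 0 = 1"
  shows "fps_const a / fps_const b = fps_const (a / b)"
proof -
  have b: "b \<noteq> 0" using assms by auto
  have "b * inverse b = 1" using assms by (simp add: inverse_mult_eq_1')
  then have inv: "inverse (fps_const b) = fps_const (inverse b)"
    by (simp add: fps_const_inverse)
  have "fps_const a / fps_const b = fps_const a * inverse (fps_const b)"
    using b by (intro fps_divide_unit) simp
  then show ?thesis unfolding inv using assms by (simp add: fps_divide_unit)
qed

definition box_ratio :: "'a::field \<Rightarrow> int \<Rightarrow> nat \<Rightarrow> 'a fps" where
  "box_ratio u e h = (1 - fps_const (u powi (- 2 * e)) * fps_X ^ (2 * h)) / (1 - fps_X ^ (2 * h))"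

definition diag_ratio :: "'a::field \<Rightarrow> nat \<Rightarrow> 'a fps" where
  "diag_ratio u h = (1 - fps_const u * fps_X ^ h) / (1 - fps_const (u powi - 1) * fps_X ^ h)"

definition lhs_coeff :: "'a::field \<Rightarrow> nat list \<Rightarrow> 'a fps" where
  "lhs_coeff u l = (- 1) ^ durfee l * fps_const (u powi - int (durfee l)) *
     (\<Prod>s\<in>boxes l. box_ratio u (box_sign s) (hook l s)) * (\<Prod>s\<in>diag_boxes l. diag_ratio u (hook l s))"

abbreviation u_const :: "rat poly fract" where
  "u_const \<equiv> Fraction_Field.Fract [:0, 1:] 1"

lemma hook_pos: "0 < hook l s"
  by (cases s) (simp add: hook_def)

lemma lhs_term_eq: "lhs_term l = fps_const (lhs_coeff u_const l) * fps_X ^ (sum_list l div 2)"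
proof -
  have box: "(1 - u_pow (- 2 * e) * var_q ^ (2 * h)) / (1 - var_q ^ (2 * h)) = fps_const (box_ratio u_const e h)"
    if "0 < h" for e h
  proof -
    have "fps_const (1 - fps_const (u_const powi (- 2 * e)) * fps_X ^ (2 * h)) / fps_const (1 - fps_X ^ (2 * h)) =
        fps_const (box_ratio u_const e h)"
      unfolding box_ratio_def by (rule fps_const_divide_unit) (use that in simp)
    then show ?thesis unfolding u_pow_def var_q_def
      by (simp only: fps_const_power fps_const_mult fps_const_sub fps_const_1_eq_1[symmetric])
  qed
  have diag: "(1 - var_u * var_q ^ h) / (1 - u_pow (- 1) * var_q ^ h) = fps_const (diag_ratio u_const h)"
    if "0 < h" for h
  proof -
    have "fps_const (1 - fps_const u_const * fps_X ^ h) / fps_const (1 - fps_const (u_const powi - 1) * fps_X ^ h) =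
        fps_const (diag_ratio u_const h)"
      unfolding diag_ratio_def by (rule fps_const_divide_unit) (use that in simp)
    moreover have u: "var_u = fps_const (fps_const u_const)" by (simp add: var_u_def u_pow_def)
    ultimately show ?thesis unfolding u_pow_def var_q_def u
      by (simp only: fps_const_power fps_const_mult fps_const_sub fps_const_1_eq_1[symmetric])
  qed
  have "lhs_term l = (- 1) ^ durfee l * u_pow (- int (durfee l)) * var_T ^ (sum_list l div 2) *
     (\<Prod>s\<in>boxes l. fps_const (box_ratio u_const (box_sign s) (hook l s))) *
     (\<Prod>s\<in>diag_boxes l. fps_const (diag_ratio u_const (hook l s)))"
    unfolding lhs_term_def box[OF hook_pos] diag[OF hook_pos] ..
  also have "\<dots> = fps_const ((- 1) ^ durfee l) * fps_const (fps_const (u_const powi - int (durfee l))) * fps_X ^ (sum_list l div 2) *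
     fps_const (\<Prod>s\<in>boxes l. box_ratio u_const (box_sign s) (hook l s)) *
     fps_const (\<Prod>s\<in>diag_boxes l. diag_ratio u_const (hook l s))"
    unfolding u_pow_def var_T_def fps_const_prod by (simp add: fps_const_neg[symmetric] fps_const_power[symmetric])
  also have "\<dots> = fps_const (lhs_coeff u_const l) * fps_X ^ (sum_list l div 2)"
    unfolding lhs_coeff_def by (simp only: fps_const_mult[symmetric] mult_ac)
  finally show ?thesis .
qed

lemma fps_to_fls_divide_unit:
  fixes a b :: "'a::field fps"
  assumes "fps_nth b 0 = 1"
  shows "fps_to_fls (a / b) = fps_to_fls a / fps_to_fls b"
  by (rule fls_divide_fps_to_fls[symmetric]) (use assms in \<open>simp add: subdegree_eq_0_iff\<close>)

lemma fps_to_fls_one_minus: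
  "fps_to_fls (1 - fps_const c * fps_X ^ (2 * h)) = 1 - fls_const c * (fls_X\<^sup>2) ^ h"
  by (simp add: fls_times_fps_to_fls fps_to_fls_power power_mult)

lemma fps_to_fls_box_ratio:
  fixes u :: "'a::field"
  assumes "0 < h"
  shows "fps_to_fls (box_ratio u 1 h) = (1 - (fls_X\<^sup>2) ^ h / (fls_const u)\<^sup>2) / (1 - (fls_X\<^sup>2) ^ h)"
    and "fps_to_fls (box_ratio u (- 1) h) = (1 - (fls_const u)\<^sup>2 * (fls_X\<^sup>2) ^ h) / (1 - (fls_X\<^sup>2) ^ h)"
proof -
  have r: "fps_to_fls (box_ratio u e h) = (1 - fls_const (u powi (- 2 * e)) * (fls_X\<^sup>2) ^ h) / (1 - (fls_X\<^sup>2) ^ h)" for e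
  proof -
    have "fps_nth (1 - fps_X ^ (2 * h) :: 'a fps) 0 = 1" using assms by simp
    then show ?thesis unfolding box_ratio_def using fps_to_fls_one_minus[of "1 :: 'a" h]
      by (simp only: fps_to_fls_divide_unit fps_to_fls_one_minus) (simp add: fps_to_fls_power power_mult)
  qed
  show "fps_to_fls (box_ratio u 1 h) = (1 - (fls_X\<^sup>2) ^ h / (fls_const u)\<^sup>2) / (1 - (fls_X\<^sup>2) ^ h)"
    unfolding r by (simp add: fls_const_power fls_const_divide_const fls_inverse_const power_int_def divide_inverse mult.commute flip: power_inverse)
  show "fps_to_fls (box_ratio u (- 1) h) = (1 - (fls_const u)\<^sup>2 * (fls_X\<^sup>2) ^ h) / (1 - (fls_X\<^sup>2) ^ h)"
    unfolding r by (simp add: fls_const_power power_int_def)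
qed

lemma fls_one_minus_nonzero:
  assumes "0 < h"
  shows "1 - fls_const c * (fls_X\<^sup>2) ^ h \<noteq> (0 :: 'a::field fls)"
proof -
  have "fps_nth (1 - fps_const c * fps_X ^ (2 * h)) 0 \<noteq> fps_nth 0 0" using assms by simp
  then have "1 - fps_const c * fps_X ^ (2 * h) \<noteq> 0" by metis
  then show ?thesis unfolding fps_to_fls_one_minus[symmetric] by (simp only: fps_to_fls_eq_0_iff) simp
qed

text \<open>The first row and the first column share the hook lengths with c > 0, and their ratios
  multiply to \<open>hook_factor\<close>. The corner absorbs the denominator of the diagonal ratio,
  and the column box with c = 0 remains alone.\<close>

lemma lhs_coeff_DD'_of_Cons:
  fixes u :: "'a::field"
  assumes st: "strict (b # bs)" and u: "u \<noteq> 0"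
  shows "fps_to_fls (lhs_coeff u (DD'_of (b # bs))) =
    bead_weight (fls_const u) (fls_X\<^sup>2) (set bs) b * fps_to_fls (lhs_coeff u (DD'_of bs))"
proof -
  let ?U = "fls_const u" and ?Q = "(fls_X :: 'a fls)\<^sup>2"
  have b: "0 < b" "\<forall>c \<in> set bs. c < b" "strict bs" using st by (auto simp: strict_Cons)
  have b0: "\<forall>c \<in> set bs. 0 < c \<and> c < b" using b strict_pos by blast
  have U: "?U \<noteq> 0" using u by simp
  define A B where "A h = fps_to_fls (box_ratio u 1 h)" and "B h = fps_to_fls (box_ratio u (- 1) h)" for h
  have AB: "A h * B h = hook_factor ?U ?Q h" if "0 < h" for h
    unfolding A_def B_def fps_to_fls_box_ratio[OF that] hook_factor_def by (simp add: power2_eq_square)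
  have bh: "0 < bead_hook bs b c" if "c < b" for c using that by (simp add: bead_hook_def)
  have "(\<Prod>c<b. B (bead_hook bs b c)) = B b * (\<Prod>c=1..<b. B (bead_hook bs b c))"
  proof -
    have "{..<b} = insert 0 {1..<b}" using b(1) by auto
    moreover have "bead_hook bs b 0 = b" using b0 by (auto simp: bead_hook_def)
    ultimately show ?thesis by simp
  qed
  then have prods: "(\<Prod>c=1..<b. A (bead_hook bs b c)) * (\<Prod>c<b. B (bead_hook bs b c)) =
      B b * (\<Prod>c=1..<b. hook_factor ?U ?Q (bead_hook bs b c))"
    using AB bh by (simp add: prod.distrib[symmetric] mult.left_commute)
  have dg: "fps_to_fls (diag_ratio u (2 * b)) = (1 - ?U * ?Q ^ b) / (1 - ?Q ^ b / ?U)"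
  proof -
    have "fps_nth (1 - fps_const (u powi - 1) * fps_X ^ (2 * b)) 0 = 1" using b(1) by simp
    then show ?thesis unfolding diag_ratio_def
      by (simp only: fps_to_fls_divide_unit fps_to_fls_one_minus)
         (simp add: fls_inverse_const divide_inverse mult.commute)
  qed
  have Ad: "A (2 * b) * fps_to_fls (diag_ratio u (2 * b)) = (1 + ?Q ^ b / ?U) * (1 - ?U * ?Q ^ b) / (1 - ?Q ^ (2 * b))"
  proof -
    have "1 - fls_const (1 / u) * ?Q ^ b \<noteq> 0" by (rule fls_one_minus_nonzero[OF b(1)])
    then have nz: "1 - ?Q ^ b / ?U \<noteq> 0" by (simp add: fls_inverse_const divide_inverse mult.commute)
    have "1 - ?Q ^ (2 * b) / ?U\<^sup>2 = (1 - ?Q ^ b / ?U) * (1 + ?Q ^ b / ?U)"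
      by (simp add: algebra_simps power2_eq_square power_mult power_even_eq)
    moreover have "x * y / z * (w / x) = y * w / z" if "x \<noteq> 0" for x y z w :: "'a fls" using that by simp
    ultimately show ?thesis unfolding A_def dg fps_to_fls_box_ratio(1)[OF mult_pos_pos[OF zero_less_numeral b(1)]]
      using nz by (simp only:)
  qed
  have Bb: "B b = (1 - ?U\<^sup>2 * ?Q ^ b) / (1 - ?Q ^ b)" unfolding B_def by (rule fps_to_fls_box_ratio(2)[OF b(1)])
  have sgn: "fps_to_fls ((- 1) ^ length xs * fps_const (u powi - int (length xs))) = (- (1 / ?U)) ^ length xs" for xs :: "nat list"
    by (simp add: fls_times_fps_to_fls fps_to_fls_power power_int_minus fls_const_power fls_inverse_const[symmetric]
        divide_inverse power_minus[of "inverse ?U"] flip: power_inverse)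
  have expand: "fps_to_fls (lhs_coeff u (DD'_of cs)) = (- (1 / ?U)) ^ length cs *
      fps_to_fls (\<Prod>s\<in>boxes (DD'_of cs). box_ratio u (box_sign s) (hook (DD'_of cs) s)) *
      fps_to_fls (\<Prod>s\<in>diag_boxes (DD'_of cs). diag_ratio u (hook (DD'_of cs) s))" if "strict cs" for cs
    unfolding lhs_coeff_def durfee_DD'_of[OF that] sgn[symmetric] by (simp only: fls_times_fps_to_fls)
  have fps_to_fls_prod: "fps_to_fls (\<Prod>i\<in>I. f i) = (\<Prod>i\<in>I. fps_to_fls (f i))" for f :: "nat \<Rightarrow> 'a fps" and I
    by (induction I rule: infinite_finite_induct) (simp_all add: fls_times_fps_to_fls)
  have "fps_to_fls (lhs_coeff u (DD'_of (b # bs))) = - (1 / ?U) * (A (2 * b) * fps_to_fls (diag_ratio u (2 * b))) *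
      ((\<Prod>c=1..<b. A (bead_hook bs b c)) * (\<Prod>c<b. B (bead_hook bs b c))) * fps_to_fls (lhs_coeff u (DD'_of bs))"
    unfolding expand[OF st] expand[OF b(3)] prod_boxes_DD'_of_Cons[OF st] prod_diag_boxes_DD'_of_Cons[OF st]
      A_def B_def fls_times_fps_to_fls fps_to_fls_prod
    by (simp only: list.size power_Suc add_0_right add_Suc_right mult_ac)
  also have "\<dots> = bead_weight ?U ?Q (set bs) b * fps_to_fls (lhs_coeff u (DD'_of bs))"
    unfolding Ad prods unfolding Bb bead_weight_def bead_hook_def by (simp only: mult.assoc)
  finally show ?thesis .
qed

lemma lhs_coeff_DD'_of:
  assumes "u \<noteq> 0"
  shows "strict bs \<Longrightarrow> fps_to_fls (lhs_coeff u (DD'_of bs)) = weight (fls_const u) (fls_X\<^sup>2) (set bs)"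
proof (induction bs)
  case Nil
  have "boxes [] = {}" "diag_boxes [] = {}" by (auto simp: boxes_def diag_boxes_def)
  moreover have "durfee [] = 0" by (simp add: durfee_def)
  ultimately show ?case by (simp add: lhs_coeff_def weight_def)
next
  case (Cons b bs)
  then have b: "\<forall>c \<in> set bs. c < b" "strict bs" by (auto simp: strict_Cons)
  show ?case unfolding lhs_coeff_DD'_of_Cons[OF Cons.prems assms] Cons.IH[OF b(2)]
    using b(1) by (simp add: weight_insert)
qed

section \<open>Summability over partitions\<close>

lemma has_sum_monomials:
  fixes c :: "'i \<Rightarrow> 'a::comm_ring_1"
  assumes fin: "\<And>n. finite {i \<in> A. d i = n}"
  shows "((\<lambda>i. fps_const (c i) * fps_X ^ d i) has_sum Abs_fps (\<lambda>n. \<Sum>i | i \<in> A \<and> d i = n. c i)) A"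
  unfolding has_sum_def
proof (rule tendsto_fpsI)
  fix n
  show "\<forall>\<^sub>F F in finite_subsets_at_top A. fps_nth (\<Sum>i\<in>F. fps_const (c i) * fps_X ^ d i) n =
      fps_nth (Abs_fps (\<lambda>n. \<Sum>i | i \<in> A \<and> d i = n. c i)) n"
    unfolding eventually_finite_subsets_at_top
  proof (intro exI[of _ "{i \<in> A. d i = n}"] conjI fin allI impI)
    fix F assume F: "finite F \<and> {i \<in> A. d i = n} \<subseteq> F \<and> F \<subseteq> A"
    have "fps_nth (\<Sum>i\<in>F. fps_const (c i) * fps_X ^ d i) n = (\<Sum>i\<in>F. if d i = n then c i else 0)"
      unfolding fps_sum_nth by (intro sum.cong refl) simp
    also have "\<dots> = (\<Sum>i\<in>{i \<in> A. d i = n}. if d i = n then c i else 0)"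
      by (rule sum.mono_neutral_right) (use F in auto)
    finally show "fps_nth (\<Sum>i\<in>F. fps_const (c i) * fps_X ^ d i) n = fps_nth (Abs_fps (\<lambda>n. \<Sum>i | i \<in> A \<and> d i = n. c i)) n"
      by simp
  qed auto
qed

lemma bij_betw_strict_sets: "bij_betw set {bs. strict bs \<and> sum_list bs = n} (strict_sets n)"
proof (rule bij_betw_byWitness[where f' = "\<lambda>S. rev (sorted_list_of_set S)"])
  have ds: "sorted_wrt (<) (rev bs) \<and> distinct bs" if "strict bs" for bs
  proof -
    have "sorted_wrt (<) (rev bs)" using that by (simp add: strict_def sorted_wrt_rev)
    then show ?thesis using strict_sorted_iff[of "rev bs"] by simp
  qed
  show "\<forall>bs\<in>{bs. strict bs \<and> sum_list bs = n}. rev (sorted_list_of_set (set bs)) = bs"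
  proof clarify
    fix bs assume "strict bs"
    then have "sorted_list_of_set (set (rev bs)) = rev bs"
      using ds by (intro sorted_list_of_set.idem_if_sorted_distinct) (auto simp: strict_sorted_iff)
    then show "rev (sorted_list_of_set (set bs)) = bs" by simp
  qed
  show "\<forall>S\<in>strict_sets n. set (rev (sorted_list_of_set S)) = S"
    by (auto simp: strict_sets_def)
  show "set ` {bs. strict bs \<and> sum_list bs = n} \<subseteq> strict_sets n"
    using ds strict_pos by (fastforce simp: strict_sets_def distinct_sum_list_conv_Sum)
  show "(\<lambda>S. rev (sorted_list_of_set S)) ` strict_sets n \<subseteq> {bs. strict bs \<and> sum_list bs = n}"
    by (auto simp: strict_sets_def strict_def sorted_wrt_rev distinct_sum_list_conv_Sum strict_sorted_list_of_set)
qed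

lemma lhs_has_sum:
  "\<exists>S. (lhs_term has_sum S) DD' \<and>
    (\<forall>n. fps_to_fls (fps_nth S n) = fps_nth (weight_series (fls_const u_const) (fls_X\<^sup>2)) n)"
proof -
  let ?d = "\<lambda>l. sum_list l div 2" and ?c = "lhs_coeff u_const"
  have u: "u_const \<noteq> 0" by (simp add: Zero_fract_def eq_fract)
  have set: "{l \<in> DD'. ?d l = n} = DD'_of ` {bs. strict bs \<and> sum_list bs = n}" for n
    unfolding DD'_eq by (auto simp: sum_list_DD'_of)
  have inj: "inj_on DD'_of {bs. strict bs \<and> sum_list bs = n}" for n
    by (rule inj_on_subset[OF inj_DD'_of]) auto
  have "finite {bs. strict bs \<and> sum_list bs = n}" for n
    using bij_betw_finite[OF bij_betw_strict_sets] finite_strict_sets by blast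
  then have "finite {l \<in> DD'. ?d l = n}" for n unfolding set by simp
  then have "(lhs_term has_sum Abs_fps (\<lambda>n. \<Sum>l | l \<in> DD' \<and> ?d l = n. ?c l)) DD'"
    unfolding lhs_term_eq by (rule has_sum_monomials)
  moreover have "fps_to_fls (\<Sum>l | l \<in> DD' \<and> ?d l = n. ?c l) = fps_nth (weight_series (fls_const u_const) (fls_X\<^sup>2)) n" for n
  proof -
    have fps_to_fls_sum: "fps_to_fls (\<Sum>i\<in>I. f i) = (\<Sum>i\<in>I. fps_to_fls (f i))"
      for f :: "nat list \<Rightarrow> rat poly fract fps" and I
      by (induction I rule: infinite_finite_induct) simp_all
    have "fps_to_fls (\<Sum>l | l \<in> DD' \<and> ?d l = n. ?c l) = (\<Sum>bs | strict bs \<and> sum_list bs = n. fps_to_fls (?c (DD'_of bs)))"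
      unfolding set fps_to_fls_sum by (simp add: sum.reindex[OF inj])
    also have "\<dots> = (\<Sum>bs | strict bs \<and> sum_list bs = n. weight (fls_const u_const) (fls_X\<^sup>2) (set bs))"
      by (intro sum.cong refl lhs_coeff_DD'_of[OF u]) auto
    also have "\<dots> = (\<Sum>S\<in>strict_sets n. weight (fls_const u_const) (fls_X\<^sup>2) S)"
      by (rule sum.reindex_bij_betw[OF bij_betw_strict_sets])
    finally show ?thesis by (simp add: weight_series_def)
  qed
  ultimately show ?thesis by (intro exI[of _ "Abs_fps (\<lambda>n. \<Sum>l | l \<in> DD' \<and> ?d l = n. ?c l)"]) simp
qed

section \<open>The infinite product\<close>

abbreviation half_up :: "nat \<Rightarrow> nat" where
  "half_up r \<equiv> Suc r div 2"

lemma nat_ceiling_half: "nat \<lceil>real r / 2\<rceil> = half_up r"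
proof -
  have "\<lceil>real r / 2\<rceil> = int (half_up r)"
    by (rule ceiling_unique) (cases "even r"; auto elim!: evenE oddE)+
  then show ?thesis by simp
qed

definition factor_exponent :: "'a::comm_ring_1 \<Rightarrow> 'a \<Rightarrow> 'a \<Rightarrow> nat \<Rightarrow> 'a" where
  "factor_exponent V V' Y r = - (V' * Y ^ (r - 1)) + V * Y ^ r
     - of_nat (half_up r) * (V'\<^sup>2 * Y ^ r + V\<^sup>2 * Y ^ Suc r)
     + of_nat (half_up (Suc r)) * Y ^ r + of_nat (half_up r) * Y ^ (r + 2)"

text \<open>The source is the series of half_up(r) Y^r, which is Y / ((1 - Y) (1 - Y^2)). Partial
  sums are given with an explicit remainder divisible by Y^R; \<open>Z\<close> is the solution of
  the recurrence that the induction imposes, in which the two half-integer counts (a, b) become (b,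
  a + 1).\<close>

lemma factor_exponent_sum:
  fixes V V' Y :: "'a::comm_ring_1"
  defines "Z \<equiv> \<lambda>a b. (1 - Y\<^sup>2) * (- V' + V * Y) - (V'\<^sup>2 + V\<^sup>2 * Y) * ((1 - Y) * (a * Y + b * Y\<^sup>2) + Y ^ 3)
       + (1 - Y) * (b * Y + (a + 1) * Y\<^sup>2) + Y ^ 3 + Y\<^sup>2 * ((1 - Y) * (a * Y + b * Y\<^sup>2) + Y ^ 3)"
  shows "(1 - Y) * (1 - Y\<^sup>2) * (\<Sum>r=1..R. factor_exponent V V' Y r) +
       Y ^ R * Z (of_nat (half_up (R + 1))) (of_nat (half_up (R + 2))) =
     (- V' + V * Y) * (1 - Y\<^sup>2) + (1 + Y ^ 3 - Y * V'\<^sup>2 - V\<^sup>2 * Y\<^sup>2) - (1 - Y) * (1 - Y\<^sup>2)"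
proof (induction R)
  case 0
  show ?case by (simp add: Z_def algebra_simps power2_eq_square power3_eq_cube)
next
  case (Suc R)
  define a b where "a = (of_nat (half_up (R + 1)) :: 'a)" and "b = (of_nat (half_up (R + 2)) :: 'a)"
  have ab: "of_nat (half_up (Suc R)) = a" "of_nat (half_up (Suc (Suc R))) = b"
      "of_nat (half_up (Suc R + 1)) = b" "of_nat (half_up (Suc R + 2)) = a + 1"
    by (simp_all add: a_def b_def)
  have f: "factor_exponent V V' Y (Suc R) = Y ^ R * (- V' + V * Y - a * (V'\<^sup>2 * Y + V\<^sup>2 * Y\<^sup>2) + b * Y + a * Y ^ 3)"
    unfolding factor_exponent_def ab by (simp add: algebra_simps power2_eq_square power3_eq_cube)
  have Z: "Z a b = (1 - Y) * (1 - Y\<^sup>2) * (- V' + V * Y - a * (V'\<^sup>2 * Y + V\<^sup>2 * Y\<^sup>2) + b * Y + a * Y ^ 3) + Y * Z b (a + 1)"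
    unfolding Z_def by (simp add: algebra_simps power2_eq_square power3_eq_cube)
  have "(1 - Y) * (1 - Y\<^sup>2) * (\<Sum>r=1..Suc R. factor_exponent V V' Y r) + Y ^ Suc R * Z b (a + 1) =
      (1 - Y) * (1 - Y\<^sup>2) * (\<Sum>r=1..R. factor_exponent V V' Y r) + Y ^ R * Z a b"
    unfolding Z by (simp add: f algebra_simps)
  then show ?case using Suc.IH unfolding ab a_def[symmetric] b_def[symmetric] by simp
qed

text \<open>\<open>prod_exponent\<close> at j-th powers, kept in the ring of power series in q,
  where the sum over r converges.\<close>

definition total_exponent :: "'a::field \<Rightarrow> nat \<Rightarrow> 'a fps" where
  "total_exponent u j = (let V = fps_const (u ^ j); V' = fps_const (1 / u ^ j); Y = fps_X ^ (2 * j) in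
     (- V' + V * Y) / (1 - Y) + (1 + Y ^ 3 - Y * V'\<^sup>2 - V\<^sup>2 * Y\<^sup>2) / ((1 - Y) * (1 - Y\<^sup>2)) - 1)"

lemma fps_to_fls_total_exponent:
  assumes "1 \<le> j"
  shows "fps_to_fls (total_exponent u j) = prod_exponent (fls_const u ^ j) ((fls_X\<^sup>2) ^ j)"
proof -
  define Y where "Y = (fps_X ^ (2 * j) :: 'a fps)"
  have Y0: "fps_nth Y 0 = 0" using assms by (simp add: Y_def)
  have 1: "fps_nth (1 - Y) 0 = 1" "fps_nth ((1 - Y) * (1 - Y\<^sup>2)) 0 = 1" using Y0 by (simp_all add: power2_eq_square)
  have Y: "fps_to_fls Y = (fls_X\<^sup>2) ^ j" by (simp add: Y_def fps_to_fls_power power_mult)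
  show ?thesis unfolding total_exponent_def Let_def Y_def[symmetric] prod_exponent_def
    by (simp only: fps_to_fls_plus fps_to_fls_minus fps_to_fls_divide_unit[OF 1(1)] fps_to_fls_divide_unit[OF 1(2)])
       (simp add: Y fls_times_fps_to_fls fps_to_fls_power fls_const_power fls_inverse_const[symmetric] divide_inverse
          power_inverse mult.commute)
qed

text \<open>Every term contains Y^(r - 1), hence a power of q with exponent 2 j (r - 1) > e.\<close>

lemma factor_exponent_nth:
  fixes c d :: "'a::field"
  assumes j: "1 \<le> j" and r: "e + 2 \<le> r"
  shows "fps_nth (factor_exponent (fps_const c) (fps_const d) (fps_X ^ (2 * j)) r) e = 0"
proof -
  obtain s where s: "r = Suc s" using r by (cases r) auto
  have "factor_exponent V V' Y r = Y ^ s * (- V' + V * Y - of_nat (half_up r) * (V'\<^sup>2 * Y + V\<^sup>2 * Y\<^sup>2)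
     + of_nat (half_up (Suc r)) * Y + of_nat (half_up r) * Y ^ 3)" for V V' Y :: "'a fps"
    unfolding factor_exponent_def s by (simp add: algebra_simps power2_eq_square power3_eq_cube)
  moreover have "e < 2 * j * s"
  proof -
    have "1 * s \<le> 2 * j * s" using j by (intro mult_le_mono1) simp
    then show ?thesis using r s by linarith
  qed
  ultimately obtain Z where "factor_exponent (fps_const c) (fps_const d) (fps_X ^ (2 * j)) r = fps_X ^ (2 * j * s) * Z"
      and "e < 2 * j * s"
    unfolding power_mult by blast
  then show ?thesis by (simp only: fps_X_power_mult_nth) simp
qed

lemma factor_exponent_sum_nth:
  fixes u :: "'a::field"
  assumes j: "1 \<le> j" and G: "finite G" "{1..e + 2} \<subseteq> G" "0 \<notin> G"
  shows "fps_nth (\<Sum>r\<in>G. factor_exponent (fps_const (u ^ j)) (fps_const (1 / u ^ j)) (fps_X ^ (2 * j)) r) e =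
    fps_nth (total_exponent u j) e"
proof -
  define V V' Y where "V = fps_const (u ^ j)" and "V' = fps_const (1 / u ^ j)" and "Y = (fps_X ^ (2 * j) :: 'a fps)"
  let ?f = "factor_exponent V V' Y" and ?R = "e + 2"
  define D where "D = (1 - Y) * (1 - Y\<^sup>2)"
  have Y0: "fps_nth Y 0 = 0" using j by (simp add: Y_def)
  have 1: "fps_nth (1 - Y) 0 = 1" "fps_nth D 0 = 1" using Y0 by (simp_all add: power2_eq_square D_def)
  have inv: "f / g * g = f" if "fps_nth g 0 = 1" for f g :: "'a fps"
    using that by (simp add: fps_divide_unit mult.assoc inverse_mult_eq_1)
  have "fps_nth (\<Sum>r\<in>G. ?f r) e = fps_nth (\<Sum>r=1..?R. ?f r) e"
    unfolding fps_sum_nth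
  proof (rule sum.mono_neutral_right[OF G(1,2)], rule ballI)
    fix r assume "r \<in> G - {1..?R}"
    then have "?R \<le> r" using G(3) by (cases "r = 0") auto
    then show "fps_nth (?f r) e = 0" unfolding V_def V'_def Y_def by (rule factor_exponent_nth[OF j])
  qed
  also have "\<dots> = fps_nth (total_exponent u j) e"
  proof -
    define T where "T = (\<Sum>r=1..?R. ?f r)"
    obtain Z where Z: "D * T + Y ^ ?R * Z =
       (- V' + V * Y) * (1 - Y\<^sup>2) + (1 + Y ^ 3 - Y * V'\<^sup>2 - V\<^sup>2 * Y\<^sup>2) - D"
      unfolding D_def T_def using factor_exponent_sum[of Y V V' ?R] by blast
    have alg: "x * y * (a + b - 1) = a * x * y + b * (x * y) - x * y" for a b x y :: "'a fps"
      by (simp add: algebra_simps)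
    have "D * total_exponent u j = (- V' + V * Y) / (1 - Y) * (1 - Y) * (1 - Y\<^sup>2) +
        (1 + Y ^ 3 - Y * V'\<^sup>2 - V\<^sup>2 * Y\<^sup>2) / D * D - D"
      unfolding total_exponent_def Let_def V_def[symmetric] V'_def[symmetric] Y_def[symmetric] D_def by (rule alg)
    also have "\<dots> = (- V' + V * Y) * (1 - Y\<^sup>2) + (1 + Y ^ 3 - Y * V'\<^sup>2 - V\<^sup>2 * Y\<^sup>2) - D"
      unfolding inv[OF 1(1)] inv[OF 1(2)] ..
    finally have *: "D * (total_exponent u j - T) = Y ^ ?R * Z"
      unfolding right_diff_distrib[of D] Z[symmetric] by (simp only: add_diff_cancel_left')
    have "inverse D * D = 1" using 1(2) by (simp add: inverse_mult_eq_1)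
    then have "total_exponent u j - T = inverse D * (D * (total_exponent u j - T))"
      by (simp only: mult.assoc[symmetric] mult_1)
    also have "\<dots> = fps_X ^ (2 * j * ?R) * (Z * inverse D)"
      unfolding * Y_def power_mult by (simp only: mult_ac)
    finally have eq: "total_exponent u j - T = fps_X ^ (2 * j * ?R) * (Z * inverse D)" .
    have "e < ?R" by simp
    also have "\<dots> = 1 * ?R" by simp
    also have "\<dots> \<le> 2 * j * ?R" using j by (intro mult_le_mono1) simp
    finally have "fps_nth (total_exponent u j - T) e = 0"
      unfolding eq by (simp only: fps_X_power_mult_nth) simp
    then show ?thesis by (simp add: T_def)
  qed
  finally show ?thesis unfolding V_def V'_def Y_def .
qed

section \<open>Convergence of the double product\<close>

definition rhs_dlog :: "'a::field \<Rightarrow> nat \<Rightarrow> nat \<Rightarrow> 'a fps fps" where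
  "rhs_dlog u m r = Abs_fps (\<lambda>k. if 0 < k \<and> m dvd k then of_nat m *
     factor_exponent (fps_const (u ^ (k div m))) (fps_const (1 / u ^ (k div m))) (fps_X ^ (2 * (k div m))) r else 0)"

lemma fps_divide_unit_mult:
  fixes f g :: "'a::field fps fps"
  assumes "fps_nth g 0 = 1"
  shows "f / g * g = f"
proof -
  have "g * inverse g = 1"
    unfolding fps_inverse_def[of g] by (rule fps_right_inverse) (use assms in simp)
  then show ?thesis using assms by (simp add: fps_divide_unit mult.assoc mult.commute[of "inverse g"])
qed

lemma has_dlog_divide:
  fixes f g :: "'a::field fps fps"
  assumes "has_dlog f s" "has_dlog g t"
  shows "has_dlog (f / g) (s - t)"
  by (rule has_dlog_quotient[OF fps_divide_unit_mult assms]) (use assms(2) in \<open>simp add: has_dlog_def\<close>)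

lemma has_dlog_rhs_factor:
  assumes m: "0 < m"
  shows "has_dlog (rhs_factor m r) (rhs_dlog u_const m r)"
proof -
  let ?u = u_const
  define b where "b i n = fps_const (?u powi i) * (fps_X :: rat poly fract fps) ^ n" for i n
  have u: "?u \<noteq> 0" by (simp add: Zero_fract_def eq_fract)
  have lin: "1 - u_pow i * var_q ^ n * var_T ^ m = 1 - fps_X ^ m * fps_const (b i n)" for i n
    unfolding u_pow_def var_q_def var_T_def b_def by (simp add: mult_ac flip: fps_const_mult fps_const_power)
  have q: "1 - var_q ^ n * var_T ^ m = 1 - fps_X ^ m * fps_const (b 0 n)" for n
    using lin[of 0 n] by (simp add: u_pow_def)
  have b_pow: "b i n ^ j = fps_const (?u powi (i * int j)) * (fps_X ^ (2 * j)) ^ n'" if "n = 2 * n'" for i n n' j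
    unfolding b_def that by (simp add: power_mult_distrib fps_const_power power_int_mult mult_ac flip: power_mult)
  have pw: "?u powi (- 1 * int j) = 1 / ?u ^ j" "?u powi (1 * int j) = ?u ^ j" "?u powi (0 * int j) = 1"
      "?u powi (- 2 * int j) = (1 / ?u ^ j)\<^sup>2" "?u powi (2 * int j) = (?u ^ j)\<^sup>2" for j
  proof -
    have "(?u ^ j)\<^sup>2 = ?u powi (int j + int j)" by (simp only: power_int_add[OF disjI1[OF u]] power_int_of_nat power2_eq_square)
    then have sq: "?u powi (int j + int j) = (?u ^ j)\<^sup>2" ..
    show "?u powi (- 1 * int j) = 1 / ?u ^ j" by (simp add: power_int_minus divide_inverse)
    show "?u powi (1 * int j) = ?u ^ j" "?u powi (0 * int j) = 1" by simp_all
    show "?u powi (2 * int j) = (?u ^ j)\<^sup>2" unfolding sq[symmetric] by simp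
    then show "?u powi (- 2 * int j) = (1 / ?u ^ j)\<^sup>2" by (simp add: power_int_minus divide_inverse power_inverse)
  qed
  have "has_dlog (rhs_factor m r)
    (lin_dlog m (b (- 1) (2 * (r - 1))) - lin_dlog m (b 1 (2 * r)) +
     ((of_nat (half_up r) * lin_dlog m (b (- 2) (2 * r)) + of_nat (half_up r) * lin_dlog m (b 2 (2 * (r + 1)))) -
      (of_nat (half_up (r + 1)) * lin_dlog m (b 0 (2 * r)) + of_nat (half_up r) * lin_dlog m (b 0 (2 * (r + 2))))))"
    unfolding rhs_factor_def nat_ceiling_half var_u_def lin q
    by (intro has_dlog_mult has_dlog_divide has_dlog_power has_dlog_lin m)
  also have "(lin_dlog m (b (- 1) (2 * (r - 1))) - lin_dlog m (b 1 (2 * r)) +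
     ((of_nat (half_up r) * lin_dlog m (b (- 2) (2 * r)) + of_nat (half_up r) * lin_dlog m (b 2 (2 * (r + 1)))) -
      (of_nat (half_up (r + 1)) * lin_dlog m (b 0 (2 * r)) + of_nat (half_up r) * lin_dlog m (b 0 (2 * (r + 2)))))) =
     rhs_dlog ?u m r" (is "?l = _")
  proof (rule fps_ext)
    fix k
    show "fps_nth ?l k = fps_nth (rhs_dlog ?u m r) k"
    proof (cases "0 < k \<and> m dvd k")
      case False
      then show ?thesis by (auto simp: lin_dlog_def rhs_dlog_def fps_of_nat[symmetric])
    next
      case True
      let ?j = "k div m"
      have "fps_nth ?l k = of_nat m * (- (b (- 1) (2 * (r - 1)) ^ ?j) + b 1 (2 * r) ^ ?j
          - of_nat (half_up r) * (b (- 2) (2 * r) ^ ?j + b 2 (2 * (r + 1)) ^ ?j)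
          + of_nat (half_up (r + 1)) * b 0 (2 * r) ^ ?j + of_nat (half_up r) * b 0 (2 * (r + 2)) ^ ?j)"
        using True by (simp add: lin_dlog_def fps_of_nat[symmetric] algebra_simps)
      also have "\<dots> = fps_nth (rhs_dlog ?u m r) k"
        using True unfolding b_pow[OF refl] pw
        by (simp add: rhs_dlog_def factor_exponent_def fps_const_power algebra_simps)
      finally show ?thesis .
    qed
  qed
  finally show ?thesis .
qed

definition total_dlog :: "'a::field \<Rightarrow> nat \<Rightarrow> 'a fps" where
  "total_dlog u k = (\<Sum>j | 1 \<le> j \<and> j dvd k. of_nat (k div j) * total_exponent u j)"

lemma fps_to_fls_total_dlog: "fps_to_fls (total_dlog u k) = prod_dlog (fls_const u) (fls_X\<^sup>2) k"
proof -
  have s: "fps_to_fls (\<Sum>i\<in>I. f i) = (\<Sum>i\<in>I. fps_to_fls (f i))" for f :: "nat \<Rightarrow> 'a fps" and I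
    by (induction I rule: infinite_finite_induct) simp_all
  show ?thesis unfolding total_dlog_def prod_dlog_def s
    by (intro sum.cong refl) (simp add: fls_times_fps_to_fls fps_to_fls_of_nat fps_to_fls_total_exponent)
qed

text \<open>At T^k only the divisors m of k contribute, and at q^e only finitely many r. A finite
  set containing the rectangle therefore gives the value of the full sum.\<close>

lemma rhs_dlog_sum_nth:
  assumes k: "1 \<le> k" "k \<le> n" and F: "finite F" "{1..n} \<times> {1..e + 2} \<subseteq> F" "F \<subseteq> {1..} \<times> {1..}"
  shows "fps_nth (fps_nth (\<Sum>(m, r)\<in>F. rhs_dlog u m r) k) e = fps_nth (total_dlog u k) e"
proof -
  define D where "D = {m. 1 \<le> m \<and> m dvd k}"
  have finD: "finite D" unfolding D_def by (rule finite_subset[of _ "{..k}"]) (use k in \<open>auto dest: dvd_imp_le\<close>)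
  define G where "G m = {r. (m, r) \<in> F}" for m
  have finG: "finite (G m)" for m
    unfolding G_def by (rule finite_subset[of _ "snd ` F"]) (use F(1) in force)+
  define f where "f m r = factor_exponent (fps_const (u ^ (k div m))) (fps_const (1 / u ^ (k div m))) (fps_X ^ (2 * (k div m))) r" for m r
  have "fps_nth (\<Sum>(m, r)\<in>F. rhs_dlog u m r) k = (\<Sum>(m, r)\<in>F. if m \<in> D then of_nat m * f m r else 0)"
    unfolding fps_sum_nth using k F(3) by (intro sum.cong refl) (auto simp: rhs_dlog_def D_def f_def)
  also have "\<dots> = (\<Sum>(m, r)\<in>Sigma D G. of_nat m * f m r)"
    by (rule sum.mono_neutral_cong_right[OF F(1)]) (auto simp: G_def split: if_splits)
  also have "\<dots> = (\<Sum>m\<in>D. of_nat m * (\<Sum>r\<in>G m. f m r))"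
    using finD finG by (simp add: sum.Sigma sum_distrib_left)
  finally have eq: "fps_nth (\<Sum>(m, r)\<in>F. rhs_dlog u m r) k = (\<Sum>m\<in>D. of_nat m * (\<Sum>r\<in>G m. f m r))" .
  have "fps_nth (fps_nth (\<Sum>(m, r)\<in>F. rhs_dlog u m r) k) e = (\<Sum>m\<in>D. of_nat m * fps_nth (\<Sum>r\<in>G m. f m r) e)"
    unfolding eq fps_sum_nth[of _ D] by (simp add: fps_of_nat[symmetric])
  also have "\<dots> = (\<Sum>m\<in>D. of_nat m * fps_nth (total_exponent u (k div m)) e)"
  proof (intro sum.cong refl arg_cong2[of _ _ _ _ "(*)"])
    fix m assume m: "m \<in> D"
    then have m': "1 \<le> m" "m dvd k" by (auto simp: D_def)
    then have "m \<le> k" using k by (auto dest: dvd_imp_le)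
    then have "1 \<le> k div m" using m' by (simp add: Suc_le_eq div_greater_zero_iff)
    moreover have "{1..e + 2} \<subseteq> G m" using F(2) m' \<open>m \<le> k\<close> k by (auto simp: G_def)
    moreover have "0 \<notin> G m" using F(3) by (auto simp: G_def)
    ultimately show "fps_nth (\<Sum>r\<in>G m. f m r) e = fps_nth (total_exponent u (k div m)) e"
      unfolding f_def using finG by (intro factor_exponent_sum_nth)
  qed
  also have "\<dots> = (\<Sum>j\<in>D. of_nat (k div j) * fps_nth (total_exponent u j) e)"
    by (rule sum.reindex_bij_witness[of _ "\<lambda>j. k div j" "\<lambda>j. k div j"])
       (use k in \<open>auto simp: D_def elim!: dvdE\<close>)
  also have "\<dots> = fps_nth (total_dlog u k) e"
    unfolding total_dlog_def D_def by (simp only: fps_sum_nth) (simp add: fps_of_nat[symmetric])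
  finally show ?thesis .
qed

text \<open>The logarithmic derivative expresses the coefficient at T^n q^e through coefficients of
  lower degree in T and degree at most e in q, for which the same rectangle is large enough.
  \<open>P\<close> obeys the same recurrence with the limiting logarithmic derivative.\<close>

lemma prod_nth_eq:
  fixes u :: "'a::field_char_0" and P :: "nat \<Rightarrow> 'a fps"
  assumes P0: "P 0 = 1" and PS: "\<And>n. of_nat (Suc n) * P (Suc n) = (\<Sum>i\<le>n. total_dlog u (Suc i) * P (n - i))"
    and f: "\<And>m r. 0 < m \<Longrightarrow> has_dlog (f m r) (rhs_dlog u m r)"
    and F: "finite F" "F \<subseteq> {1..} \<times> {1..}"
  shows "{1..n} \<times> {1..e + 2} \<subseteq> F \<Longrightarrow> fps_nth (fps_nth (\<Prod>(m, r)\<in>F. f m r) n) e = fps_nth (P n) e"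
proof (induction n arbitrary: e rule: less_induct)
  case (less n)
  let ?p = "\<Prod>(m, r)\<in>F. f m r" and ?s = "\<Sum>(m, r)\<in>F. rhs_dlog u m r"
  have dl: "has_dlog ?p ?s"
  proof (rule has_dlog_prod, clarify)
    fix m r assume "(m, r) \<in> F"
    then have "0 < m" using F(2) by auto
    then show "has_dlog (f m r) (rhs_dlog u m r)" by (rule f)
  qed
  show ?case
  proof (cases n)
    case 0
    then show ?thesis using dl by (simp add: has_dlog_def P0)
  next
    case (Suc n')
    have conv: "fps_nth (of_nat (Suc n') * a) e = of_nat (Suc n') * fps_nth a e" for a :: "'a fps"
      by (simp add: fps_of_nat[symmetric] del: of_nat_Suc)
    have "of_nat (Suc n') * fps_nth (fps_nth ?p n) e =
        (\<Sum>i\<le>n'. \<Sum>d=0..e. fps_nth (fps_nth ?s (Suc i)) d * fps_nth (fps_nth ?p (n' - i)) (e - d))"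
      unfolding conv[symmetric] Suc has_dlog_nth_Suc[OF dl] by (simp only: fps_sum_nth fps_mult_nth)
    also have "\<dots> = (\<Sum>i\<le>n'. \<Sum>d=0..e. fps_nth (total_dlog u (Suc i)) d * fps_nth (P (n' - i)) (e - d))"
    proof (intro sum.cong refl arg_cong2[of _ _ _ _ "(*)"])
      fix i d assume i: "i \<in> {..n'}" and d: "d \<in> {0..e}"
      have sub: "{1..a} \<times> {1..c + 2} \<subseteq> F" if "a \<le> n" "c \<le> e" for a c
        using less.prems that by (fastforce simp: subset_iff)
      show "fps_nth (fps_nth ?s (Suc i)) d = fps_nth (total_dlog u (Suc i)) d"
        by (rule rhs_dlog_sum_nth[of _ n]) (use F sub[of n d] i d Suc in auto)
      show "fps_nth (fps_nth ?p (n' - i)) (e - d) = fps_nth (P (n' - i)) (e - d)"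
        by (rule less.IH) (use sub[of "n' - i" "e - d"] i Suc in auto)
    qed
    also have "\<dots> = of_nat (Suc n') * fps_nth (P n) e"
      unfolding conv[symmetric] Suc PS by (simp only: fps_sum_nth fps_mult_nth)
    finally show ?thesis by (simp del: of_nat_Suc)
  qed
qed

theorem theorem6p5:
  shows "lhs_term summable_on DD' \<and>
    fps_has_prod (\<lambda>(m, r). rhs_factor m r) ({1..} \<times> {1..}) (\<Sum>\<^sub>\<infinity>l\<in>DD'. lhs_term l)"
proof -
  let ?U = "fls_const u_const" and ?Q = "(fls_X :: rat poly fract fls)\<^sup>2"
  obtain S where S: "(lhs_term has_sum S) DD'" and w: "\<And>n. fps_to_fls (fps_nth S n) = fps_nth (weight_series ?U ?Q) n"
    using lhs_has_sum by blast
  have u: "u_const \<noteq> 0" by (simp add: Zero_fract_def eq_fract)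
  have P: "fps_to_fls (fps_nth S n) = exp_coeff (prod_dlog ?U ?Q) n" for n
    using weight_series_eq_prod_series[of ?U] u by (simp add: w prod_series_def)
  have P0: "fps_nth S 0 = 1" using P[of 0] by simp
  have fps_to_fls_sum: "fps_to_fls (\<Sum>i\<in>I. f i) = (\<Sum>i\<in>I. fps_to_fls (f i))"
    for f :: "nat \<Rightarrow> rat poly fract fps" and I
    by (induction I rule: infinite_finite_induct) simp_all
  \<comment> \<open>The identity was obtained over Laurent series in q. The embedding of power
    series is injective, so the recurrence for the coefficients descends.\<close>
  have PS: "of_nat (Suc n) * fps_nth S (Suc n) = (\<Sum>i\<le>n. total_dlog u_const (Suc i) * fps_nth S (n - i))" for n
  proof -
    have "fps_to_fls (of_nat (Suc n) * fps_nth S (Suc n)) = (\<Sum>i\<le>n. prod_dlog ?U ?Q (Suc i) * exp_coeff (prod_dlog ?U ?Q) (n - i))"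
      unfolding fls_times_fps_to_fls fps_to_fls_of_nat P by (simp del: of_nat_Suc)
    also have "\<dots> = fps_to_fls (\<Sum>i\<le>n. total_dlog u_const (Suc i) * fps_nth S (n - i))"
      unfolding fps_to_fls_sum fls_times_fps_to_fls P fps_to_fls_total_dlog ..
    finally show ?thesis by (simp only: fps_to_fls_eq_iff)
  qed
  have "fps_has_prod (\<lambda>(m, r). rhs_factor m r) ({1..} \<times> {1..}) S"
    unfolding fps_has_prod_def
  proof (intro allI tendsto_fpsI)
    fix n e
    show "\<forall>\<^sub>F F in finite_subsets_at_top ({1..} \<times> {1..}).
        fps_nth (fps_nth (\<Prod>i\<in>F. case i of (m, r) \<Rightarrow> rhs_factor m r) n) e = fps_nth (fps_nth S n) e"
      unfolding eventually_finite_subsets_at_top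
    \<comment> \<open>Factors with m > n are 1 modulo T^(n + 1), and those with r > e + 2 are 1
      modulo q^(e + 1).\<close>
    proof (intro exI[of _ "{1..n} \<times> {1..e + 2}"] conjI allI impI)
      fix F :: "(nat \<times> nat) set" assume F: "finite F \<and> {1..n} \<times> {1..e + 2} \<subseteq> F \<and> F \<subseteq> {1..} \<times> {1..}"
      show "fps_nth (fps_nth (\<Prod>i\<in>F. case i of (m, r) \<Rightarrow> rhs_factor m r) n) e = fps_nth (fps_nth S n) e"
        by (rule prod_nth_eq[OF P0 PS has_dlog_rhs_factor]) (use F in auto)
    qed auto
  qed
  then show ?thesis using S infsumI[OF S] by (auto simp: summable_on_def)
qed

end
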